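(* Let $\tau>0$, $q>0$, and let $\varepsilon_1,\varepsilon_2,c_1,c_2\in C([0,1])$ with $\varepsilon_1,\varepsilon_2>0$ on $[0,1]$. Consider, for $(x,t)\in[0,1]\times\mathbb R^+$, the system $$\partial_tu_1(x,t)=-\varepsilon_1(x)\partial_xu_1(x,t)+c_1(x)u_2(x,t),$$ $$\partial_tu_2(x,t)=\varepsilon_2(x)\partial_xu_2(x,t)+c_2(x)u_1(x,t),$$ $$u_1(0,t)=q\,u_2(0,t),\qquad u_2(1,t)=v(0,t),$$ $$\tau\,\partial_tv(x,t)=\partial_xv(x,t),\qquad v(1,t)=U(t),$$ with the control law $$U(t)=\int_0^1p(1-y)v(y,t)\,dy+\int_0^1\alpha_1(1,y)u_1(y,t)\,dy+\int_0^1\alpha_2(1,y)u_2(y,t)\,dy,$$ where the gains $p,\alpha_1,\alpha_2$ are the kernel functions defined in the context. Then for any initial conditions $u_1(\cdot,0)=u_{10}$, $u_2(\cdot,0)=u_{20}$, $v(\cdot,0)=v_0$ in $L^2([0,1])$, the closed-loop system is finite-time stable, that is, its zero equilibrium is reached in the finite time $t=t_F$ (so $u_1(\cdot,t)=u_2(\cdot,t)=v(\cdot,t)=0$ for $t\ge t_F$), where $$t_F=\tau+\int_0^1\left(\frac1{\varepsilon_1(y)}+\frac1{\varepsilon_2(y)}\right)dy.$$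
   Context: Kernels $K^{21},K^{22}$ on $\mathcal T_1=\{(x,y):0\le y\le x\le1\}$ (these depend only on $\varepsilon_i,c_i,q$): the continuous solution of $$\varepsilon_2(x)\partial_xK^{21}-\varepsilon_1(y)\partial_yK^{21}=\varepsilon_1'(y)K^{21}+c_2(y)K^{22},$$ $$\varepsilon_2(x)\partial_xK^{22}+\varepsilon_2(y)\partial_yK^{22}=-\varepsilon_2'(y)K^{22}+c_1(y)K^{21},$$ $$K^{21}(x,x)=-\frac{c_2(x)}{\varepsilon_1(x)+\varepsilon_2(x)},\qquad \varepsilon_2(0)K^{22}(x,0)=q\,\varepsilon_1(0)K^{21}(x,0).$$ Kernels $\alpha_1,\alpha_2$ on $\mathcal T_2=[0,1]\times[0,1]$: the solution of $$\frac1\tau\partial_x\alpha_1-\varepsilon_1(y)\partial_y\alpha_1=\varepsilon_1'(y)\alpha_1+c_2(y)\alpha_2,\qquad \frac1\tau\partial_x\alpha_2+\varepsilon_2(y)\partial_y\alpha_2=-\varepsilon_2'(y)\alpha_2+c_1(y)\alpha_1,$$ $$\alpha_1(x,1)=0,\qquad \varepsilon_2(0)\alpha_2(x,0)=q\,\varepsilon_1(0)\alpha_1(x,0),\qquad \alpha_1(0,y)=K^{21}(1,y),\qquad \alpha_2(0,y)=K^{22}(1,y).$$ Finally $p(x)=\tau\,\varepsilon_2(1)\,\alpha_2(x,1)$ for $x\in[0,1]$. All kernel equations are understood in the sense of characteristics (integrated along characteristic curves, with the boundary data prescribed where these curves enter the domain). The derivatives $\varepsilon_i'$ appear only through the products $\partial_y(\varepsilon_i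 K^{2i})$ and $\partial_y(\varepsilon_i\alpha_i)$, $i=1,2$, so the equations may be read in terms of those products. Solutions of the evolution system with $L^2$ data are mild solutions, i.e. solutions obtained by integrating along characteristics. *)

theory Defs
  imports "HOL-Analysis.Analysis"
begin

text \<open>
  Transport equation \<open>a(x) w_x + b(y) w_y = f(x, y)\<close> on \<open>D\<close>, understood in integrated form along
  every segment, contained in \<open>D\<close>, of a characteristic curve \<open>X' = a(X)\<close>, \<open>Y' = b(Y)\<close>.
  Asking for every characteristic rather than almost every one loses no generality in the
  \<open>L\<^sup>2\<close> setting below: the characteristic families of the coupled unknowns are transversal, so
  changing an unknown on a null set of its own characteristics does not affect the right-hand
  sides of the other equations.
\<close>

definition transport_along_characteristics ::
  "(real \<Rightarrow> real) \<Rightarrow> (real \<Rightarrow> real) \<Rightarrow> (real \<times> real) set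
    \<Rightarrow> (real \<Rightarrow> real \<Rightarrow> real) \<Rightarrow> (real \<Rightarrow> real \<Rightarrow> real) \<Rightarrow> bool" where
  "transport_along_characteristics a b D w f \<longleftrightarrow>
    (\<forall>r s X Y. r \<le> s \<longrightarrow>
      (\<forall>\<sigma>\<in>{r..s}.
        (X has_real_derivative a (X \<sigma>)) (at \<sigma> within {r..s}) \<and>
        (Y has_real_derivative b (Y \<sigma>)) (at \<sigma> within {r..s}) \<and>
        (X \<sigma>, Y \<sigma>) \<in> D) \<longrightarrow>
      set_integrable lborel {r..s} (\<lambda>\<sigma>. f (X \<sigma>) (Y \<sigma>)) \<and>
      w (X s) (Y s) = w (X r) (Y r) + (LBINT \<sigma>:{r..s}. f (X \<sigma>) (Y \<sigma>)))"

definition kernel_triangle :: "(real \<times> real) set" where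
  "kernel_triangle = {(x, y). 0 \<le> y \<and> y \<le> x \<and> x \<le> 1}"

definition kernel_square :: "(real \<times> real) set" where
  "kernel_square = {0..1} \<times> {0..1}"

text \<open>
  \<open>\<epsilon>1\<close>, \<open>\<epsilon>2\<close> need not be differentiable, so the kernel equations are written for the products
  \<open>\<epsilon>1(y) K21\<close> and \<open>\<epsilon>2(y) K22\<close> (likewise for \<open>\<alpha>1\<close>, \<open>\<alpha>2\<close>). For instance, multiplying
  \<open>\<epsilon>2(x) K21_x - \<epsilon>1(y) K21_y = \<epsilon>1'(y) K21 + c2(y) K22\<close> by \<open>\<epsilon>1(y)\<close> gives
  \<open>\<epsilon>2(x) (\<epsilon>1 K21)_x - \<epsilon>1(y) (\<epsilon>1 K21)_y = \<epsilon>1(y) c2(y) K22\<close>.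
\<close>

definition is_backstepping_kernel ::
  "real \<Rightarrow> (real \<Rightarrow> real) \<Rightarrow> (real \<Rightarrow> real) \<Rightarrow> (real \<Rightarrow> real) \<Rightarrow> (real \<Rightarrow> real)
    \<Rightarrow> (real \<Rightarrow> real \<Rightarrow> real) \<Rightarrow> (real \<Rightarrow> real \<Rightarrow> real) \<Rightarrow> bool" where
  "is_backstepping_kernel q \<epsilon>1 \<epsilon>2 c1 c2 K21 K22 \<longleftrightarrow>
    continuous_on kernel_triangle (\<lambda>(x, y). K21 x y) \<and>
    continuous_on kernel_triangle (\<lambda>(x, y). K22 x y) \<and>
    transport_along_characteristics \<epsilon>2 (\<lambda>y. - \<epsilon>1 y) kernel_triangle
      (\<lambda>x y. \<epsilon>1 y * K21 x y) (\<lambda>x y. \<epsilon>1 y * (c2 y * K22 x y)) \<and>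
    transport_along_characteristics \<epsilon>2 \<epsilon>2 kernel_triangle
      (\<lambda>x y. \<epsilon>2 y * K22 x y) (\<lambda>x y. \<epsilon>2 y * (c1 y * K21 x y)) \<and>
    (\<forall>x\<in>{0..1}. K21 x x = - c2 x / (\<epsilon>1 x + \<epsilon>2 x)) \<and>
    (\<forall>x\<in>{0..1}. \<epsilon>2 0 * K22 x 0 = q * \<epsilon>1 0 * K21 x 0)"

text \<open>
  The data \<open>\<alpha>1(x, 1) = 0\<close> and \<open>\<alpha>1(0, y) = K21(1, y)\<close> are in general incompatible at the
  corner \<open>(0, 1)\<close>, so \<open>\<alpha>1\<close>, \<open>\<alpha>2\<close> may jump across the characteristic issuing from it and
  only bounded Borel functions can be expected. The value at that corner is left free.
\<close>

definition is_delay_kernel ::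
  "real \<Rightarrow> real \<Rightarrow> (real \<Rightarrow> real) \<Rightarrow> (real \<Rightarrow> real) \<Rightarrow> (real \<Rightarrow> real) \<Rightarrow> (real \<Rightarrow> real)
    \<Rightarrow> (real \<Rightarrow> real \<Rightarrow> real) \<Rightarrow> (real \<Rightarrow> real \<Rightarrow> real)
    \<Rightarrow> (real \<Rightarrow> real \<Rightarrow> real) \<Rightarrow> (real \<Rightarrow> real \<Rightarrow> real) \<Rightarrow> bool" where
  "is_delay_kernel \<tau> q \<epsilon>1 \<epsilon>2 c1 c2 K21 K22 \<alpha>1 \<alpha>2 \<longleftrightarrow>
    set_borel_measurable borel kernel_square (\<lambda>(x, y). \<alpha>1 x y) \<and>
    set_borel_measurable borel kernel_square (\<lambda>(x, y). \<alpha>2 x y) \<and>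
    (\<exists>M. \<forall>(x, y)\<in>kernel_square. \<bar>\<alpha>1 x y\<bar> \<le> M \<and> \<bar>\<alpha>2 x y\<bar> \<le> M) \<and>
    transport_along_characteristics (\<lambda>x. 1 / \<tau>) (\<lambda>y. - \<epsilon>1 y) kernel_square
      (\<lambda>x y. \<epsilon>1 y * \<alpha>1 x y) (\<lambda>x y. \<epsilon>1 y * (c2 y * \<alpha>2 x y)) \<and>
    transport_along_characteristics (\<lambda>x. 1 / \<tau>) \<epsilon>2 kernel_square
      (\<lambda>x y. \<epsilon>2 y * \<alpha>2 x y) (\<lambda>x y. \<epsilon>2 y * (c1 y * \<alpha>1 x y)) \<and>
    (\<forall>x\<in>{0<..1}. \<alpha>1 x 1 = 0) \<and>
    (\<forall>x\<in>{0..1}. \<epsilon>2 0 * \<alpha>2 x 0 = q * \<epsilon>1 0 * \<alpha>1 x 0) \<and>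
    (\<forall>y\<in>{0..<1}. \<alpha>1 0 y = K21 1 y) \<and>
    (\<forall>y\<in>{0..1}. \<alpha>2 0 y = K22 1 y)"

definition delay_gain :: "real \<Rightarrow> (real \<Rightarrow> real) \<Rightarrow> (real \<Rightarrow> real \<Rightarrow> real) \<Rightarrow> real \<Rightarrow> real" where
  "delay_gain \<tau> \<epsilon>2 \<alpha>2 x = \<tau> * \<epsilon>2 1 * \<alpha>2 x 1"

definition control_law ::
  "(real \<Rightarrow> real) \<Rightarrow> (real \<Rightarrow> real \<Rightarrow> real) \<Rightarrow> (real \<Rightarrow> real \<Rightarrow> real)
    \<Rightarrow> (real \<Rightarrow> real \<Rightarrow> real) \<Rightarrow> (real \<Rightarrow> real \<Rightarrow> real) \<Rightarrow> (real \<Rightarrow> real \<Rightarrow> real) \<Rightarrow> real \<Rightarrow> real" where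
  "control_law p \<alpha>1 \<alpha>2 u1 u2 v t =
    (LBINT y:{0..1}. p (1 - y) * v y t) +
    (LBINT y:{0..1}. \<alpha>1 1 y * u1 y t) +
    (LBINT y:{0..1}. \<alpha>2 1 y * u2 y t)"

definition L2_unit_interval :: "(real \<Rightarrow> real) \<Rightarrow> bool" where
  "L2_unit_interval f \<longleftrightarrow>
    set_borel_measurable lebesgue {0..1} f \<and> set_integrable lebesgue {0..1} (\<lambda>x. (f x)\<^sup>2)"

definition state_domain :: "(real \<times> real) set" where
  "state_domain = {0..1} \<times> {0..}"

definition locally_bounded_in_L2 :: "(real \<Rightarrow> real \<Rightarrow> real) \<Rightarrow> bool" where
  "locally_bounded_in_L2 w \<longleftrightarrow>
    set_borel_measurable borel state_domain (\<lambda>(x, t). w x t) \<and>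
    (\<forall>T. \<exists>M. \<forall>t\<in>{0..T}.
      set_integrable lborel {0..1} (\<lambda>x. (w x t)\<^sup>2) \<and> (LBINT x:{0..1}. (w x t)\<^sup>2) \<le> M)"

text \<open>
  Initial and boundary data are attained almost everywhere, as is natural for \<open>L\<^sup>2\<close> data.
  Continuity of \<open>t \<mapsto> w(\<cdot>, t)\<close> in \<open>L\<^sup>2\<close> is a consequence and is not required separately.
\<close>

definition is_mild_solution ::
  "real \<Rightarrow> real \<Rightarrow> (real \<Rightarrow> real) \<Rightarrow> (real \<Rightarrow> real) \<Rightarrow> (real \<Rightarrow> real) \<Rightarrow> (real \<Rightarrow> real)
    \<Rightarrow> (real \<Rightarrow> real) \<Rightarrow> (real \<Rightarrow> real \<Rightarrow> real) \<Rightarrow> (real \<Rightarrow> real \<Rightarrow> real)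
    \<Rightarrow> (real \<Rightarrow> real) \<Rightarrow> (real \<Rightarrow> real) \<Rightarrow> (real \<Rightarrow> real)
    \<Rightarrow> (real \<Rightarrow> real \<Rightarrow> real) \<Rightarrow> (real \<Rightarrow> real \<Rightarrow> real) \<Rightarrow> (real \<Rightarrow> real \<Rightarrow> real) \<Rightarrow> bool" where
  "is_mild_solution \<tau> q \<epsilon>1 \<epsilon>2 c1 c2 p \<alpha>1 \<alpha>2 u10 u20 v0 u1 u2 v \<longleftrightarrow>
    locally_bounded_in_L2 u1 \<and> locally_bounded_in_L2 u2 \<and> locally_bounded_in_L2 v \<and>
    transport_along_characteristics \<epsilon>1 (\<lambda>t. 1) state_domain u1 (\<lambda>x t. c1 x * u2 x t) \<and>
    transport_along_characteristics (\<lambda>x. - \<epsilon>2 x) (\<lambda>t. 1) state_domain u2 (\<lambda>x t. c2 x * u1 x t) \<and>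
    transport_along_characteristics (\<lambda>x. - 1) (\<lambda>t. \<tau>) state_domain v (\<lambda>x t. 0) \<and>
    (AE t in lborel. 0 < t \<longrightarrow> u1 0 t = q * u2 0 t) \<and>
    (AE t in lborel. 0 < t \<longrightarrow> u2 1 t = v 0 t) \<and>
    (AE t in lborel. 0 < t \<longrightarrow> v 1 t = control_law p \<alpha>1 \<alpha>2 u1 u2 v t) \<and>
    (AE x in lebesgue. x \<in> {0..1} \<longrightarrow> u1 x 0 = u10 x \<and> u2 x 0 = u20 x \<and> v x 0 = v0 x)"

end

theory Submission
  imports Defs
begin

text \<open>
  The proof is by duality. The kernels \<open>K21, K22\<close> followed by \<open>\<alpha>1, \<alpha>2\<close> solve the backward adjoint of
  the plant, once the first variable is measured by travel time. Fix \<open>t0 > \<tau> + \<phi>2 1\<close>, where \<open>\<phi>i y\<close>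
  is the travel time from \<open>0\<close> to \<open>y\<close>. Multiplying the kernels by the solution at time \<open>t0 - s\<close> and
  integrating along the two families of characteristics gives two flux balances with the same interior
  term. Subtracting them cancels the boundary terms at \<open>y = 0\<close> and leaves: the value of \<open>u2\<close> entering
  at \<open>y = 1\<close> at time \<open>t0 - \<phi>2 1\<close> is the control law if and only if \<open>u2\<close> vanishes at \<open>y = 0\<close> at time
  \<open>t0\<close>. Thus \<open>u1 = u2 = 0\<close> at \<open>y = 0\<close> for almost all \<open>t > \<tau> + \<phi>2 1\<close>, and the Cauchy problem in the
  direction of \<open>y\<close> (a Gronwall argument) propagates the zero data to all \<open>t \<ge> \<tau> + \<phi>2 1 + \<phi>1 y\<close>. No
  inverse Volterra transformation is needed.
\<close>

text \<open>The data in the kernel equations are what the flux balances demand. The diagonal is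
  itself a characteristic of the second family, so only the first family has a flux through it, and
  the value prescribed for \<open>K21\<close> there turns that flux into the coupling term of
  \<open>u2\<close> along its characteristic reaching \<open>y = 0\<close> at \<open>t0\<close>. The
  kernel relation at \<open>y = 0\<close> mirrors the reflection of the state,
  \<open>\<alpha>1 = 0\<close> on \<open>y = 1\<close> removes the flux of \<open>u1\<close> leaving
  the plant, and the factor \<open>\<tau>\<close> in the gain \<open>p\<close> is the Jacobian
  between position in the delay line and time. The obstacle is low regularity: the delay kernels may
  jump, the states are only L2 in space, and boundary relations hold almost everywhere. Instead of a
  divergence theorem in the plane, products are differentiated along single characteristics, and the
  identities are integrated over the label of the characteristic by Fubini after a shear. Discarding
  single labels absorbs the free corner value of \<open>\<alpha>1\<close>. Boundary traces need
  their own integrability proof. The term \<phi>1 1 in the final time is the time in which the zero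
  data cross from \<open>y = 0\<close> to \<open>y = 1\<close>.\<close>

section \<open>Indefinite integrals and Fubini along lines\<close>

text \<open>Absolute continuity of \<open>F\<close> with density \<open>f\<close>, in integral form:
  along a characteristic the density is merely integrable, so no pointwise derivative can be asked
  for.\<close>

definition primitive_on :: "real \<Rightarrow> real \<Rightarrow> (real \<Rightarrow> real) \<Rightarrow> (real \<Rightarrow> real) \<Rightarrow> bool" where
  "primitive_on a b F f \<longleftrightarrow>
    set_integrable lborel {a..b} f \<and> (\<forall>x\<in>{a..b}. F x = F a + (LBINT y:{a..x}. f y))"

lemma set_integral_Icc_combine:
  fixes f :: "real \<Rightarrow> real"
  assumes "a \<le> b" "b \<le> c" "set_integrable lborel {a..b} f" "set_integrable lborel {b..c} f"
  shows "set_integrable lborel {a..c} f"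
    and "(LBINT x:{a..c}. f x) = (LBINT x:{a..b}. f x) + (LBINT x:{b..c}. f x)"
proof -
  have eq: "{a..c} = {a..b} \<union> {b..c}" using assms by auto
  show "set_integrable lborel {a..c} f"
    unfolding eq using assms by (intro set_integrable_Un) auto
  have "AE x in lborel. x \<noteq> b" by (rule AE_lborel_singleton)
  then have "AE x in lborel. \<not> (x \<in> {a..b} \<and> x \<in> {b..c})"
    by eventually_elim auto
  then show "(LBINT x:{a..c}. f x) = (LBINT x:{a..b}. f x) + (LBINT x:{b..c}. f x)"
    unfolding eq using assms by (intro set_integral_Un_AE) auto
qed

lemma primitive_on_integrable: "primitive_on a b F f \<Longrightarrow> set_integrable lborel {a..b} f"
  by (simp add: primitive_on_def)

lemma primitive_onD:
  "primitive_on a b F f \<Longrightarrow> a \<le> x \<Longrightarrow> x \<le> b \<Longrightarrow> F x = F a + (LBINT y:{a..x}. f y)"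
  unfolding primitive_on_def by (meson atLeastAtMost_iff)

lemma primitive_on_eq: "primitive_on a b F f \<Longrightarrow> a \<le> b \<Longrightarrow> F b - F a = (LBINT y:{a..b}. f y)"
  using primitive_onD[of a b F f b] by simp

lemma primitive_on_subinterval:
  assumes "primitive_on a b F f" "a \<le> c" "c \<le> d" "d \<le> b"
  shows "primitive_on c d F f"
  unfolding primitive_on_def
proof safe
  have int: "set_integrable lborel {a..b} f" and
    eq: "\<And>x. a \<le> x \<Longrightarrow> x \<le> b \<Longrightarrow> F x = F a + (LBINT y:{a..x}. f y)"
    using primitive_on_integrable[OF assms(1)] primitive_onD[OF assms(1)] by blast+
  show "set_integrable lborel {c..d} f"
    by (rule set_integrable_subset[OF int]) (use assms in auto)
  fix x assume x: "x \<in> {c..d}"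
  have "(LBINT y:{a..x}. f y) = (LBINT y:{a..c}. f y) + (LBINT y:{c..x}. f y)"
    by (rule set_integral_Icc_combine(2)[OF _ _ set_integrable_subset[OF int] set_integrable_subset[OF int]])
      (use assms x in auto)
  with eq[of x] eq[of c] x assms show "F x = F c + (LBINT y:{c..x}. f y)" by simp
qed

lemma primitive_on_combine:
  assumes "primitive_on a b F f" "primitive_on b c F f" "a \<le> b" "b \<le> c"
  shows "primitive_on a c F f"
  unfolding primitive_on_def
proof safe
  have int: "set_integrable lborel {a..b} f" "set_integrable lborel {b..c} f" and
    eq: "\<And>x. a \<le> x \<Longrightarrow> x \<le> b \<Longrightarrow> F x = F a + (LBINT y:{a..x}. f y)"
      "\<And>x. b \<le> x \<Longrightarrow> x \<le> c \<Longrightarrow> F x = F b + (LBINT y:{b..x}. f y)"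
    using primitive_on_integrable[OF assms(1)] primitive_onD[OF assms(1)]
      primitive_on_integrable[OF assms(2)] primitive_onD[OF assms(2)] by blast+
  show "set_integrable lborel {a..c} f"
    using assms(3,4) int by (rule set_integral_Icc_combine)
  fix x assume x: "x \<in> {a..c}"
  show "F x = F a + (LBINT y:{a..x}. f y)"
  proof (cases "x \<le> b")
    case True
    then show ?thesis using eq(1)[of x] x by auto
  next
    case False
    have "(LBINT y:{a..x}. f y) = (LBINT y:{a..b}. f y) + (LBINT y:{b..x}. f y)"
      by (rule set_integral_Icc_combine(2)[OF _ _ int(1) set_integrable_subset[OF int(2)]])
        (use assms x False in auto)
    with eq(1)[of b] eq(2)[of x] x False assms show ?thesis by simp
  qed
qed

lemma primitive_on_cong:
  assumes "primitive_on a b F f"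
    and "\<And>x. a \<le> x \<Longrightarrow> x \<le> b \<Longrightarrow> F' x = F x" "\<And>x. a \<le> x \<Longrightarrow> x \<le> b \<Longrightarrow> f' x = f x"
  shows "primitive_on a b F' f'"
  unfolding primitive_on_def
proof safe
  have int: "set_integrable lborel {a..b} f" and
    eq: "\<And>x. a \<le> x \<Longrightarrow> x \<le> b \<Longrightarrow> F x = F a + (LBINT y:{a..x}. f y)"
    using primitive_on_integrable[OF assms(1)] primitive_onD[OF assms(1)] by blast+
  show "set_integrable lborel {a..b} f'"
    using int assms(3) by (subst set_integrable_cong[where M = lborel and M' = lborel and f' = f]) auto
  fix x assume x: "x \<in> {a..b}"
  have "(LBINT y:{a..x}. f' y) = (LBINT y:{a..x}. f y)"
    by (rule set_lebesgue_integral_cong) (use assms x in auto)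
  then show "F' x = F' a + (LBINT y:{a..x}. f' y)" using eq[of x] x assms by simp
qed

lemma primitive_on_subst:
  assumes F: "primitive_on (g a) (g b) F f" and "a \<le> b"
    and g: "\<And>x. (g has_real_derivative g' x) (at x)" and g': "continuous_on UNIV g'"
    and pos: "\<And>x. 0 \<le> g' x"
  shows "primitive_on a b (\<lambda>x. F (g x)) (\<lambda>x. f (g x) * g' x)"
  unfolding primitive_on_def
proof safe
  have int: "set_integrable lborel {g a..g b} f" and
    eq: "\<And>x. g a \<le> x \<Longrightarrow> x \<le> g b \<Longrightarrow> F x = F (g a) + (LBINT y:{g a..x}. f y)"
    using primitive_on_integrable[OF F] primitive_onD[OF F] by blast+
  have mono: "g x \<le> g y" if "x \<le> y" for x y
    using that g pos by (intro DERIV_nonneg_imp_nondecreasing[of x y g]) blast+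
  have cont: "continuous_on A g'" for A using g' continuous_on_subset by blast
  show "set_integrable lborel {a..b} (\<lambda>x. f (g x) * g' x)"
    using int by (rule integral_substitution(1)) (use g cont pos \<open>a \<le> b\<close> in auto)
  fix x assume x: "x \<in> {a..b}"
  have "set_integrable lborel {g a..g x} f"
    by (rule set_integrable_subset[OF int]) (use mono x in auto)
  then have "(LBINT y. f y * indicator {g a..g x} y) = (LBINT y. f (g y) * g' y * indicator {a..x} y)"
    by (rule integral_substitution(2)) (use g cont pos x in auto)
  then have "(LBINT y:{g a..g x}. f y) = (LBINT y:{a..x}. f (g y) * g' y)"
    unfolding set_lebesgue_integral_def by (simp add: mult.commute)
  with eq[of "g x"] mono x show "F (g x) = F (g a) + (LBINT y:{a..x}. f (g y) * g' y)" by auto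
qed

lemma set_integral_reflect_Icc:
  fixes f :: "real \<Rightarrow> real"
  shows "set_integrable lborel {- b..- a} (\<lambda>x. f (- x)) \<longleftrightarrow> set_integrable lborel {a..b} f"
    and "(LBINT x:{- b..- a}. f (- x)) = (LBINT x:{a..b}. f x)"
proof -
  have ind: "indicator {- b..- a} x = indicat_real {a..b} (- x)" for x
    by (auto simp: indicator_def)
  show "set_integrable lborel {- b..- a} (\<lambda>x. f (- x)) \<longleftrightarrow> set_integrable lborel {a..b} f"
    unfolding set_integrable_def ind
    using lborel_integrable_real_affine_iff[of "-1" "\<lambda>x. indicator {a..b} x *\<^sub>R f x" 0] by simp
  show "(LBINT x:{- b..- a}. f (- x)) = (LBINT x:{a..b}. f x)"
    unfolding set_lebesgue_integral_def ind
    using lborel_integral_real_affine[of "-1" "\<lambda>x. indicator {a..b} x *\<^sub>R f x" 0] by simp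
qed

text \<open>Supplies decreasing changes of variable, which \<open>primitive_on_subst\<close>
  excludes by its sign condition on \<open>g'\<close>.\<close>

lemma primitive_on_reflect:
  assumes F: "primitive_on (- b) (- a) F f" and "a \<le> b"
  shows "primitive_on a b (\<lambda>x. F (- x)) (\<lambda>x. - f (- x))"
  unfolding primitive_on_def
proof safe
  have int: "set_integrable lborel {- b..- a} f"
    using F by (rule primitive_on_integrable)
  show "set_integrable lborel {a..b} (\<lambda>x. - f (- x))"
    using set_integral_reflect_Icc(1)[of "- a" "- b" f] int by (simp add: set_integrable_def)
  fix x assume x: "x \<in> {a..b}"
  have "primitive_on (- x) (- a) F f"
    by (rule primitive_on_subinterval[OF F]) (use x in auto)
  then have "F (- a) - F (- x) = (LBINT y:{- x..- a}. f y)"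
    by (rule primitive_on_eq) (use x in auto)
  also have "\<dots> = (LBINT y:{a..x}. f (- y))"
    using set_integral_reflect_Icc(2)[of "- a" "- x" f] by simp
  finally show "F (- x) = F (- a) + (LBINT y:{a..x}. - f (- y))"
    by (simp add: set_lebesgue_integral_def)
qed

lemma integrable_mult_pair_lborel:
  fixes f g :: "real \<Rightarrow> real"
  assumes f: "integrable lborel f" and g: "integrable lborel g"
  shows "integrable (lborel \<Otimes>\<^sub>M lborel) (\<lambda>(x, y). f x * g y)"
proof (rule lborel_pair.Fubini_integrable)
  have [measurable]: "f \<in> borel_measurable borel" "g \<in> borel_measurable borel"
    using f g by auto
  show "(\<lambda>(x, y). f x * g y) \<in> borel_measurable (lborel \<Otimes>\<^sub>M lborel)" by measurable
  show "integrable lborel (\<lambda>x. LBINT y. norm (case (x, y) of (x, y) \<Rightarrow> f x * g y))"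
    using f by (simp add: abs_mult)
qed (use g in simp)

text \<open>
  The double integrals of \<open>f x * g y\<close> over \<open>y \<le> x\<close> and over \<open>x \<le> y\<close>, which come from the two
  terms of the product rule, add up to the integral over the full square.
\<close>

lemma primitive_on_mult:
  assumes F: "primitive_on a b F f" and G: "primitive_on a b G g"
  shows "primitive_on a b (\<lambda>x. F x * G x) (\<lambda>x. f x * G x + F x * g x)"
proof -
  have eq: "set_integrable lborel {a..c} (\<lambda>x. f x * G x + F x * g x) \<and>
      F c * G c = F a * G a + (LBINT x:{a..c}. f x * G x + F x * g x)" if c: "a \<le> c" "c \<le> b" for c
  proof -
    have Fc: "primitive_on a c F f" and Gc: "primitive_on a c G g"
      using primitive_on_subinterval[OF F, of a c] primitive_on_subinterval[OF G, of a c] c by auto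
    define f0 where "f0 x = indicator {a..c} x * f x" for x
    define g0 where "g0 x = indicator {a..c} x * g x" for x
    have f0: "integrable lborel f0" and g0: "integrable lborel g0"
      using primitive_on_integrable[OF Fc] primitive_on_integrable[OF Gc]
      by (auto simp: set_integrable_def f0_def[abs_def] g0_def[abs_def])
    have [measurable]: "f0 \<in> borel_measurable borel" "g0 \<in> borel_measurable borel"
      using f0 g0 by auto
    have Feq: "F x = F a + (LBINT y. f0 y * indicator {y..} x)" if "x \<in> {a..c}" for x
    proof -
      have "(LBINT y:{a..x}. f y) = (LBINT y. f0 y * indicator {y..} x)"
        unfolding set_lebesgue_integral_def
        by (rule Bochner_Integration.integral_cong) (use that in \<open>auto simp: f0_def indicator_def\<close>)
      then show ?thesis using primitive_onD[OF Fc, of x] that by auto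
    qed
    have Geq: "G x = G a + (LBINT y. g0 y * indicator {y..} x)" if "x \<in> {a..c}" for x
    proof -
      have "(LBINT y:{a..x}. g y) = (LBINT y. g0 y * indicator {y..} x)"
        unfolding set_lebesgue_integral_def
        by (rule Bochner_Integration.integral_cong) (use that in \<open>auto simp: g0_def indicator_def\<close>)
      then show ?thesis using primitive_onD[OF Gc, of x] that by auto
    qed
    have pair: "integrable (lborel \<Otimes>\<^sub>M lborel) (\<lambda>(x, y). f0 x * g0 y)"
      using f0 g0 by (rule integrable_mult_pair_lborel)
    have below: "integrable (lborel \<Otimes>\<^sub>M lborel) (\<lambda>(x, y). f0 x * (g0 y * indicator {y..} x))"
      by (rule Bochner_Integration.integrable_bound[OF pair]) (auto simp: indicator_def)
    have above: "integrable (lborel \<Otimes>\<^sub>M lborel) (\<lambda>(x, y). f0 x * (g0 y * indicator {x..} y))"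
      by (rule Bochner_Integration.integrable_bound[OF pair]) (auto simp: indicator_def)
    \<comment> \<open>\<open>J\<close> and \<open>J'\<close> integrate the same function over the
      same triangle in opposite orders: \<open>J\<close> is what the term \<open>F x * g x\<close>
      produces, \<open>J'\<close> is what can be added to \<open>I\<close> pointwise.\<close>
    define I where "I x = (LBINT y. f0 x * (g0 y * indicator {y..} x))" for x
    define J where "J y = (LBINT x. f0 x * (g0 y * indicator {x..} y))" for y
    define J' where "J' x = (LBINT y. f0 x * (g0 y * indicator {x..} y))" for x
    have I: "integrable lborel I" unfolding I_def[abs_def]
      using lborel_pair.integrable_fst[OF below] .
    have J: "integrable lborel J" unfolding J_def[abs_def]
      using lborel_pair.integrable_snd[OF above] .
    have J': "integrable lborel J'" unfolding J'_def[abs_def]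
      using lborel_pair.integrable_fst[OF above] .
    have JJ': "(LBINT y. J y) = (LBINT x. J' x)"
      unfolding J_def J'_def
      using lborel_pair.integral_fst[OF above] lborel_pair.integral_snd[OF above] by simp
    have sum: "I x + J' x = f0 x * (LBINT y. g0 y)" for x
    proof -
      have i1: "integrable lborel (\<lambda>y. g0 y * indicator {y..} x)"
        by (rule Bochner_Integration.integrable_bound[OF g0]) (auto simp: indicator_def)
      have i2: "integrable lborel (\<lambda>y. g0 y * indicator {x..} y)"
        by (rule Bochner_Integration.integrable_bound[OF g0]) (auto simp: indicator_def)
      have "I x + J' x = f0 x * (LBINT y. g0 y * indicator {y..} x + g0 y * indicator {x..} y)"
        unfolding I_def J'_def using i1 i2 by (simp add: distrib_left)
      also have "(LBINT y. g0 y * indicator {y..} x + g0 y * indicator {x..} y) = (LBINT y. g0 y)"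
      proof (rule integral_cong_AE)
        \<comment> \<open>Both indicators equal 1 at \<open>y = x\<close>, so the two triangles tile
          the square only up to a null set.\<close>
        have "AE y in lborel. y \<noteq> x" by (rule AE_lborel_singleton)
        then show "AE y in lborel. g0 y * indicator {y..} x + g0 y * indicator {x..} y = g0 y"
          by eventually_elim (auto simp: indicator_def)
      qed (intro borel_measurable_integrable Bochner_Integration.integrable_add i1 i2 g0)+
      finally show ?thesis .
    qed
    have fG: "indicator {a..c} x * (f x * G x) = G a * f0 x + I x" for x
    proof (cases "x \<in> {a..c}")
      case True
      then show ?thesis by (subst Geq) (auto simp: f0_def I_def algebra_simps)
    qed (simp add: f0_def I_def)
    have Fg: "indicator {a..c} x * (F x * g x) = F a * g0 x + J x" for x
    proof (cases "x \<in> {a..c}")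
      case True
      have "J x = (LBINT y. f0 y * indicator {y..} x) * g0 x"
        unfolding J_def by (subst integral_mult_left_zero[symmetric]) (simp add: mult_ac)
      then show ?thesis using True by (subst Feq) (auto simp: g0_def algebra_simps)
    qed (simp add: g0_def J_def)
    have tot: "indicator {a..c} x * (f x * G x + F x * g x) = (G a * f0 x + I x) + (F a * g0 x + J x)" for x
      using fG[of x] Fg[of x] by (simp add: distrib_left)
    have "(LBINT x:{a..c}. f x * G x + F x * g x) =
        G a * (LBINT x. f0 x) + F a * (LBINT x. g0 x) + ((LBINT x. I x) + (LBINT x. J' x))"
      unfolding set_lebesgue_integral_def using f0 g0 I J by (simp add: tot JJ')
    also have "(LBINT x. I x) + (LBINT x. J' x) = (LBINT x. I x + J' x)"
      using I J' by simp
    also have "\<dots> = (LBINT x. f0 x) * (LBINT x. g0 x)"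
      by (simp add: sum)
    finally have val: "(LBINT x:{a..c}. f x * G x + F x * g x) =
        G a * (LBINT x. f0 x) + F a * (LBINT x. g0 x) + (LBINT x. f0 x) * (LBINT x. g0 x)" .
    have "F c = F a + (LBINT x. f0 x)" "G c = G a + (LBINT x. g0 x)"
      using primitive_onD[OF Fc, of c] primitive_onD[OF Gc, of c] c
      by (auto simp: set_lebesgue_integral_def f0_def g0_def)
    then have "F c * G c = F a * G a + (LBINT x:{a..c}. f x * G x + F x * g x)"
      unfolding val by (simp add: algebra_simps)
    moreover have "set_integrable lborel {a..c} (\<lambda>x. f x * G x + F x * g x)"
      unfolding set_integrable_def using f0 g0 I J by (simp add: tot)
    ultimately show ?thesis by simp
  qed
  show ?thesis
  proof (cases "a \<le> b")
    case True
    show ?thesis unfolding primitive_on_def using eq[of b] True eq by (meson atLeastAtMost_iff order_refl)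
  next
    case False
    then show ?thesis by (simp add: primitive_on_def set_integrable_def)
  qed
qed

text \<open>For fixed \<open>y\<close> the shear is a translation of the first variable, so Tonelli
  and translation invariance suffice and measurability of \<phi> is enough. It replaces the
  coordinate \<open>s\<close> by the label \<open>c\<close> of the characteristic through the
  point.\<close>

lemma shear_integral:
  fixes q :: "real \<Rightarrow> real \<Rightarrow> real"
  assumes q: "integrable (lborel \<Otimes>\<^sub>M lborel) (\<lambda>(s, y). q s y)"
    and [measurable]: "\<phi> \<in> borel_measurable borel"
  shows "integrable (lborel \<Otimes>\<^sub>M lborel) (\<lambda>(c, y). q (c + \<phi> y) y)"
    and "(LBINT c. LBINT y. q (c + \<phi> y) y) = (LBINT s. LBINT y. q s y)"
proof -
  have [measurable]: "(\<lambda>(s, y). q s y) \<in> borel_measurable (borel \<Otimes>\<^sub>M borel)"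
    using borel_measurable_integrable[OF q] by simp
  have shift: "(LBINT c. h (c + k)) = (LBINT s. h s)" for k and h :: "real \<Rightarrow> real"
    using lborel_integral_real_affine[of 1 h k] by (simp add: add.commute)
  have nn: "(\<integral>\<^sup>+ p. norm (case p of (c, y) \<Rightarrow> q (c + \<phi> y) y) \<partial>(lborel \<Otimes>\<^sub>M lborel)) =
      (\<integral>\<^sup>+ p. norm (case p of (s, y) \<Rightarrow> q s y) \<partial>(lborel \<Otimes>\<^sub>M lborel))"
  proof -
    have "(\<integral>\<^sup>+ c. norm (q (c + \<phi> y) y) \<partial>lborel) = (\<integral>\<^sup>+ s. norm (q s y) \<partial>lborel)" for y
      using nn_integral_real_affine[of "\<lambda>s. ennreal (norm (q s y))" 1 "\<phi> y"]
      by (simp add: add.commute)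
    then show ?thesis
      by (subst (1 2) lborel_pair.nn_integral_snd[symmetric]) simp_all
  qed
  show int: "integrable (lborel \<Otimes>\<^sub>M lborel) (\<lambda>(c, y). q (c + \<phi> y) y)"
    using q nn unfolding integrable_iff_bounded by simp
  have "(LBINT c. LBINT y. q (c + \<phi> y) y) = (LBINT y. LBINT c. q (c + \<phi> y) y)"
    using lborel_pair.Fubini_integral[OF int] by simp
  also have "\<dots> = (LBINT y. LBINT s. q s y)"
    by (simp add: shift[where h = "\<lambda>s. q s y" for y])
  also have "\<dots> = (LBINT s. LBINT y. q s y)"
    using lborel_pair.Fubini_integral[OF q] by simp
  finally show "(LBINT c. LBINT y. q (c + \<phi> y) y) = (LBINT s. LBINT y. q s y)" .
qed

section \<open>Travel times and characteristics\<close>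

text \<open>The exceptional \<open>x\<close> lie in the image of a null set under \<open>h\<close>,
  and differentiable maps of the line preserve null sets. Hence differentiability is required of the
  left inverse \<open>h\<close> and not of \<open>g\<close>.\<close>

lemma AE_lborel_compose_inverse:
  fixes g h :: "real \<Rightarrow> real"
  assumes "AE c in lborel. P c" and inv: "\<And>x. h (g x) = x"
    and h: "\<And>c. (h has_real_derivative h' c) (at c)"
  shows "AE x in lborel. P (g x)"
proof -
  obtain N where N: "\<And>c. c \<notin> N \<Longrightarrow> P c" "N \<in> null_sets lborel"
    using assms(1) by (rule AE_E3) auto
  have "negligible N"
    using N(2) by (simp add: negligible_iff_null_sets null_sets_completionI)
  then have "negligible (h ` N)"
  proof (rule negligible_differentiable_image_negligible[rotated])
    show "h differentiable_on N"
      unfolding differentiable_on_def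
      by (meson DERIV_subset differentiableI h has_field_derivative_imp_has_derivative has_field_derivative_at_within)
  qed simp
  then have "AE x in lebesgue. x \<notin> h ` N"
    unfolding negligible_iff_null_sets by (rule AE_not_in)
  then have "AE x in lebesgue. P (g x)"
  proof eventually_elim
    case (elim x)
    then have "g x \<notin> N" using inv[of x] by (metis imageI)
    then show ?case by (rule N(1))
  qed
  then show ?thesis by (simp add: AE_completion_iff)
qed

lemma AE_lborel_affine:
  fixes k d :: real
  assumes "AE c in lborel. P c" "d \<noteq> 0"
  shows "AE x in lborel. P (k + d * x)"
  by (rule AE_lborel_compose_inverse[where h = "\<lambda>c. (c - k) / d" and h' = "\<lambda>_. 1 / d", OF assms(1)])
    (use assms(2) in \<open>auto intro!: derivative_eq_intros\<close>)

text \<open>Posed on the whole line, so that \<open>position\<close> is a total inverse of \<phi>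
  and computations with labels need no range conditions. The upper bound on the speed is what makes
  \<phi> onto.\<close>

locale travel_time =
  fixes e \<phi> :: "real \<Rightarrow> real"
  assumes e_cont: "continuous_on UNIV e"
    and e_bounds: "\<exists>m M. 0 < m \<and> (\<forall>y. m \<le> e y \<and> e y \<le> M)"
    and travel_deriv: "\<And>y. (\<phi> has_real_derivative 1 / e y) (at y)"
    and travel_0 [simp]: "\<phi> 0 = 0"
begin

definition position :: "real \<Rightarrow> real" where
  "position = inv \<phi>"

lemma e_pos: "0 < e y"
  using e_bounds by (meson less_le_trans)

lemma travel_less: "x < y \<Longrightarrow> \<phi> x < \<phi> y"
  by (rule DERIV_pos_imp_increasing[of x y \<phi>]) (use travel_deriv e_pos in \<open>auto intro!: exI\<close>)

lemma travel_le_iff [simp]: "\<phi> x \<le> \<phi> y \<longleftrightarrow> x \<le> y"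
  using travel_less[of x y] travel_less[of y x] by (cases x y rule: linorder_cases) auto

lemma travel_nonneg [simp]: "0 \<le> \<phi> y \<longleftrightarrow> 0 \<le> y"
  using travel_le_iff[of 0 y] by (simp del: travel_le_iff)

lemma inj_travel: "inj \<phi>"
  by (rule injI) (metis order_antisym order_refl travel_le_iff)

lemma isCont_travel: "isCont \<phi> y"
  using travel_deriv DERIV_isCont by blast

lemma surj_travel: "surj \<phi>"
proof -
  obtain m M where m: "0 < m" "\<And>y. m \<le> e y" "\<And>y. e y \<le> M" using e_bounds by auto
  have M: "0 < M" using m(1) m(2)[of 0] m(3)[of 0] by linarith
  have diff: "(b - a) / M \<le> \<phi> b - \<phi> a" if ab: "a < b" for a b
  proof -
    obtain z where "\<phi> b - \<phi> a = (b - a) * (1 / e z)"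
      using MVT2[OF ab travel_deriv] by auto
    moreover have "1 / M \<le> 1 / e z" using m(3) e_pos M by (simp add: frac_le)
    ultimately show ?thesis using that by (simp add: divide_inverse)
  qed
  have "\<exists>x. \<phi> x = y" for y
  proof -
    \<comment> \<open>\<phi> has slope at least \<open>1 / M\<close>, so the distance
      \<open>b\<close> takes a time of at least \<open>\<bar>y\<bar> + 1\<close> in either
      direction.\<close>
    define b where "b = M * (\<bar>y\<bar> + 1)"
    have b: "0 < b" using M by (simp add: b_def)
    have "\<bar>y\<bar> + 1 \<le> \<phi> b" using diff[OF b] M by (simp add: b_def)
    moreover have "\<phi> (- b) \<le> - (\<bar>y\<bar> + 1)" using diff[of "- b" 0] b M by (simp add: b_def)
    ultimately show ?thesis
      using IVT[of \<phi> "- b" y b] b isCont_travel by fastforce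
  qed
  then show ?thesis by (metis surjI)
qed

lemma position_travel [simp]: "position (\<phi> y) = y"
  unfolding position_def by (rule inv_f_f[OF inj_travel])

lemma travel_position [simp]: "\<phi> (position s) = s"
  unfolding position_def by (rule surj_f_inv_f[OF surj_travel])

lemma position_le_iff: "position s \<le> y \<longleftrightarrow> s \<le> \<phi> y"
  by (metis travel_le_iff travel_position)

lemma le_position_iff: "y \<le> position s \<longleftrightarrow> \<phi> y \<le> s"
  by (metis travel_le_iff travel_position)

lemma position_0 [simp]: "position 0 = 0"
  by (metis position_travel travel_0)

lemma isCont_position: "isCont position s"
proof -
  have "isCont position (\<phi> (position s))"
    by (rule isCont_inverse_function[of 1]) (auto simp: isCont_travel)
  then show ?thesis by simp
qed

lemma position_deriv: "(position has_real_derivative e (position s)) (at s)"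
proof -
  have "(position has_real_derivative inverse (1 / e (position s))) (at s)"
    by (rule DERIV_inverse_function[where f = \<phi> and a = "s - 1" and b = "s + 1"])
      (use travel_deriv e_pos[of "position s"] isCont_position in auto)
  then show ?thesis by simp
qed

lemma borel_travel [measurable]: "\<phi> \<in> borel_measurable borel"
  by (intro borel_measurable_continuous_onI continuous_at_imp_continuous_on) (auto simp: isCont_travel)

lemma borel_position [measurable]: "position \<in> borel_measurable borel"
  by (intro borel_measurable_continuous_onI continuous_at_imp_continuous_on) (auto simp: isCont_position)

lemma borel_e [measurable]: "e \<in> borel_measurable borel"
  by (rule borel_measurable_continuous_onI[OF e_cont])

lemma e_position_cont: "continuous_on UNIV (\<lambda>s. e (position s))"
  by (rule continuous_on_compose2[OF e_cont])
    (auto intro!: continuous_at_imp_continuous_on simp: isCont_position)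

lemma inverse_e_cont: "continuous_on UNIV (\<lambda>y. 1 / e y)"
  by (intro continuous_intros e_cont) (use e_pos less_irrefl in metis)

text \<open>Reparametrises a characteristic by position instead of time, which divides the density
  by the speed. The falling version serves characteristics on which the parameter decreases as
  \<open>y\<close> grows.\<close>

lemma primitive_on_rising:
  assumes "primitive_on (k + \<phi> a) (k + \<phi> b) F f" "a \<le> b"
  shows "primitive_on a b (\<lambda>y. F (k + \<phi> y)) (\<lambda>y. f (k + \<phi> y) / e y)"
proof -
  have "primitive_on a b (\<lambda>y. F (k + \<phi> y)) (\<lambda>y. f (k + \<phi> y) * (1 / e y))"
    by (rule primitive_on_subst[where g = "\<lambda>y. k + \<phi> y", OF assms _ inverse_e_cont])
      (auto intro!: derivative_eq_intros travel_deriv e_pos less_imp_le)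
  then show ?thesis by simp
qed

lemma primitive_on_falling:
  assumes "primitive_on (k - \<phi> b) (k - \<phi> a) F f" "a \<le> b"
  shows "primitive_on a b (\<lambda>y. F (k - \<phi> y)) (\<lambda>y. - f (k - \<phi> y) / e y)"
proof -
  have "primitive_on (\<phi> a - k) (\<phi> b - k) (\<lambda>x. F (- x)) (\<lambda>x. - f (- x))"
    by (rule primitive_on_reflect) (use assms in auto)
  then have "primitive_on (- k + \<phi> a) (- k + \<phi> b) (\<lambda>x. F (- x)) (\<lambda>x. - f (- x))"
    by simp
  from primitive_on_rising[OF this assms(2)] show ?thesis by simp
qed

text \<open>On a boundary piece where the line through position \<open>y\<close> has label
  \<open>k + \<phi> y\<close>, this turns an integral over labels into one over \<open>y\<close>,
  the speed being the Jacobian.\<close>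

lemma integral_position_rising:
  fixes h :: "real \<Rightarrow> real"
  assumes h: "set_integrable lborel {a..b} h" and ab: "a \<le> b"
  shows "set_integrable lborel {k + \<phi> a..k + \<phi> b} (\<lambda>c. h (position (c - k)) * e (position (c - k)))"
    and "(LBINT c:{k + \<phi> a..k + \<phi> b}. h (position (c - k)) * e (position (c - k))) = (LBINT y:{a..b}. h y)"
proof -
  let ?g = "\<lambda>c. position (c - k)"
  have h': "set_integrable lborel {?g (k + \<phi> a)..?g (k + \<phi> b)} h" using h by simp
  have d: "(?g has_real_derivative e (?g c)) (at c)" for c
    using DERIV_shift[of position "e (?g c)" c "- k"] position_deriv[of "c - k"] by simp
  have c: "continuous_on {k + \<phi> a..k + \<phi> b} (\<lambda>c. e (?g c))"
    by (rule continuous_on_compose2[OF e_position_cont]) (auto intro!: continuous_intros)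
  have le: "k + \<phi> a \<le> k + \<phi> b" using ab by simp
  show "set_integrable lborel {k + \<phi> a..k + \<phi> b} (\<lambda>c. h (?g c) * e (?g c))"
    by (rule integral_substitution(1)[OF h' d c less_imp_le[OF e_pos] le])
  show "(LBINT c:{k + \<phi> a..k + \<phi> b}. h (?g c) * e (?g c)) = (LBINT y:{a..b}. h y)"
    using integral_substitution(2)[OF h' d c less_imp_le[OF e_pos] le]
    by (simp add: set_lebesgue_integral_def mult.commute)
qed

lemma integral_position_falling:
  fixes h :: "real \<Rightarrow> real"
  assumes h: "set_integrable lborel {a..b} h" and ab: "a \<le> b"
  shows "set_integrable lborel {k - \<phi> b..k - \<phi> a} (\<lambda>c. h (position (k - c)) * e (position (k - c)))"
    and "(LBINT c:{k - \<phi> b..k - \<phi> a}. h (position (k - c)) * e (position (k - c))) = (LBINT y:{a..b}. h y)"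
  using integral_position_rising[OF assms, of "- k"]
    set_integral_reflect_Icc[of "k - \<phi> a" "k - \<phi> b" "\<lambda>c. h (position (k - c)) * e (position (k - c))"]
  by (simp_all add: add.commute)

lemma AE_rising: "AE c in lborel. P c \<Longrightarrow> AE x in lborel. P (k + \<phi> x)"
proof (rule AE_lborel_compose_inverse[where h = "\<lambda>c. position (c - k)"])
  show "((\<lambda>c. position (c - k)) has_real_derivative e (position (c - k))) (at c)" for c
    using DERIV_shift[of position "e (position (c - k))" c "- k"] position_deriv[of "c - k"] by simp
qed auto

lemma AE_falling: "AE c in lborel. P c \<Longrightarrow> AE x in lborel. P (k - \<phi> x)"
proof (rule AE_lborel_compose_inverse[where h = "\<lambda>c. position (k - c)"])
  show "((\<lambda>c. position (k - c)) has_real_derivative - e (position (k - c))) (at c)" for c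
    by (rule DERIV_chain2[of position "e (position (k - c))" "\<lambda>c. k - c" c "-1", simplified])
      (auto intro!: derivative_eq_intros position_deriv)
qed auto

end

section \<open>Extension of the coefficients beyond the unit interval\<close>

definition clamp_unit :: "real \<Rightarrow> real" where
  "clamp_unit y = max 0 (min 1 y)"

lemma clamp_unit_eq [simp]: "0 \<le> y \<Longrightarrow> y \<le> 1 \<Longrightarrow> clamp_unit y = y"
  by (simp add: clamp_unit_def)

lemma clamp_unit_bounds [simp]: "0 \<le> clamp_unit y" "clamp_unit y \<le> 1"
  by (auto simp: clamp_unit_def)

lemma continuous_on_clamp_unit:
  assumes "continuous_on {0..1} f"
  shows "continuous_on UNIV (\<lambda>y. f (clamp_unit y) :: real)"
  by (rule continuous_on_compose2[OF assms]) (auto simp: clamp_unit_def[abs_def] intro!: continuous_intros)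

text \<open>Freezing \<open>e\<close> at its end values keeps it continuous on the line, and
  compactness of the unit interval provides the two positive bounds.\<close>

lemma travel_time_exists:
  fixes e :: "real \<Rightarrow> real"
  assumes cont: "continuous_on {0..1} e" and pos: "\<And>y. y \<in> {0..1} \<Longrightarrow> 0 < e y"
  obtains \<phi> where "travel_time (\<lambda>y. e (clamp_unit y)) \<phi>" "\<phi> 1 = integral {0..1} (\<lambda>y. 1 / e y)"
proof -
  let ?e = "\<lambda>y. e (clamp_unit y)"
  have e: "continuous_on UNIV ?e" using cont by (rule continuous_on_clamp_unit)
  obtain y0 where y0: "y0 \<in> {0..1}" "\<And>y. y \<in> {0..1} \<Longrightarrow> e y0 \<le> e y"
    using continuous_attains_inf[of "{0..1::real}" e] cont by auto
  obtain y1 where y1: "\<And>y. y \<in> {0..1} \<Longrightarrow> e y \<le> e y1"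
    using continuous_attains_sup[of "{0..1::real}" e] cont by (auto intro: that)
  have epos: "0 < ?e y" for y using pos by simp
  have inv: "continuous_on UNIV (\<lambda>y. 1 / ?e y)"
    by (intro continuous_intros e) (use epos less_irrefl in metis)
  obtain F where F: "\<And>x::real. (F has_vector_derivative 1 / ?e x) (at x)"
    using einterval_antiderivative[of "-\<infinity>" "\<infinity>" "\<lambda>y. 1 / ?e y"] inv
    by (auto simp: continuous_on_eq_continuous_at)
  define \<phi> where "\<phi> x = F x - F 0" for x
  have deriv: "(\<phi> has_real_derivative 1 / ?e x) (at x)" for x
    using F[of x] unfolding \<phi>_def has_real_derivative_iff_has_vector_derivative[symmetric]
    by (auto intro!: derivative_eq_intros)
  have "(\<phi> has_vector_derivative 1 / ?e x) (at x within {0..1})" for x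
    using deriv[of x] has_vector_derivative_at_within
    unfolding has_real_derivative_iff_has_vector_derivative by blast
  then have "((\<lambda>y. 1 / ?e y) has_integral \<phi> 1 - \<phi> 0) {0..1}"
    by (rule fundamental_theorem_of_calculus[OF zero_le_one])
  moreover have "((\<lambda>y. 1 / ?e y) has_integral c) {0..1} \<longleftrightarrow> ((\<lambda>y. 1 / e y) has_integral c) {0..1}" for c
    by (rule has_integral_cong) auto
  ultimately have "((\<lambda>y. 1 / e y) has_integral \<phi> 1) {0..1}"
    by (simp add: \<phi>_def)
  moreover have "travel_time ?e \<phi>"
  proof
    show "\<exists>m M. 0 < m \<and> (\<forall>y. m \<le> ?e y \<and> ?e y \<le> M)"
      using y0 y1 pos by (intro exI[of _ "e y0"] exI[of _ "e y1"]) auto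
  qed (use e deriv in \<open>auto simp: \<phi>_def\<close>)
  ultimately show ?thesis using that by (simp add: integral_unique)
qed

text \<open>The inverse speeds add up. The sum is needed because the first-family line through the
  boundary point \<open>s = \<phi>2 y\<close> has the label
  \<open>\<phi>1 y + \<phi>2 y\<close>.\<close>

lemma travel_time_add:
  assumes "travel_time e1 \<phi>1" "travel_time e2 \<phi>2"
  shows "travel_time (\<lambda>y. 1 / (1 / e1 y + 1 / e2 y)) (\<lambda>y. \<phi>1 y + \<phi>2 y)"
proof -
  interpret t1: travel_time e1 \<phi>1 by fact
  interpret t2: travel_time e2 \<phi>2 by fact
  obtain m1 M1 where m1: "0 < m1" "\<And>y. m1 \<le> e1 y" "\<And>y. e1 y \<le> M1" using t1.e_bounds by auto
  obtain m2 M2 where m2: "0 < m2" "\<And>y. m2 \<le> e2 y" "\<And>y. e2 y \<le> M2" using t2.e_bounds by auto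
  have M: "0 < M1" "0 < M2" using m1(1) m1(2,3)[of 0] m2(1) m2(2,3)[of 0] by linarith+
  have pos: "0 < 1 / e1 y + 1 / e2 y" for y
    using t1.e_pos[of y] t2.e_pos[of y] by (simp add: add_pos_pos)
  show ?thesis
  proof
    show "continuous_on UNIV (\<lambda>y. 1 / (1 / e1 y + 1 / e2 y))"
      by (intro continuous_intros t1.inverse_e_cont t2.inverse_e_cont) (use pos less_irrefl in metis)
    show "\<exists>m M. 0 < m \<and> (\<forall>y. m \<le> 1 / (1 / e1 y + 1 / e2 y) \<and> 1 / (1 / e1 y + 1 / e2 y) \<le> M)"
    proof (rule exI[of _ "1 / (1 / m1 + 1 / m2)"], rule exI[of _ "1 / (1 / M1 + 1 / M2)"], intro conjI allI)
      show "0 < 1 / (1 / m1 + 1 / m2)" using m1 m2 by (simp add: add_pos_pos)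
      fix y
      have "1 / e1 y \<le> 1 / m1" "1 / e2 y \<le> 1 / m2"
        using m1 m2 t1.e_pos t2.e_pos by (auto intro!: frac_le)
      then show "1 / (1 / m1 + 1 / m2) \<le> 1 / (1 / e1 y + 1 / e2 y)"
        using pos[of y] by (intro frac_le) auto
      have "1 / M1 \<le> 1 / e1 y" "1 / M2 \<le> 1 / e2 y"
        using m1 m2 M t1.e_pos t2.e_pos by (auto intro!: frac_le)
      then show "1 / (1 / e1 y + 1 / e2 y) \<le> 1 / (1 / M1 + 1 / M2)"
        using M by (intro frac_le) (auto intro!: add_pos_pos)
    qed
    show "((\<lambda>y. \<phi>1 y + \<phi>2 y) has_real_derivative 1 / (1 / (1 / e1 y + 1 / e2 y))) (at y)" for y
      by (auto intro!: derivative_eq_intros t1.travel_deriv t2.travel_deriv)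
  qed simp
qed

text \<open>Transport only relates the two ends of a segment, but it does so for every segment
  inside \<open>D\<close>; applied to each initial part it yields the indefinite integral.\<close>

lemma transport_primitive_on:
  assumes "transport_along_characteristics a b D w f"
    and "\<And>\<sigma>. r \<le> \<sigma> \<Longrightarrow> \<sigma> \<le> s \<Longrightarrow> (X has_real_derivative a (X \<sigma>)) (at \<sigma>)"
    and "\<And>\<sigma>. r \<le> \<sigma> \<Longrightarrow> \<sigma> \<le> s \<Longrightarrow> (Y has_real_derivative b (Y \<sigma>)) (at \<sigma>)"
    and "\<And>\<sigma>. r \<le> \<sigma> \<Longrightarrow> \<sigma> \<le> s \<Longrightarrow> (X \<sigma>, Y \<sigma>) \<in> D" and "r \<le> s"
  shows "primitive_on r s (\<lambda>\<sigma>. w (X \<sigma>) (Y \<sigma>)) (\<lambda>\<sigma>. f (X \<sigma>) (Y \<sigma>))"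
proof -
  have "set_integrable lborel {r..x} (\<lambda>\<sigma>. f (X \<sigma>) (Y \<sigma>)) \<and>
      w (X x) (Y x) = w (X r) (Y r) + (LBINT \<sigma>:{r..x}. f (X \<sigma>) (Y \<sigma>))" if "r \<le> x" "x \<le> s" for x
    using assms(1)[unfolded transport_along_characteristics_def, rule_format, of r x X Y] assms(2-4) that
    by (meson DERIV_subset atLeastAtMost_iff order_trans subset_UNIV)
  then show ?thesis
    unfolding primitive_on_def using \<open>r \<le> s\<close> by (meson atLeastAtMost_iff order_refl)
qed

text \<open>The curves never leave \<open>D\<close>, so only values on \<open>D\<close> count. This
  permits extending coefficients and cutting off unknowns outside \<open>D\<close>.\<close>

lemma transport_along_characteristics_cong:
  assumes "transport_along_characteristics a b D w f"
    and "\<And>x y. (x, y) \<in> D \<Longrightarrow> a' x = a x \<and> b' y = b y \<and> w' x y = w x y \<and> f' x y = f x y"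
  shows "transport_along_characteristics a' b' D w' f'"
  unfolding transport_along_characteristics_def
proof (intro allI impI)
  fix r s :: real and X Y :: "real \<Rightarrow> real"
  assume rs: "r \<le> s" and XY: "\<forall>\<sigma>\<in>{r..s}.
        (X has_real_derivative a' (X \<sigma>)) (at \<sigma> within {r..s}) \<and>
        (Y has_real_derivative b' (Y \<sigma>)) (at \<sigma> within {r..s}) \<and>
        (X \<sigma>, Y \<sigma>) \<in> D"
  have XY': "\<forall>\<sigma>\<in>{r..s}.
        (X has_real_derivative a (X \<sigma>)) (at \<sigma> within {r..s}) \<and>
        (Y has_real_derivative b (Y \<sigma>)) (at \<sigma> within {r..s}) \<and>
        (X \<sigma>, Y \<sigma>) \<in> D" using XY assms(2) by metis
  have "set_integrable lborel {r..s} (\<lambda>\<sigma>. f (X \<sigma>) (Y \<sigma>))"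
    "w (X s) (Y s) = w (X r) (Y r) + (LBINT \<sigma>:{r..s}. f (X \<sigma>) (Y \<sigma>))"
    using assms(1)[unfolded transport_along_characteristics_def, rule_format, OF rs] XY' by blast+
  moreover have "set_integrable lborel {r..s} (\<lambda>\<sigma>. f' (X \<sigma>) (Y \<sigma>)) \<longleftrightarrow>
      set_integrable lborel {r..s} (\<lambda>\<sigma>. f (X \<sigma>) (Y \<sigma>))"
    by (rule set_integrable_cong) (use XY assms(2) in auto)
  moreover have "(LBINT \<sigma>:{r..s}. f' (X \<sigma>) (Y \<sigma>)) = (LBINT \<sigma>:{r..s}. f (X \<sigma>) (Y \<sigma>))"
    by (rule set_lebesgue_integral_cong) (use XY assms(2) in auto)
  ultimately show "set_integrable lborel {r..s} (\<lambda>\<sigma>. f' (X \<sigma>) (Y \<sigma>)) \<and>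
      w' (X s) (Y s) = w' (X r) (Y r) + (LBINT \<sigma>:{r..s}. f' (X \<sigma>) (Y \<sigma>))"
    using XY assms(2) rs by auto
qed

section \<open>Unique continuation in the spatial direction\<close>

text \<open>Phrased in \<open>ennreal\<close> so that such bounds can later be integrated over the
  labels by Tonelli without integrability conditions.\<close>

lemma primitive_on_abs_le:
  assumes "primitive_on a b F f" "F a = 0" "a \<le> x" "x \<le> b"
  shows "ennreal \<bar>F x\<bar> \<le> (\<integral>\<^sup>+ y. indicator {a..x} y * ennreal \<bar>f y\<bar> \<partial>lborel)"
proof -
  have P: "primitive_on a x F f" using primitive_on_subinterval[OF assms(1), of a x] assms by simp
  have "F x = (LBINT y. indicator {a..x} y *\<^sub>R f y)"
    using primitive_on_eq[OF P] assms by (simp add: set_lebesgue_integral_def)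
  then have "ennreal \<bar>F x\<bar> \<le> (\<integral>\<^sup>+ y. norm (indicator {a..x} y *\<^sub>R f y) \<partial>lborel)"
    using integral_norm_bound_ennreal[of lborel "\<lambda>y. indicator {a..x} y *\<^sub>R f y"] primitive_on_integrable[OF P]
    by (simp add: set_integrable_def)
  also have "\<dots> = (\<integral>\<^sup>+ y. indicator {a..x} y * ennreal \<bar>f y\<bar> \<partial>lborel)"
    by (rule nn_integral_cong) (auto simp: indicator_def)
  finally show ?thesis .
qed

lemma primitive_on_weighted_abs_le:
  assumes F: "primitive_on a b F (\<lambda>y. k y * f y)" and k: "\<And>y. \<bar>k y\<bar> \<le> C"
    and "F a = 0" "a \<le> x" "x \<le> b" and [measurable]: "f \<in> borel_measurable borel"
  shows "ennreal \<bar>F x\<bar> \<le> ennreal C * (\<integral>\<^sup>+ y. indicator {a..x} y * ennreal \<bar>f y\<bar> \<partial>lborel)"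
proof -
  have "0 \<le> C" using k[of 0] by linarith
  have "ennreal \<bar>F x\<bar> \<le> (\<integral>\<^sup>+ y. indicator {a..x} y * ennreal \<bar>k y * f y\<bar> \<partial>lborel)"
    by (rule primitive_on_abs_le) fact+
  also have "\<dots> \<le> (\<integral>\<^sup>+ y. C * (indicator {a..x} y * ennreal \<bar>f y\<bar>) \<partial>lborel)"
    using k \<open>0 \<le> C\<close>
    by (intro nn_integral_mono)
      (auto simp: indicator_def abs_mult ennreal_mult[symmetric] intro!: mult_right_mono ennreal_leI)
  also have "\<dots> = ennreal C * (\<integral>\<^sup>+ y. indicator {a..x} y * ennreal \<bar>f y\<bar> \<partial>lborel)"
    by (rule nn_integral_cmult) measurable
  finally show ?thesis .
qed

lemma nn_integral_translate:
  fixes k :: real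
  assumes [measurable]: "f \<in> borel_measurable borel"
  shows "(\<integral>\<^sup>+ c. f (c + k) \<partial>lborel) = (\<integral>\<^sup>+ t. f t \<partial>lborel)"
  using nn_integral_real_affine[OF assms, of 1 k] by (simp add: add.commute)

text \<open>Iterating the bound \<open>n\<close> times gains the factor
  \<open>(C * x) ^ n / fact n\<close>, which tends to zero. Finiteness of the total mass starts the
  iteration: in \<open>ennreal\<close> the integral inequality alone would admit infinite values of
  \<open>N\<close>.\<close>

lemma gronwall_zero:
  fixes N :: "real \<Rightarrow> ennreal" and C :: real
  assumes [measurable]: "N \<in> borel_measurable borel" and C: "0 \<le> C"
    and bound: "\<And>x. x \<in> {0..1} \<Longrightarrow> N x \<le> C * (\<integral>\<^sup>+ y. indicator {0..x} y * N y \<partial>lborel)"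
    and fin: "(\<integral>\<^sup>+ y. indicator {0..1} y * N y \<partial>lborel) < \<infinity>"
    and x: "x \<in> {0..1}"
  shows "N x = 0"
proof -
  obtain J where J: "0 \<le> J" "(\<integral>\<^sup>+ y. indicator {0..1} y * N y \<partial>lborel) = ennreal J"
    using fin by (cases "(\<integral>\<^sup>+ y. indicator {0..1} y * N y \<partial>lborel)") auto
  have le: "N x \<le> ennreal (J * C * (C ^ n * x ^ n / fact n))" if "x \<in> {0..1}" for x n
    using that
  proof (induction n arbitrary: x)
    case 0
    have "N x \<le> C * (\<integral>\<^sup>+ y. indicator {0..x} y * N y \<partial>lborel)" using bound 0 .
    also have "\<dots> \<le> C * (\<integral>\<^sup>+ y. indicator {0..1} y * N y \<partial>lborel)"
      using 0 by (intro mult_left_mono nn_integral_mono) (auto simp: indicator_def)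
    finally show ?case using J C by (simp add: ennreal_mult mult.commute)
  next
    case (Suc n)
    \<comment> \<open>Chosen so that \<open>K * y ^ Suc n\<close> is an antiderivative of the bound
      reached at stage \<open>n\<close>.\<close>
    define K where "K = J * C * C ^ n / fact (Suc n)"
    have "N x \<le> C * (\<integral>\<^sup>+ y. indicator {0..x} y * N y \<partial>lborel)" using bound Suc(2) .
    also have "\<dots> \<le> C * (\<integral>\<^sup>+ y. ennreal (J * C * (C ^ n * y ^ n / fact n)) * indicator {0..x} y \<partial>lborel)"
      using Suc by (intro mult_left_mono nn_integral_mono) (auto simp: indicator_def)
    also have "(\<integral>\<^sup>+ y. ennreal (J * C * (C ^ n * y ^ n / fact n)) * indicator {0..x} y \<partial>lborel) =
        ennreal (K * x ^ Suc n - K * 0 ^ Suc n)"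
    proof (rule nn_integral_FTC_Icc)
      have "K * (real (Suc n) * y ^ n) = J * C * (C ^ n * y ^ n / fact n)" for y
        unfolding K_def fact_Suc by (simp add: field_simps del: of_nat_Suc)
      then show "((\<lambda>y. K * y ^ Suc n) has_real_derivative J * C * (C ^ n * y ^ n / fact n)) (at y)" for y
        using DERIV_cmult[OF DERIV_pow[of "Suc n" y], of K] by simp
      show "0 \<le> J * C * (C ^ n * y ^ n / fact n)" if "y \<in> {0..x}" for y
        using that J C by auto
    qed (use Suc(2) in auto)
    also have "C * ennreal (K * x ^ Suc n - K * 0 ^ Suc n) =
        ennreal (J * C * (C ^ Suc n * x ^ Suc n / fact (Suc n)))"
      using C J Suc(2) by (simp add: K_def ennreal_mult'[symmetric] mult_ac)
    finally show ?case .
  qed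
  have "(\<lambda>n. J * C * (inverse (fact n) * (C * x) ^ n)) \<longlonglongrightarrow> J * C * 0"
    by (intro tendsto_mult_left summable_LIMSEQ_zero summable_exp)
  then have "(\<lambda>n. ennreal (J * C * (C ^ n * x ^ n / fact n))) \<longlonglongrightarrow> ennreal 0"
    by (intro tendsto_ennrealI) (simp add: field_simps power_mult_distrib)
  then have "N x \<le> ennreal 0"
    by (rule LIMSEQ_le_const) (use le[OF x] in auto)
  then show ?thesis by simp
qed

text \<open>At each fixed position, passing from the label \<open>c\<close> to the time
  \<open>c + \<psi> x\<close> preserves measure, so an estimate on lines becomes an estimate of
  slice masses. By \<open>down\<close>, a line that is in \<Omega> at \<open>x\<close> was there at
  all smaller positions, so the cut-off may be moved inside the line integral. The second claim
  returns to lines: on almost every line \<open>w\<close> vanishes at all points of \<Omega>, not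
  just at almost all of them.\<close>

lemma nn_integral_along_lines:
  fixes f w :: "real \<Rightarrow> real \<Rightarrow> real" and C :: real and \<Omega> :: "(real \<times> real) set"
  assumes [measurable]: "case_prod f \<in> borel_measurable (borel \<Otimes>\<^sub>M borel)"
      "case_prod w \<in> borel_measurable (borel \<Otimes>\<^sub>M borel)" "\<psi> \<in> borel_measurable borel"
      "\<Omega> \<in> sets (borel \<Otimes>\<^sub>M borel)"
    and down: "\<And>c x y. (x, c + \<psi> x) \<in> \<Omega> \<Longrightarrow> 0 \<le> y \<Longrightarrow> y \<le> x \<Longrightarrow> x \<le> 1 \<Longrightarrow> (y, c + \<psi> y) \<in> \<Omega>"
    and line: "AE c in lborel. \<forall>x\<in>{0..1}. (x, c + \<psi> x) \<in> \<Omega> \<longrightarrow>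
      ennreal \<bar>w x (c + \<psi> x)\<bar> \<le> C * (\<integral>\<^sup>+ y. indicator {0..x} y * ennreal \<bar>f y (c + \<psi> y)\<bar> \<partial>lborel)"
  shows "x \<in> {0..1} \<Longrightarrow> (\<integral>\<^sup>+ t. indicator \<Omega> (x, t) * ennreal \<bar>w x t\<bar> \<partial>lborel) \<le>
      C * (\<integral>\<^sup>+ y. indicator {0..x} y * (\<integral>\<^sup>+ t. indicator \<Omega> (y, t) * ennreal \<bar>f y t\<bar> \<partial>lborel) \<partial>lborel)"
    and "(\<And>y. y \<in> {0..1} \<Longrightarrow> (\<integral>\<^sup>+ t. indicator \<Omega> (y, t) * ennreal \<bar>f y t\<bar> \<partial>lborel) = 0) \<Longrightarrow>
      AE c in lborel. \<forall>x\<in>{0..1}. (x, c + \<psi> x) \<in> \<Omega> \<longrightarrow> w x (c + \<psi> x) = 0"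
proof -
  have shift: "(\<integral>\<^sup>+ c. indicator \<Omega> (y, c + \<psi> y) * ennreal \<bar>g y (c + \<psi> y)\<bar> \<partial>lborel) =
      (\<integral>\<^sup>+ t. indicator \<Omega> (y, t) * ennreal \<bar>g y t\<bar> \<partial>lborel)"
    if [measurable]: "case_prod g \<in> borel_measurable (borel \<Otimes>\<^sub>M borel)" for y and g :: "real \<Rightarrow> real \<Rightarrow> real"
    by (rule nn_integral_translate[where f = "\<lambda>t. indicator \<Omega> (y, t) * ennreal \<bar>g y t\<bar>"]) measurable
  have pt: "indicator \<Omega> (x, c + \<psi> x) * (\<integral>\<^sup>+ y. indicator {0..x} y * ennreal \<bar>f y (c + \<psi> y)\<bar> \<partial>lborel) \<le>
      (\<integral>\<^sup>+ y. indicator {0..x} y * (indicator \<Omega> (y, c + \<psi> y) * ennreal \<bar>f y (c + \<psi> y)\<bar>) \<partial>lborel)"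
    if "x \<in> {0..1}" for x c
    using that down[of x c] by (cases "(x, c + \<psi> x) \<in> \<Omega>") (auto intro!: nn_integral_mono simp: indicator_def)
  have swap: "(\<integral>\<^sup>+ c. (\<integral>\<^sup>+ y. indicator {0..x} y * (indicator \<Omega> (y, c + \<psi> y) * ennreal \<bar>f y (c + \<psi> y)\<bar>) \<partial>lborel) \<partial>lborel)
      = (\<integral>\<^sup>+ y. indicator {0..x} y * (\<integral>\<^sup>+ t. indicator \<Omega> (y, t) * ennreal \<bar>f y t\<bar> \<partial>lborel) \<partial>lborel)" for x
  proof -
    have "(\<integral>\<^sup>+ c. (\<integral>\<^sup>+ y. indicator {0..x} y * (indicator \<Omega> (y, c + \<psi> y) * ennreal \<bar>f y (c + \<psi> y)\<bar>) \<partial>lborel) \<partial>lborel) =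
        (\<integral>\<^sup>+ y. (\<integral>\<^sup>+ c. indicator {0..x} y * (indicator \<Omega> (y, c + \<psi> y) * ennreal \<bar>f y (c + \<psi> y)\<bar>) \<partial>lborel) \<partial>lborel)"
      by (rule lborel_pair.Fubini') measurable
    also have "\<dots> = (\<integral>\<^sup>+ y. indicator {0..x} y * (\<integral>\<^sup>+ t. indicator \<Omega> (y, t) * ennreal \<bar>f y t\<bar> \<partial>lborel) \<partial>lborel)"
      by (subst nn_integral_cmult) (simp_all add: shift)
    finally show ?thesis .
  qed
  show "(\<integral>\<^sup>+ t. indicator \<Omega> (x, t) * ennreal \<bar>w x t\<bar> \<partial>lborel) \<le>
      C * (\<integral>\<^sup>+ y. indicator {0..x} y * (\<integral>\<^sup>+ t. indicator \<Omega> (y, t) * ennreal \<bar>f y t\<bar> \<partial>lborel) \<partial>lborel)"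
    if x: "x \<in> {0..1}"
  proof -
    have "(\<integral>\<^sup>+ t. indicator \<Omega> (x, t) * ennreal \<bar>w x t\<bar> \<partial>lborel) =
        (\<integral>\<^sup>+ c. indicator \<Omega> (x, c + \<psi> x) * ennreal \<bar>w x (c + \<psi> x)\<bar> \<partial>lborel)"
      by (rule shift[symmetric]) measurable
    also have "\<dots> \<le> (\<integral>\<^sup>+ c. C * (indicator \<Omega> (x, c + \<psi> x) *
        (\<integral>\<^sup>+ y. indicator {0..x} y * ennreal \<bar>f y (c + \<psi> y)\<bar> \<partial>lborel)) \<partial>lborel)"
      using line by (intro nn_integral_mono_AE, eventually_elim) (use x in \<open>auto simp: indicator_def\<close>)
    also have "\<dots> = C * (\<integral>\<^sup>+ c. indicator \<Omega> (x, c + \<psi> x) *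
        (\<integral>\<^sup>+ y. indicator {0..x} y * ennreal \<bar>f y (c + \<psi> y)\<bar> \<partial>lborel) \<partial>lborel)"
      by (rule nn_integral_cmult) measurable
    also have "\<dots> \<le> C * (\<integral>\<^sup>+ c. (\<integral>\<^sup>+ y. indicator {0..x} y *
        (indicator \<Omega> (y, c + \<psi> y) * ennreal \<bar>f y (c + \<psi> y)\<bar>) \<partial>lborel) \<partial>lborel)"
      by (intro mult_left_mono nn_integral_mono pt[OF x]) auto
    finally show ?thesis unfolding swap .
  qed
  show "AE c in lborel. \<forall>x\<in>{0..1}. (x, c + \<psi> x) \<in> \<Omega> \<longrightarrow> w x (c + \<psi> x) = 0"
    if zero: "\<And>y. y \<in> {0..1} \<Longrightarrow> (\<integral>\<^sup>+ t. indicator \<Omega> (y, t) * ennreal \<bar>f y t\<bar> \<partial>lborel) = 0"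
  proof -
    have "(\<integral>\<^sup>+ y. indicator {0..1} y * (\<integral>\<^sup>+ t. indicator \<Omega> (y, t) * ennreal \<bar>f y t\<bar> \<partial>lborel) \<partial>lborel) =
        (\<integral>\<^sup>+ y. 0 \<partial>(lborel :: real measure))"
    proof (rule nn_integral_cong)
      show "indicator {0..1} y * (\<integral>\<^sup>+ t. indicator \<Omega> (y, t) * ennreal \<bar>f y t\<bar> \<partial>lborel) = 0" for y
        using zero[of y] by (cases "y \<in> {0..1}") simp_all
    qed
    then have "(\<integral>\<^sup>+ c. (\<integral>\<^sup>+ y. indicator {0..1} y *
        (indicator \<Omega> (y, c + \<psi> y) * ennreal \<bar>f y (c + \<psi> y)\<bar>) \<partial>lborel) \<partial>lborel) = 0"
      unfolding swap[of 1] by simp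
    then have "AE c in lborel. (\<integral>\<^sup>+ y. indicator {0..1} y *
        (indicator \<Omega> (y, c + \<psi> y) * ennreal \<bar>f y (c + \<psi> y)\<bar>) \<partial>lborel) = 0"
      by (subst (asm) nn_integral_0_iff_AE) measurable
    then show ?thesis
      using line
    proof eventually_elim
      case (elim c)
      show ?case
      proof (intro ballI impI)
        fix x :: real assume x: "x \<in> {0..1}" and \<Omega>: "(x, c + \<psi> x) \<in> \<Omega>"
        have "(\<integral>\<^sup>+ y. indicator {0..x} y * ennreal \<bar>f y (c + \<psi> y)\<bar> \<partial>lborel) \<le>
            (\<integral>\<^sup>+ y. indicator {0..x} y * (indicator \<Omega> (y, c + \<psi> y) * ennreal \<bar>f y (c + \<psi> y)\<bar>) \<partial>lborel)"
          using pt[OF x, of c] \<Omega> by simp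
        also have "\<dots> \<le> (\<integral>\<^sup>+ y. indicator {0..1} y * (indicator \<Omega> (y, c + \<psi> y) * ennreal \<bar>f y (c + \<psi> y)\<bar>) \<partial>lborel)"
          by (intro nn_integral_mono) (use x in \<open>auto simp: indicator_def\<close>)
        finally have "(\<integral>\<^sup>+ y. indicator {0..x} y * ennreal \<bar>f y (c + \<psi> y)\<bar> \<partial>lborel) = 0"
          using elim(1) by simp
        then show "w x (c + \<psi> x) = 0" using elim(2) x \<Omega> by fastforce
      qed
    qed
  qed
qed

text \<open>The plant without boundary or initial data. Of the L2 bounds only integrability over
  slices and over time strips is kept.\<close>

locale hyperbolic_pair =
  s1: travel_time e1 \<phi>1 + s2: travel_time e2 \<phi>2
  for e1 \<phi>1 e2 \<phi>2 :: "real \<Rightarrow> real" +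
  fixes c1 c2 :: "real \<Rightarrow> real" and u1 u2 :: "real \<Rightarrow> real \<Rightarrow> real"
  assumes c1_borel [measurable]: "c1 \<in> borel_measurable borel"
    and c2_borel [measurable]: "c2 \<in> borel_measurable borel"
    and c_bound: "\<exists>C. \<forall>y. \<bar>c1 y\<bar> \<le> C \<and> \<bar>c2 y\<bar> \<le> C"
    and u1_borel [measurable]: "case_prod u1 \<in> borel_measurable (borel \<Otimes>\<^sub>M borel)"
    and u2_borel [measurable]: "case_prod u2 \<in> borel_measurable (borel \<Otimes>\<^sub>M borel)"
    and u1_slice: "0 \<le> t \<Longrightarrow> set_integrable lborel {0..1} (\<lambda>y. u1 y t)"
    and u2_slice: "0 \<le> t \<Longrightarrow> set_integrable lborel {0..1} (\<lambda>y. u2 y t)"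
    and u1_strip: "set_integrable (lborel \<Otimes>\<^sub>M lborel) ({0..T} \<times> {0..1}) (\<lambda>(t, y). u1 y t)"
    and u2_strip: "set_integrable (lborel \<Otimes>\<^sub>M lborel) ({0..T} \<times> {0..1}) (\<lambda>(t, y). u2 y t)"
    and u1_transport: "transport_along_characteristics e1 (\<lambda>t. 1) state_domain u1 (\<lambda>x t. c1 x * u2 x t)"
    and u2_transport: "transport_along_characteristics (\<lambda>x. - e2 x) (\<lambda>t. 1) state_domain u2 (\<lambda>x t. c2 x * u1 x t)"
begin

text \<open>The label \<open>c\<close> is the time at which the line meets \<open>y = 0\<close>,
  possibly negative. Time grows with \<open>y\<close>, so a nonnegative time at \<open>x\<close>
  suffices for the whole segment up to 1.\<close>

lemma u1_line:
  assumes "0 \<le> x" "x \<le> 1" "0 \<le> c + \<phi>1 x"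
  shows "primitive_on x 1 (\<lambda>y. u1 y (c + \<phi>1 y)) (\<lambda>y. c1 y / e1 y * u2 y (c + \<phi>1 y))"
proof -
  have "primitive_on (\<phi>1 x) (\<phi>1 1) (\<lambda>\<sigma>. u1 (s1.position \<sigma>) (c + \<sigma>))
      (\<lambda>\<sigma>. c1 (s1.position \<sigma>) * u2 (s1.position \<sigma>) (c + \<sigma>))"
  proof (rule transport_primitive_on[OF u1_transport])
    show "(s1.position \<sigma>, c + \<sigma>) \<in> state_domain" if "\<phi>1 x \<le> \<sigma>" "\<sigma> \<le> \<phi>1 1" for \<sigma>
      using that assms order_trans[of 0 "\<phi>1 x" \<sigma>]
      by (auto simp: state_domain_def s1.position_le_iff s1.le_position_iff)
  qed (use assms in \<open>auto intro!: derivative_eq_intros s1.position_deriv\<close>)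
  then have "primitive_on (0 + \<phi>1 x) (0 + \<phi>1 1) (\<lambda>\<sigma>. u1 (s1.position \<sigma>) (c + \<sigma>))
      (\<lambda>\<sigma>. c1 (s1.position \<sigma>) * u2 (s1.position \<sigma>) (c + \<sigma>))" by simp
  from s1.primitive_on_rising[OF this assms(2)] show ?thesis by simp
qed

text \<open>Here time falls as \<open>y\<close> grows, whence the minus sign in the density and a
  time condition at the right end \<open>x\<close>; \<open>c\<close> is the time of arrival at
  \<open>y = 0\<close>.\<close>

lemma u2_line:
  assumes "0 \<le> x" "x \<le> 1" "0 \<le> c - \<phi>2 x"
  shows "primitive_on 0 x (\<lambda>y. u2 y (c - \<phi>2 y)) (\<lambda>y. - c2 y / e2 y * u1 y (c - \<phi>2 y))"
proof -
  have "primitive_on (- \<phi>2 x) 0 (\<lambda>\<sigma>. u2 (s2.position (- \<sigma>)) (c + \<sigma>))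
      (\<lambda>\<sigma>. c2 (s2.position (- \<sigma>)) * u1 (s2.position (- \<sigma>)) (c + \<sigma>))"
  proof (rule transport_primitive_on[OF u2_transport])
    show "(s2.position (- \<sigma>), c + \<sigma>) \<in> state_domain" if "- \<phi>2 x \<le> \<sigma>" "\<sigma> \<le> 0" for \<sigma>
    proof -
      have "- \<sigma> \<le> \<phi>2 1" using that assms s2.travel_le_iff[of x 1] by linarith
      then show ?thesis
        using that assms by (auto simp: state_domain_def s2.position_le_iff s2.le_position_iff)
    qed
    show "((\<lambda>\<sigma>. s2.position (- \<sigma>)) has_real_derivative - e2 (s2.position (- \<sigma>))) (at \<sigma>)" for \<sigma>
    proof -
      have "((\<lambda>\<sigma>. s2.position (- \<sigma>)) has_real_derivative e2 (s2.position (- \<sigma>)) * - 1) (at \<sigma>)"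
        by (rule DERIV_chain2[OF s2.position_deriv]) (auto intro!: derivative_eq_intros)
      then show ?thesis by simp
    qed
  qed (use assms in \<open>auto intro!: derivative_eq_intros\<close>)
  then have "primitive_on (0 - \<phi>2 x) (0 - \<phi>2 0) (\<lambda>\<sigma>. u2 (s2.position (- \<sigma>)) (c + \<sigma>))
      (\<lambda>\<sigma>. c2 (s2.position (- \<sigma>)) * u1 (s2.position (- \<sigma>)) (c + \<sigma>))" by simp
  from s2.primitive_on_falling[OF this assms(1)] show ?thesis by simp
qed

lemma coeff_bound: "\<exists>C\<ge>0. \<forall>y. \<bar>c1 y / e1 y\<bar> \<le> C \<and> \<bar>c2 y / e2 y\<bar> \<le> C"
proof -
  obtain C where C: "\<And>y. \<bar>c1 y\<bar> \<le> C" "\<And>y. \<bar>c2 y\<bar> \<le> C" using c_bound by auto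
  obtain m1 where m1: "0 < m1" "\<And>y. m1 \<le> e1 y" using s1.e_bounds by auto
  obtain m2 where m2: "0 < m2" "\<And>y. m2 \<le> e2 y" using s2.e_bounds by auto
  have "0 \<le> C" using C(1)[of 0] by linarith
  have "\<bar>c1 y / e1 y\<bar> \<le> C / m1" "\<bar>c2 y / e2 y\<bar> \<le> C / m2" for y
    using C m1 m2 s1.e_pos[of y] s2.e_pos[of y] \<open>0 \<le> C\<close> by (auto simp: abs_divide intro!: frac_le)
  then show ?thesis
    using \<open>0 \<le> C\<close> m1 m2 by (intro exI[of _ "max (C / m1) (C / m2)"]) (auto simp: le_max_iff_disj)
qed

text \<open>With \<open>y\<close> as the evolution variable both equations remain transport
  equations and both unknowns start from zero at \<open>y = 0\<close>. The edge
  \<open>t = t1 + \<phi>1 x\<close> of the zero region is the characteristic of \<open>u1\<close>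
  leaving \<open>y = 0\<close> at time \<open>t1\<close>.\<close>

lemma sideways_uniqueness:
  assumes t1: "0 \<le> t1" and zero: "AE t in lborel. t1 < t \<longrightarrow> u1 0 t = 0 \<and> u2 0 t = 0"
  shows "AE c in lborel. \<forall>x\<in>{0..1}. t1 \<le> c \<longrightarrow> u1 x (c + \<phi>1 x) = 0" (is ?u1)
    and "AE c in lborel. \<forall>x\<in>{0..1}. t1 + \<phi>1 x + \<phi>2 x \<le> c \<longrightarrow> u2 x (c - \<phi>2 x) = 0" (is ?u2)
proof -
  obtain C where C: "0 \<le> C" "\<And>y. \<bar>c1 y / e1 y\<bar> \<le> C" "\<And>y. \<bar>c2 y / e2 y\<bar> \<le> C"
    using coeff_bound by auto
  \<comment> \<open>The lower edge is a line of the first family and the upper edge one of the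
    second, so moving towards \<open>y = 0\<close> along either family stays inside. The upper edge
    also keeps the masses finite; \<open>T\<close> finally runs through the natural numbers.\<close>
  define \<Omega> where "\<Omega> T = {p. t1 + \<phi>1 (fst p) \<le> snd p \<and> snd p \<le> T - \<phi>2 (fst p)}" for T :: real
  have \<Omega>_borel [measurable]: "\<Omega> T \<in> sets (borel \<Otimes>\<^sub>M borel)" for T
  proof -
    have "\<Omega> T = {p \<in> space (borel \<Otimes>\<^sub>M borel). t1 + \<phi>1 (fst p) \<le> snd p \<and> snd p \<le> T - \<phi>2 (fst p)}"
      by (simp add: \<Omega>_def space_pair_measure)
    also have "\<dots> \<in> sets (borel \<Otimes>\<^sub>M borel)" by measurable
    finally show ?thesis .
  qed
  have zero': "AE c in lborel. t1 \<le> c \<longrightarrow> u1 0 c = 0 \<and> u2 0 c = 0"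
    using zero AE_lborel_singleton[of t1] by eventually_elim auto
  have line1: "AE c in lborel. \<forall>x\<in>{0..1}. (x, c + \<phi>1 x) \<in> \<Omega> T \<longrightarrow> ennreal \<bar>u1 x (c + \<phi>1 x)\<bar> \<le>
      C * (\<integral>\<^sup>+ y. indicator {0..x} y * ennreal \<bar>u2 y (c + \<phi>1 y)\<bar> \<partial>lborel)" for T
    using zero'
  proof eventually_elim
    case (elim c)
    show ?case
    proof (intro ballI impI)
      fix x assume x: "x \<in> {0..1}" "(x, c + \<phi>1 x) \<in> \<Omega> T"
      then have "t1 \<le> c" by (simp add: \<Omega>_def)
      then show "ennreal \<bar>u1 x (c + \<phi>1 x)\<bar> \<le>
          C * (\<integral>\<^sup>+ y. indicator {0..x} y * ennreal \<bar>u2 y (c + \<phi>1 y)\<bar> \<partial>lborel)"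
        using t1 elim x by (intro primitive_on_weighted_abs_le[OF u1_line[of 0 c] C(2)]) auto
    qed
  qed
  have line2: "AE c in lborel. \<forall>x\<in>{0..1}. (x, c + - \<phi>2 x) \<in> \<Omega> T \<longrightarrow> ennreal \<bar>u2 x (c + - \<phi>2 x)\<bar> \<le>
      C * (\<integral>\<^sup>+ y. indicator {0..x} y * ennreal \<bar>u1 y (c + - \<phi>2 y)\<bar> \<partial>lborel)" for T
    using zero'
  proof eventually_elim
    case (elim c)
    show ?case
    proof (intro ballI impI)
      fix x assume x: "x \<in> {0..1}" "(x, c + - \<phi>2 x) \<in> \<Omega> T"
      then have pos: "0 \<le> \<phi>1 x" "0 \<le> \<phi>2 x" and c: "t1 + \<phi>1 x + \<phi>2 x \<le> c"
        by (auto simp: \<Omega>_def)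
      have c0: "0 \<le> c - \<phi>2 x" "t1 \<le> c" using pos c t1 by linarith+
      have "ennreal \<bar>u2 x (c - \<phi>2 x)\<bar> \<le>
          C * (\<integral>\<^sup>+ y. indicator {0..x} y * ennreal \<bar>u1 y (c - \<phi>2 y)\<bar> \<partial>lborel)"
        by (rule primitive_on_weighted_abs_le[OF u2_line[of x c], where x = x])
          (use c0 t1 elim x c C in \<open>auto simp del: abs_divide\<close>)
      then show "ennreal \<bar>u2 x (c + - \<phi>2 x)\<bar> \<le>
          C * (\<integral>\<^sup>+ y. indicator {0..x} y * ennreal \<bar>u1 y (c + - \<phi>2 y)\<bar> \<partial>lborel)"
        by simp
    qed
  qed
  have down1: "(y, c + \<phi>1 y) \<in> \<Omega> T" if "(x, c + \<phi>1 x) \<in> \<Omega> T" "0 \<le> y" "y \<le> x" "x \<le> 1" for c x y T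
  proof -
    have "\<phi>1 y \<le> \<phi>1 x" "\<phi>2 y \<le> \<phi>2 x" using that by auto
    then show ?thesis using that(1) unfolding \<Omega>_def mem_Collect_eq fst_conv snd_conv by linarith
  qed
  have down2: "(y, c + - \<phi>2 y) \<in> \<Omega> T" if "(x, c + - \<phi>2 x) \<in> \<Omega> T" "0 \<le> y" "y \<le> x" "x \<le> 1" for c x y T
  proof -
    have "\<phi>1 y \<le> \<phi>1 x" "\<phi>2 y \<le> \<phi>2 x" using that by auto
    then show ?thesis using that(1) unfolding \<Omega>_def mem_Collect_eq fst_conv snd_conv by linarith
  qed
  note lines1 = nn_integral_along_lines[OF u2_borel u1_borel s1.borel_travel \<Omega>_borel down1 line1]
  note lines2 = nn_integral_along_lines[OF u1_borel u2_borel borel_measurable_uminus[OF s2.borel_travel] \<Omega>_borel down2 line2]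
  define N1 where "N1 T x = (\<integral>\<^sup>+ t. indicator (\<Omega> T) (x, t) * ennreal \<bar>u1 x t\<bar> \<partial>lborel)" for T x
  define N2 where "N2 T x = (\<integral>\<^sup>+ t. indicator (\<Omega> T) (x, t) * ennreal \<bar>u2 x t\<bar> \<partial>lborel)" for T x
  have N_borel [measurable]: "N1 T \<in> borel_measurable borel" "N2 T \<in> borel_measurable borel" for T
    unfolding N1_def[abs_def] N2_def[abs_def] by measurable
  have fin: "(\<integral>\<^sup>+ y. indicator {0..1} y * (\<integral>\<^sup>+ t. indicator (\<Omega> T) (y, t) * ennreal \<bar>u y t\<bar> \<partial>lborel) \<partial>lborel) < \<infinity>"
    if u: "set_integrable (lborel \<Otimes>\<^sub>M lborel) ({0..T} \<times> {0..1}) (\<lambda>(t, y). u y t)"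
      and [measurable]: "case_prod u \<in> borel_measurable (borel \<Otimes>\<^sub>M borel)"
    for u :: "real \<Rightarrow> real \<Rightarrow> real" and T
  proof -
    have [measurable]: "(\<lambda>p. ennreal (norm (indicat_real ({0..T} \<times> {0..1}) p *\<^sub>R (case p of (t, y) \<Rightarrow> u y t))))
        \<in> borel_measurable (lborel \<Otimes>\<^sub>M lborel)"
      using u unfolding set_integrable_def by (intro measurable_compose[OF _ measurable_ennreal]) auto
    have "(\<integral>\<^sup>+ y. indicator {0..1} y * (\<integral>\<^sup>+ t. indicator (\<Omega> T) (y, t) * ennreal \<bar>u y t\<bar> \<partial>lborel) \<partial>lborel) \<le>
        (\<integral>\<^sup>+ y. (\<integral>\<^sup>+ t. norm (indicator ({0..T} \<times> {0..1}) (t, y) *\<^sub>R (case (t, y) of (t, y) \<Rightarrow> u y t)) \<partial>lborel) \<partial>lborel)"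
    proof (rule nn_integral_mono)
      fix y :: real
      show "indicator {0..1} y * (\<integral>\<^sup>+ t. indicator (\<Omega> T) (y, t) * ennreal \<bar>u y t\<bar> \<partial>lborel) \<le>
        (\<integral>\<^sup>+ t. norm (indicator ({0..T} \<times> {0..1}) (t, y) *\<^sub>R (case (t, y) of (t, y) \<Rightarrow> u y t)) \<partial>lborel)"
      proof (cases "y \<in> {0..1}")
        case True
        have "indicator (\<Omega> T) (y, t) * ennreal \<bar>u y t\<bar> \<le>
            norm (indicator ({0..T} \<times> {0..1}) (t, y) *\<^sub>R (case (t, y) of (t, y) \<Rightarrow> u y t))" for t
        proof (cases "(y, t) \<in> \<Omega> T")
          case in\<Omega>: True
          have "0 \<le> \<phi>1 y" "0 \<le> \<phi>2 y" using True by auto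
          then have "0 \<le> t" "t \<le> T" using in\<Omega> t1 unfolding \<Omega>_def mem_Collect_eq fst_conv snd_conv by linarith+
          then show ?thesis using True in\<Omega> by simp
        qed simp
        then show ?thesis using True by (simp add: nn_integral_mono)
      qed simp
    qed
    also have "\<dots> = (\<integral>\<^sup>+ p. norm (indicator ({0..T} \<times> {0..1}) p *\<^sub>R (case p of (t, y) \<Rightarrow> u y t)) \<partial>(lborel \<Otimes>\<^sub>M lborel))"
      by (rule lborel_pair.nn_integral_snd) measurable
    also have "\<dots> < \<infinity>" using u unfolding set_integrable_def integrable_iff_bounded by simp
    finally show ?thesis .
  qed
  have N0: "N1 T x = 0 \<and> N2 T x = 0" if x: "x \<in> {0..1}" for T x
  proof -
    \<comment> \<open>Each mass is bounded by the integral of the other one, so only their sum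
      satisfies a closed Gronwall inequality.\<close>
    have "N1 T x + N2 T x = 0"
    proof (rule gronwall_zero[OF _ C(1) _ _ x])
      show "(\<lambda>x. N1 T x + N2 T x) \<in> borel_measurable borel" by measurable
      fix x :: real assume x: "x \<in> {0..1}"
      have "N1 T x + N2 T x \<le> C * (\<integral>\<^sup>+ y. indicator {0..x} y * N2 T y \<partial>lborel) +
          C * (\<integral>\<^sup>+ y. indicator {0..x} y * N1 T y \<partial>lborel)"
        using lines1(1)[OF _ _ _ _ x, of T] lines2(1)[OF _ _ _ _ x, of T]
        unfolding N1_def N2_def by (intro add_mono) auto
      also have "\<dots> = C * (\<integral>\<^sup>+ y. indicator {0..x} y * (N1 T y + N2 T y) \<partial>lborel)"
        by (simp add: distrib_left nn_integral_add add.commute)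
      finally show "N1 T x + N2 T x \<le> C * (\<integral>\<^sup>+ y. indicator {0..x} y * (N1 T y + N2 T y) \<partial>lborel)" .
    next
      have "(\<integral>\<^sup>+ y. indicator {0..1} y * (N1 T y + N2 T y) \<partial>lborel) =
          (\<integral>\<^sup>+ y. indicator {0..1} y * N1 T y \<partial>lborel) + (\<integral>\<^sup>+ y. indicator {0..1} y * N2 T y \<partial>lborel)"
        by (simp add: distrib_left nn_integral_add)
      then show "(\<integral>\<^sup>+ y. indicator {0..1} y * (N1 T y + N2 T y) \<partial>lborel) < \<infinity>"
        using fin[OF u1_strip u1_borel, of T] fin[OF u2_strip u2_borel, of T]
        unfolding N1_def N2_def by (simp add: less_top)
    qed
    then show ?thesis by simp
  qed
  have "AE c in lborel. \<forall>n::nat. \<forall>x\<in>{0..1}. (x, c + \<phi>1 x) \<in> \<Omega> (real n) \<longrightarrow> u1 x (c + \<phi>1 x) = 0"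
    unfolding AE_all_countable using N0 unfolding N2_def by (intro allI lines1(2)) auto
  then show ?u1
  proof eventually_elim
    case (elim c)
    show ?case
    proof (intro ballI impI)
      fix x :: real assume "x \<in> {0..1}" "t1 \<le> c"
      moreover obtain n :: nat where "c + \<phi>1 x + \<phi>2 x \<le> real n" using real_arch_simple by blast
      ultimately show "u1 x (c + \<phi>1 x) = 0" using elim by (auto simp: \<Omega>_def dest!: spec[of _ n])
    qed
  qed
  have "AE c in lborel. \<forall>n::nat. \<forall>x\<in>{0..1}. (x, c + - \<phi>2 x) \<in> \<Omega> (real n) \<longrightarrow> u2 x (c + - \<phi>2 x) = 0"
    unfolding AE_all_countable using N0 unfolding N1_def by (intro allI lines2(2)) auto
  then show ?u2
  proof eventually_elim
    case (elim c)
    show ?case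
    proof (intro ballI impI)
      fix x :: real assume "x \<in> {0..1}" "t1 + \<phi>1 x + \<phi>2 x \<le> c"
      moreover obtain n :: nat where "c \<le> real n" using real_arch_simple by blast
      ultimately show "u2 x (c - \<phi>2 x) = 0" using elim by (auto simp: \<Omega>_def dest!: spec[of _ n])
    qed
  qed
qed

end

section \<open>Kernels along characteristics\<close>

lemma primitive_on_diff_const:
  assumes "primitive_on a b F f"
  shows "primitive_on a b (\<lambda>x. F x - d) f"
  unfolding primitive_on_def
proof safe
  show "set_integrable lborel {a..b} f" using assms by (rule primitive_on_integrable)
  show "F x - d = F a - d + (LBINT y:{a..x}. f y)" if "x \<in> {a..b}" for x
    using primitive_onD[OF assms, of x] that by simp
qed

text \<open>The values at \<open>z\<close> and at any \<open>y\<close> differ by at most the mass of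
  the density. Averaging over \<open>y\<close> in an interval of length one replaces the value at
  \<open>y\<close> by an integral.\<close>

lemma primitive_on_trace:
  assumes F: "primitive_on 0 1 F (\<lambda>y. k y * f y)" and k: "\<And>y. \<bar>k y\<bar> \<le> C"
    and [measurable]: "F \<in> borel_measurable borel" "f \<in> borel_measurable borel" and z: "z \<in> {0..1}"
  shows "ennreal \<bar>F z\<bar> \<le> (\<integral>\<^sup>+ y. indicator {0..1} y * ennreal \<bar>F y\<bar> \<partial>lborel) +
    ennreal C * (\<integral>\<^sup>+ y. indicator {0..1} y * ennreal \<bar>f y\<bar> \<partial>lborel)"
proof -
  let ?R = "ennreal C * (\<integral>\<^sup>+ y. indicator {0..1} y * ennreal \<bar>f y\<bar> \<partial>lborel)"
  have diff: "ennreal \<bar>F x - F y\<bar> \<le> ?R" if "0 \<le> y" "y \<le> x" "x \<le> 1" for x y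
  proof -
    have "ennreal \<bar>F x - F y\<bar> \<le> ennreal C * (\<integral>\<^sup>+ y'. indicator {y..x} y' * ennreal \<bar>f y'\<bar> \<partial>lborel)"
      by (rule primitive_on_weighted_abs_le[OF primitive_on_diff_const[OF primitive_on_subinterval[OF F]] k, where b = x])
        (use that in auto)
    also have "\<dots> \<le> ?R"
      by (intro mult_left_mono nn_integral_mono) (use that in \<open>auto simp: indicator_def\<close>)
    finally show ?thesis .
  qed
  have pt: "ennreal \<bar>F z\<bar> \<le> ennreal \<bar>F y\<bar> + ?R" if "y \<in> {0..1}" for y
  proof -
    have "ennreal \<bar>F z\<bar> \<le> ennreal (\<bar>F y\<bar> + \<bar>F z - F y\<bar>)" by (rule ennreal_leI) linarith
    also have "\<dots> = ennreal \<bar>F y\<bar> + ennreal \<bar>F z - F y\<bar>" by simp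
    also have "ennreal \<bar>F z - F y\<bar> \<le> ?R"
      using diff[of y z] diff[of z y] z that by (cases "y \<le> z") (auto simp: abs_minus_commute)
    finally show ?thesis by (simp add: add_left_mono)
  qed
  have "ennreal \<bar>F z\<bar> = (\<integral>\<^sup>+ y. indicator {0..1} y * ennreal \<bar>F z\<bar> \<partial>(lborel :: real measure))"
    by (simp add: nn_integral_multc)
  also have "\<dots> \<le> (\<integral>\<^sup>+ y. indicator {0..1} y * ennreal \<bar>F y\<bar> + indicator {0..1} y * ?R \<partial>lborel)"
    by (rule nn_integral_mono) (use pt in \<open>auto simp: indicator_def\<close>)
  also have "\<dots> = (\<integral>\<^sup>+ y. indicator {0..1} y * ennreal \<bar>F y\<bar> \<partial>lborel) + (\<integral>\<^sup>+ y. indicator {0..1} y * ?R \<partial>(lborel :: real measure))"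
    by (rule nn_integral_add) measurable
  also have "(\<integral>\<^sup>+ y. indicator {0..1} y * ?R \<partial>(lborel :: real measure)) = ?R"
    by (simp add: nn_integral_multc)
  finally show ?thesis .
qed

text \<open>Lines with labels up to \<open>T\<close> reach times up to \<open>T + P\<close>, hence
  the longer strip in the hypothesis.\<close>

lemma strip_shear_finite:
  fixes u :: "real \<Rightarrow> real \<Rightarrow> real"
  assumes u: "set_integrable (lborel \<Otimes>\<^sub>M lborel) ({0..T + P} \<times> {0..1}) (\<lambda>(t, y). u y t)"
    and [measurable]: "\<psi> \<in> borel_measurable borel"
    and \<psi>: "\<And>y. y \<in> {0..1} \<Longrightarrow> 0 \<le> \<psi> y \<and> \<psi> y \<le> P"
  shows "(\<integral>\<^sup>+ c. indicator {0..T} c * (\<integral>\<^sup>+ y. indicator {0..1} y * ennreal \<bar>u y (c + \<psi> y)\<bar> \<partial>lborel) \<partial>lborel) < \<infinity>"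
proof -
  define g where "g t y = indicator ({0..T + P} \<times> {0..1}) (t, y) * u y t" for t y
  have "integrable (lborel \<Otimes>\<^sub>M lborel) (\<lambda>(t, y). g t y)"
    using u by (auto simp: set_integrable_def g_def split_beta' cong: Bochner_Integration.integrable_cong)
  from shear_integral(1)[OF this, of \<psi>]
  have int: "integrable (lborel \<Otimes>\<^sub>M lborel) (\<lambda>(c, y). g (c + \<psi> y) y)" by simp
  note [measurable] = borel_measurable_integrable[OF int]
  have "(\<integral>\<^sup>+ c. indicator {0..T} c * (\<integral>\<^sup>+ y. indicator {0..1} y * ennreal \<bar>u y (c + \<psi> y)\<bar> \<partial>lborel) \<partial>lborel) \<le>
      (\<integral>\<^sup>+ c. (\<integral>\<^sup>+ y. ennreal (norm (case (c, y) of (c, y) \<Rightarrow> g (c + \<psi> y) y)) \<partial>lborel) \<partial>lborel)"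
  proof (rule nn_integral_mono)
    fix c :: real
    show "indicator {0..T} c * (\<integral>\<^sup>+ y. indicator {0..1} y * ennreal \<bar>u y (c + \<psi> y)\<bar> \<partial>lborel) \<le>
        (\<integral>\<^sup>+ y. ennreal (norm (case (c, y) of (c, y) \<Rightarrow> g (c + \<psi> y) y)) \<partial>lborel)"
    proof (cases "c \<in> {0..T}")
      case True
      have "indicator {0..1} y * ennreal \<bar>u y (c + \<psi> y)\<bar> \<le> ennreal (norm (g (c + \<psi> y) y))" for y
        using \<psi>[of y] True by (cases "y \<in> {0..1}") (auto simp: g_def)
      then show ?thesis using True by (simp add: nn_integral_mono)
    qed simp
  qed
  also have "\<dots> = (\<integral>\<^sup>+ p. ennreal (norm (case p of (c, y) \<Rightarrow> g (c + \<psi> y) y)) \<partial>(lborel \<Otimes>\<^sub>M lborel))"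
    by (rule lborel.nn_integral_fst) measurable
  also have "\<dots> < \<infinity>" using int unfolding integrable_iff_bounded by simp
  finally show ?thesis .
qed

lemma integrable_reflect_fst:
  fixes f :: "real \<Rightarrow> real \<Rightarrow> real"
  assumes f: "integrable (lborel \<Otimes>\<^sub>M lborel) (\<lambda>(s, y). f s y)"
  shows "integrable (lborel \<Otimes>\<^sub>M lborel) (\<lambda>(s, y). f (k - s) y)"
proof -
  have [measurable]: "(\<lambda>(s, y). f s y) \<in> borel_measurable (borel \<Otimes>\<^sub>M borel)"
    using borel_measurable_integrable[OF f] by simp
  have "(\<integral>\<^sup>+ s. norm (f (k - s) y) \<partial>lborel) = (\<integral>\<^sup>+ s. norm (f s y) \<partial>lborel)" for y
    using nn_integral_real_affine[of "\<lambda>s. ennreal (norm (f s y))" "-1" k] by simp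
  then have "(\<integral>\<^sup>+ p. norm (case p of (s, y) \<Rightarrow> f (k - s) y) \<partial>(lborel \<Otimes>\<^sub>M lborel)) =
      (\<integral>\<^sup>+ p. norm (case p of (s, y) \<Rightarrow> f s y) \<partial>(lborel \<Otimes>\<^sub>M lborel))"
    by (subst (1 2) lborel_pair.nn_integral_snd[symmetric]) simp_all
  then show ?thesis using f unfolding integrable_iff_bounded by simp
qed

lemma set_integrable_reflect_fst:
  fixes u :: "real \<Rightarrow> real \<Rightarrow> real"
  assumes u: "set_integrable (lborel \<Otimes>\<^sub>M lborel) ({0..t0} \<times> {0..1}) (\<lambda>(t, y). u y t)" and "S \<le> t0"
  shows "set_integrable (lborel \<Otimes>\<^sub>M lborel) ({0..S} \<times> {0..1}) (\<lambda>(s, y). u y (t0 - s))"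
proof -
  define g where "g t y = indicator ({0..t0} \<times> {0..1}) (t, y) * u y t" for t y
  have "integrable (lborel \<Otimes>\<^sub>M lborel) (\<lambda>(t, y). g t y)"
    using u by (auto simp: set_integrable_def g_def split_beta' cong: Bochner_Integration.integrable_cong)
  then have "integrable (lborel \<Otimes>\<^sub>M lborel) (\<lambda>(s, y). g (t0 - s) y)"
    by (rule integrable_reflect_fst)
  then have "set_integrable (lborel \<Otimes>\<^sub>M lborel) ({0..t0} \<times> {0..1}) (\<lambda>(s, y). u y (t0 - s))"
    unfolding set_integrable_def
    by (rule Bochner_Integration.integrable_cong[THEN iffD1, rotated -1])
      (auto simp: g_def indicator_def)
  then show ?thesis
    by (rule set_integrable_subset) (use \<open>S \<le> t0\<close> in \<open>auto intro!: pair_measureI\<close>)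
qed

context hyperbolic_pair
begin

text \<open>Bounds on slices at fixed times do not control the trace at a fixed position. The trace
  is recovered by averaging along the characteristics that start there.\<close>

lemma u1_inflow_integrable: "set_integrable lborel {0..T} (\<lambda>c. u1 0 c)"
proof -
  obtain C where C: "0 \<le> C" "\<And>y. \<bar>c1 y / e1 y\<bar> \<le> C" using coeff_bound by auto
  have "ennreal \<bar>u1 0 c\<bar> \<le> (\<integral>\<^sup>+ y. indicator {0..1} y * ennreal \<bar>u1 y (c + \<phi>1 y)\<bar> \<partial>lborel) +
    ennreal C * (\<integral>\<^sup>+ y. indicator {0..1} y * ennreal \<bar>u2 y (c + \<phi>1 y)\<bar> \<partial>lborel)" if "0 \<le> c" for c
    using primitive_on_trace[OF u1_line[of 0 c] C(2), of 0] that by simp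
  then have "(\<integral>\<^sup>+ c. ennreal (norm (indicator {0..T} c *\<^sub>R u1 0 c)) \<partial>lborel) \<le>
      (\<integral>\<^sup>+ c. indicator {0..T} c * (\<integral>\<^sup>+ y. indicator {0..1} y * ennreal \<bar>u1 y (c + \<phi>1 y)\<bar> \<partial>lborel) +
      ennreal C * (indicator {0..T} c * (\<integral>\<^sup>+ y. indicator {0..1} y * ennreal \<bar>u2 y (c + \<phi>1 y)\<bar> \<partial>lborel)) \<partial>lborel)"
    by (intro nn_integral_mono) (auto simp: indicator_def)
  also have "\<dots> = (\<integral>\<^sup>+ c. indicator {0..T} c * (\<integral>\<^sup>+ y. indicator {0..1} y * ennreal \<bar>u1 y (c + \<phi>1 y)\<bar> \<partial>lborel) \<partial>lborel) +
      ennreal C * (\<integral>\<^sup>+ c. indicator {0..T} c * (\<integral>\<^sup>+ y. indicator {0..1} y * ennreal \<bar>u2 y (c + \<phi>1 y)\<bar> \<partial>lborel) \<partial>lborel)"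
    by (subst nn_integral_add) (measurable, simp add: nn_integral_cmult)
  also have "\<dots> < \<infinity>"
    using strip_shear_finite[OF u1_strip s1.borel_travel, where T = T and P = "\<phi>1 1"]
      strip_shear_finite[OF u2_strip s1.borel_travel, where T = T and P = "\<phi>1 1"]
    by (simp add: ennreal_mult_less_top)
  finally show ?thesis
    unfolding set_integrable_def integrable_iff_bounded by simp
qed

lemma u2_inflow_integrable: "set_integrable lborel {0..T} (\<lambda>c. u2 1 c)"
proof -
  obtain C where C: "0 \<le> C" "\<And>y. \<bar>c2 y / e2 y\<bar> \<le> C" using coeff_bound by auto
  then have C': "\<And>y. \<bar>- c2 y / e2 y\<bar> \<le> C" by simp
  have "ennreal \<bar>u2 1 c\<bar> \<le> (\<integral>\<^sup>+ y. indicator {0..1} y * ennreal \<bar>u2 y (c + (\<phi>2 1 - \<phi>2 y))\<bar> \<partial>lborel) +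
    ennreal C * (\<integral>\<^sup>+ y. indicator {0..1} y * ennreal \<bar>u1 y (c + (\<phi>2 1 - \<phi>2 y))\<bar> \<partial>lborel)" if "0 \<le> c" for c
    using primitive_on_trace[OF u2_line[of 1 "c + \<phi>2 1"] C', of 1] that by (simp add: add_diff_eq)
  then have "(\<integral>\<^sup>+ c. ennreal (norm (indicator {0..T} c *\<^sub>R u2 1 c)) \<partial>lborel) \<le>
      (\<integral>\<^sup>+ c. indicator {0..T} c * (\<integral>\<^sup>+ y. indicator {0..1} y * ennreal \<bar>u2 y (c + (\<phi>2 1 - \<phi>2 y))\<bar> \<partial>lborel) +
      ennreal C * (indicator {0..T} c * (\<integral>\<^sup>+ y. indicator {0..1} y * ennreal \<bar>u1 y (c + (\<phi>2 1 - \<phi>2 y))\<bar> \<partial>lborel)) \<partial>lborel)"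
    by (intro nn_integral_mono) (auto simp: indicator_def)
  also have "\<dots> = (\<integral>\<^sup>+ c. indicator {0..T} c * (\<integral>\<^sup>+ y. indicator {0..1} y * ennreal \<bar>u2 y (c + (\<phi>2 1 - \<phi>2 y))\<bar> \<partial>lborel) \<partial>lborel) +
      ennreal C * (\<integral>\<^sup>+ c. indicator {0..T} c * (\<integral>\<^sup>+ y. indicator {0..1} y * ennreal \<bar>u1 y (c + (\<phi>2 1 - \<phi>2 y))\<bar> \<partial>lborel) \<partial>lborel)"
    by (subst nn_integral_add) (measurable, simp add: nn_integral_cmult)
  also have "\<dots> < \<infinity>"
    using strip_shear_finite[OF u2_strip, where \<psi> = "\<lambda>y. \<phi>2 1 - \<phi>2 y" and T = T and P = "\<phi>2 1"]
      strip_shear_finite[OF u1_strip, where \<psi> = "\<lambda>y. \<phi>2 1 - \<phi>2 y" and T = T and P = "\<phi>2 1"]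
    by (simp add: ennreal_mult_less_top)
  finally show ?thesis
    unfolding set_integrable_def integrable_iff_bounded by simp
qed

end

text \<open>Of the boundary relations for the state only the reflection at \<open>y = 0\<close> is
  included; the inlet condition and the control law enter through the hypothesis of
  \<open>outflow_vanishes\<close>.\<close>

locale feedback_kernels =
  hyperbolic_pair e1 \<phi>1 e2 \<phi>2 c1 c2 u1 u2
  for e1 \<phi>1 e2 \<phi>2 c1 c2 :: "real \<Rightarrow> real" and u1 u2 :: "real \<Rightarrow> real \<Rightarrow> real" +
  fixes q \<tau> :: real and K1 K2 \<alpha>1 \<alpha>2 :: "real \<Rightarrow> real \<Rightarrow> real"
  assumes \<tau>_pos: "0 < \<tau>"
    and K1_borel [measurable]: "case_prod K1 \<in> borel_measurable (borel \<Otimes>\<^sub>M borel)"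
    and K2_borel [measurable]: "case_prod K2 \<in> borel_measurable (borel \<Otimes>\<^sub>M borel)"
    and \<alpha>1_borel [measurable]: "case_prod \<alpha>1 \<in> borel_measurable (borel \<Otimes>\<^sub>M borel)"
    and \<alpha>2_borel [measurable]: "case_prod \<alpha>2 \<in> borel_measurable (borel \<Otimes>\<^sub>M borel)"
    and kernel_bound: "\<exists>B. \<forall>x y. \<bar>K1 x y\<bar> \<le> B \<and> \<bar>K2 x y\<bar> \<le> B \<and> \<bar>\<alpha>1 x y\<bar> \<le> B \<and> \<bar>\<alpha>2 x y\<bar> \<le> B"
    and K1_transport: "transport_along_characteristics e2 (\<lambda>y. - e1 y) kernel_triangle
      (\<lambda>x y. e1 y * K1 x y) (\<lambda>x y. e1 y * (c2 y * K2 x y))"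
    and K2_transport: "transport_along_characteristics e2 e2 kernel_triangle
      (\<lambda>x y. e2 y * K2 x y) (\<lambda>x y. e2 y * (c1 y * K1 x y))"
    and \<alpha>1_transport: "transport_along_characteristics (\<lambda>x. 1 / \<tau>) (\<lambda>y. - e1 y) kernel_square
      (\<lambda>x y. e1 y * \<alpha>1 x y) (\<lambda>x y. e1 y * (c2 y * \<alpha>2 x y))"
    and \<alpha>2_transport: "transport_along_characteristics (\<lambda>x. 1 / \<tau>) e2 kernel_square
      (\<lambda>x y. e2 y * \<alpha>2 x y) (\<lambda>x y. e2 y * (c1 y * \<alpha>1 x y))"
    and K1_diag: "\<And>x. x \<in> {0..1} \<Longrightarrow> K1 x x = - c2 x / (e1 x + e2 x)"
    and K2_base: "\<And>x. x \<in> {0..1} \<Longrightarrow> e2 0 * K2 x 0 = q * e1 0 * K1 x 0"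
    and \<alpha>1_top: "\<And>x. x \<in> {0<..1} \<Longrightarrow> \<alpha>1 x 1 = 0"
    and \<alpha>2_base: "\<And>x. x \<in> {0..1} \<Longrightarrow> e2 0 * \<alpha>2 x 0 = q * e1 0 * \<alpha>1 x 0"
    and \<alpha>1_start: "\<And>y. y \<in> {0..<1} \<Longrightarrow> \<alpha>1 0 y = K1 1 y"
    and \<alpha>2_start: "\<And>y. y \<in> {0..1} \<Longrightarrow> \<alpha>2 0 y = K2 1 y"
    and reflection: "AE t in lborel. 0 < t \<longrightarrow> u1 0 t = q * u2 0 t"
begin

text \<open>The time after which a control value is felt at \<open>y = 0\<close>: the delay plus the
  passage of \<open>u2\<close> through the plant. It is also the length of the merged kernels in the
  variable \<open>s\<close>.\<close>

definition horizon :: real where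
  "horizon = \<phi>2 1 + \<tau>"

text \<open>
  The kernels of the delay block continue \<open>K1\<close>, \<open>K2\<close> beyond \<open>x = 1\<close>: measuring \<open>x\<close> by the
  travel time \<open>s\<close> towards the controlled end makes both families of kernels one function.
\<close>

definition k1 :: "real \<Rightarrow> real \<Rightarrow> real" where
  "k1 s y = (if s \<le> \<phi>2 1 then K1 (s2.position s) y else \<alpha>1 ((s - \<phi>2 1) / \<tau>) y)"

definition k2 :: "real \<Rightarrow> real \<Rightarrow> real" where
  "k2 s y = (if s \<le> \<phi>2 1 then K2 (s2.position s) y else \<alpha>2 ((s - \<phi>2 1) / \<tau>) y)"

lemma k_borel [measurable]:
  "case_prod k1 \<in> borel_measurable (borel \<Otimes>\<^sub>M borel)" "case_prod k2 \<in> borel_measurable (borel \<Otimes>\<^sub>M borel)"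
  unfolding k1_def[abs_def] k2_def[abs_def] by measurable

lemma k_bound: "\<exists>B\<ge>0. \<forall>s y. \<bar>k1 s y\<bar> \<le> B \<and> \<bar>k2 s y\<bar> \<le> B"
proof -
  obtain B where B: "\<forall>x y. \<bar>K1 x y\<bar> \<le> B \<and> \<bar>K2 x y\<bar> \<le> B \<and> \<bar>\<alpha>1 x y\<bar> \<le> B \<and> \<bar>\<alpha>2 x y\<bar> \<le> B"
    using kernel_bound by auto
  then have "0 \<le> B" using abs_ge_zero order_trans by blast
  then show ?thesis using B by (intro exI[of _ B]) (auto simp: k1_def k2_def)
qed

text \<open>At the junction \<open>s = \<phi>2 1\<close> both branches agree by the starting values
  of \<alpha>1, except possibly at \<open>y = 1\<close>, where \<alpha>1 is left free.\<close>

lemma k1_after: "\<phi>2 1 \<le> s \<Longrightarrow> 0 \<le> y \<Longrightarrow> y < 1 \<or> \<phi>2 1 < s \<Longrightarrow> k1 s y = \<alpha>1 ((s - \<phi>2 1) / \<tau>) y"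
  using \<alpha>1_start[of y] by (cases "s = \<phi>2 1") (auto simp: k1_def)

lemma k2_after: "\<phi>2 1 \<le> s \<Longrightarrow> 0 \<le> y \<Longrightarrow> y \<le> 1 \<Longrightarrow> k2 s y = \<alpha>2 ((s - \<phi>2 1) / \<tau>) y"
  using \<alpha>2_start[of y] by (cases "s = \<phi>2 1") (auto simp: k2_def)

lemma k_base: "0 \<le> s \<Longrightarrow> s \<le> horizon \<Longrightarrow> e2 0 * k2 s 0 = q * e1 0 * k1 s 0"
proof -
  assume s: "0 \<le> s" "s \<le> horizon"
  show ?thesis
  proof (cases "s \<le> \<phi>2 1")
    case True
    then have "s2.position s \<in> {0..1}" using s by (simp add: s2.position_le_iff s2.le_position_iff)
    then show ?thesis using True K2_base by (simp add: k1_def k2_def)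
  next
    case False
    then have "(s - \<phi>2 1) / \<tau> \<in> {0..1}" using s \<tau>_pos by (simp add: horizon_def)
    then show ?thesis using False \<alpha>2_base by (simp add: k1_def k2_def)
  qed
qed

text \<open>The excluded label belongs to the line through the corner \<open>s = \<phi>2 1\<close>,
  \<open>y = 1\<close>, at which \<open>K1\<close> and \<alpha>1 may disagree. The condition at
  \<open>b\<close> keeps the segment on the triangle side of the diagonal.\<close>

lemma k1_line:
  assumes "0 \<le> a" "a \<le> b" "b \<le> 1" "\<phi>2 b \<le> c - \<phi>1 b" "c - \<phi>1 a \<le> horizon" "c \<noteq> \<phi>1 1 + \<phi>2 1"
  shows "primitive_on a b (\<lambda>y. e1 y * k1 (c - \<phi>1 y) y) (\<lambda>y. - c2 y * k2 (c - \<phi>1 y) y)"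
proof -
  have before: "primitive_on a b (\<lambda>y. e1 y * k1 (c - \<phi>1 y) y) (\<lambda>y. - c2 y * k2 (c - \<phi>1 y) y)"
    if a: "0 \<le> a" and ab: "a \<le> b" and b: "b \<le> 1" "\<phi>2 b \<le> c - \<phi>1 b" and c: "c - \<phi>1 a \<le> \<phi>2 1" for a b
  proof -
    have "primitive_on (c - \<phi>1 b) (c - \<phi>1 a)
        (\<lambda>\<sigma>. e1 (s1.position (c - \<sigma>)) * K1 (s2.position \<sigma>) (s1.position (c - \<sigma>)))
        (\<lambda>\<sigma>. e1 (s1.position (c - \<sigma>)) * (c2 (s1.position (c - \<sigma>)) * K2 (s2.position \<sigma>) (s1.position (c - \<sigma>))))"
    proof (rule transport_primitive_on[OF K1_transport])
      fix \<sigma> assume \<sigma>: "c - \<phi>1 b \<le> \<sigma>" "\<sigma> \<le> c - \<phi>1 a"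
      have "s1.position (c - \<sigma>) \<le> b" using \<sigma> by (simp add: s1.position_le_iff)
      moreover have "b \<le> s2.position \<sigma>" using \<sigma> b by (simp add: s2.le_position_iff)
      moreover have "a \<le> s1.position (c - \<sigma>)" using \<sigma> by (simp add: s1.le_position_iff)
      moreover have "s2.position \<sigma> \<le> 1" using \<sigma> c by (simp add: s2.position_le_iff)
      ultimately show "(s2.position \<sigma>, s1.position (c - \<sigma>)) \<in> kernel_triangle"
        using a by (simp add: kernel_triangle_def)
      have "((\<lambda>\<sigma>. s1.position (c - \<sigma>)) has_real_derivative e1 (s1.position (c - \<sigma>)) * - 1) (at \<sigma>)"
        by (rule DERIV_chain2[OF s1.position_deriv]) (auto intro!: derivative_eq_intros)
      then show "((\<lambda>\<sigma>. s1.position (c - \<sigma>)) has_real_derivative - e1 (s1.position (c - \<sigma>))) (at \<sigma>)" by simp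
    qed (use ab in \<open>auto intro: s2.position_deriv\<close>)
    from s1.primitive_on_falling[OF this ab] show ?thesis
    proof (rule primitive_on_cong)
      fix y assume y: "a \<le> y" "y \<le> b"
      have "\<phi>1 a \<le> \<phi>1 y" using y by simp
      then have "c - \<phi>1 y \<le> \<phi>2 1" using c by linarith
      then show "e1 y * k1 (c - \<phi>1 y) y = e1 (s1.position (c - (c - \<phi>1 y))) *
          K1 (s2.position (c - \<phi>1 y)) (s1.position (c - (c - \<phi>1 y)))"
        "- c2 y * k2 (c - \<phi>1 y) y = - (e1 (s1.position (c - (c - \<phi>1 y))) * (c2 (s1.position (c - (c - \<phi>1 y))) *
          K2 (s2.position (c - \<phi>1 y)) (s1.position (c - (c - \<phi>1 y))))) / e1 y"
        using s1.e_pos[of y] by (simp_all add: k1_def k2_def)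
    qed
  qed
  have after: "primitive_on a b (\<lambda>y. e1 y * k1 (c - \<phi>1 y) y) (\<lambda>y. - c2 y * k2 (c - \<phi>1 y) y)"
    if a: "0 \<le> a" and ab: "a \<le> b" and b: "b \<le> 1" and c: "\<phi>2 1 \<le> c - \<phi>1 b" "c - \<phi>1 a \<le> horizon" for a b
  proof -
    have "primitive_on (c - \<phi>1 b) (c - \<phi>1 a)
        (\<lambda>\<sigma>. e1 (s1.position (c - \<sigma>)) * \<alpha>1 ((\<sigma> - \<phi>2 1) / \<tau>) (s1.position (c - \<sigma>)))
        (\<lambda>\<sigma>. e1 (s1.position (c - \<sigma>)) * (c2 (s1.position (c - \<sigma>)) * \<alpha>2 ((\<sigma> - \<phi>2 1) / \<tau>) (s1.position (c - \<sigma>))))"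
    proof (rule transport_primitive_on[OF \<alpha>1_transport])
      fix \<sigma> assume \<sigma>: "c - \<phi>1 b \<le> \<sigma>" "\<sigma> \<le> c - \<phi>1 a"
      have "s1.position (c - \<sigma>) \<le> b" using \<sigma> by (simp add: s1.position_le_iff)
      moreover have "a \<le> s1.position (c - \<sigma>)" using \<sigma> by (simp add: s1.le_position_iff)
      ultimately show "((\<sigma> - \<phi>2 1) / \<tau>, s1.position (c - \<sigma>)) \<in> kernel_square"
        using a b c \<sigma> \<tau>_pos by (auto simp: kernel_square_def horizon_def)
      have "((\<lambda>\<sigma>. s1.position (c - \<sigma>)) has_real_derivative e1 (s1.position (c - \<sigma>)) * - 1) (at \<sigma>)"
        by (rule DERIV_chain2[OF s1.position_deriv]) (auto intro!: derivative_eq_intros)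
      then show "((\<lambda>\<sigma>. s1.position (c - \<sigma>)) has_real_derivative - e1 (s1.position (c - \<sigma>))) (at \<sigma>)" by simp
    qed (use ab \<tau>_pos in \<open>auto intro!: derivative_eq_intros\<close>)
    from s1.primitive_on_falling[OF this ab] show ?thesis
    proof (rule primitive_on_cong)
      fix y assume y: "a \<le> y" "y \<le> b"
      have "\<phi>1 y \<le> \<phi>1 b" using y by simp
      then have s: "\<phi>2 1 \<le> c - \<phi>1 y" using c by linarith
      moreover have "y < 1 \<or> \<phi>2 1 < c - \<phi>1 y"
        using assms(6) s y b by (cases "y = 1") auto
      ultimately show "e1 y * k1 (c - \<phi>1 y) y = e1 (s1.position (c - (c - \<phi>1 y))) *
          \<alpha>1 ((c - \<phi>1 y - \<phi>2 1) / \<tau>) (s1.position (c - (c - \<phi>1 y)))"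
        "- c2 y * k2 (c - \<phi>1 y) y = - (e1 (s1.position (c - (c - \<phi>1 y))) * (c2 (s1.position (c - (c - \<phi>1 y))) *
          \<alpha>2 ((c - \<phi>1 y - \<phi>2 1) / \<tau>) (s1.position (c - (c - \<phi>1 y))))) / e1 y"
        using s1.e_pos[of y] a b y by (simp_all add: k1_after k2_after)
    qed
  qed
  consider "c - \<phi>1 a \<le> \<phi>2 1" | "\<phi>2 1 \<le> c - \<phi>1 b" | "c - \<phi>1 b \<le> \<phi>2 1" "\<phi>2 1 \<le> c - \<phi>1 a" by linarith
  then show ?thesis
  proof cases
    case 3
    \<comment> \<open>The crossing with the junction \<open>s = \<phi>2 1\<close>. Along this family
      \<open>s\<close> decreases in \<open>y\<close>, so the delay branch occupies the lower part of
      the segment.\<close>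
    define y where "y = s1.position (c - \<phi>2 1)"
    have y: "\<phi>1 y = c - \<phi>2 1" "a \<le> y" "y \<le> b"
      using 3 by (auto simp: y_def s1.position_le_iff s1.le_position_iff)
    show ?thesis
      using after[of a y] before[of y b] assms y by (intro primitive_on_combine[of a y _ _ b]) auto
  qed (use before[of a b] after[of a b] assms in auto)
qed

text \<open>The line \<open>c = 0\<close> is the diagonal and ends in the same corner, where the
  density would involve the free value of \<alpha>1; \<open>0 < c\<close> leaves it out.\<close>

lemma k2_line:
  assumes "0 \<le> a" "a \<le> b" "b \<le> 1" "0 < c" "c + \<phi>2 b \<le> horizon"
  shows "primitive_on a b (\<lambda>y. e2 y * k2 (c + \<phi>2 y) y) (\<lambda>y. c1 y * k1 (c + \<phi>2 y) y)"
proof -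
  have before: "primitive_on a b (\<lambda>y. e2 y * k2 (c + \<phi>2 y) y) (\<lambda>y. c1 y * k1 (c + \<phi>2 y) y)"
    if a: "0 \<le> a" and ab: "a \<le> b" and c: "c + \<phi>2 b \<le> \<phi>2 1" for a b
  proof -
    have "primitive_on (c + \<phi>2 a) (c + \<phi>2 b)
        (\<lambda>\<sigma>. e2 (s2.position (\<sigma> - c)) * K2 (s2.position \<sigma>) (s2.position (\<sigma> - c)))
        (\<lambda>\<sigma>. e2 (s2.position (\<sigma> - c)) * (c1 (s2.position (\<sigma> - c)) * K1 (s2.position \<sigma>) (s2.position (\<sigma> - c))))"
    proof (rule transport_primitive_on[OF K2_transport])
      fix \<sigma> assume \<sigma>: "c + \<phi>2 a \<le> \<sigma>" "\<sigma> \<le> c + \<phi>2 b"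
      have "a \<le> s2.position (\<sigma> - c)" using \<sigma> by (simp add: s2.le_position_iff)
      moreover have "s2.position (\<sigma> - c) \<le> s2.position \<sigma>"
        using \<open>0 < c\<close> by (simp add: s2.position_le_iff)
      moreover have "s2.position \<sigma> \<le> 1" using \<sigma> c by (simp add: s2.position_le_iff)
      ultimately show "(s2.position \<sigma>, s2.position (\<sigma> - c)) \<in> kernel_triangle"
        using a by (simp add: kernel_triangle_def)
      have "((\<lambda>\<sigma>. s2.position (\<sigma> - c)) has_real_derivative e2 (s2.position (\<sigma> - c)) * 1) (at \<sigma>)"
        by (rule DERIV_chain2[OF s2.position_deriv]) (auto intro!: derivative_eq_intros)
      then show "((\<lambda>\<sigma>. s2.position (\<sigma> - c)) has_real_derivative e2 (s2.position (\<sigma> - c))) (at \<sigma>)" by simp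
    qed (use ab in \<open>auto intro: s2.position_deriv\<close>)
    from s2.primitive_on_rising[OF this ab] show ?thesis
    proof (rule primitive_on_cong)
      fix y assume y: "a \<le> y" "y \<le> b"
      have "\<phi>2 y \<le> \<phi>2 b" using y by simp
      then have "c + \<phi>2 y \<le> \<phi>2 1" using c by linarith
      then show "e2 y * k2 (c + \<phi>2 y) y = e2 (s2.position (c + \<phi>2 y - c)) *
          K2 (s2.position (c + \<phi>2 y)) (s2.position (c + \<phi>2 y - c))"
        "c1 y * k1 (c + \<phi>2 y) y = e2 (s2.position (c + \<phi>2 y - c)) * (c1 (s2.position (c + \<phi>2 y - c)) *
          K1 (s2.position (c + \<phi>2 y)) (s2.position (c + \<phi>2 y - c))) / e2 y"
        using s2.e_pos[of y] by (simp_all add: k1_def k2_def)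
    qed
  qed
  have after: "primitive_on a b (\<lambda>y. e2 y * k2 (c + \<phi>2 y) y) (\<lambda>y. c1 y * k1 (c + \<phi>2 y) y)"
    if a: "0 \<le> a" and ab: "a \<le> b" and b: "b \<le> 1" and c: "\<phi>2 1 \<le> c + \<phi>2 a" "c + \<phi>2 b \<le> horizon" for a b
  proof -
    have "primitive_on (c + \<phi>2 a) (c + \<phi>2 b)
        (\<lambda>\<sigma>. e2 (s2.position (\<sigma> - c)) * \<alpha>2 ((\<sigma> - \<phi>2 1) / \<tau>) (s2.position (\<sigma> - c)))
        (\<lambda>\<sigma>. e2 (s2.position (\<sigma> - c)) * (c1 (s2.position (\<sigma> - c)) * \<alpha>1 ((\<sigma> - \<phi>2 1) / \<tau>) (s2.position (\<sigma> - c))))"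
    proof (rule transport_primitive_on[OF \<alpha>2_transport])
      fix \<sigma> assume \<sigma>: "c + \<phi>2 a \<le> \<sigma>" "\<sigma> \<le> c + \<phi>2 b"
      have "a \<le> s2.position (\<sigma> - c)" using \<sigma> by (simp add: s2.le_position_iff)
      moreover have "s2.position (\<sigma> - c) \<le> b" using \<sigma> by (simp add: s2.position_le_iff)
      ultimately show "((\<sigma> - \<phi>2 1) / \<tau>, s2.position (\<sigma> - c)) \<in> kernel_square"
        using a b c \<sigma> \<tau>_pos by (auto simp: kernel_square_def horizon_def)
      have "((\<lambda>\<sigma>. s2.position (\<sigma> - c)) has_real_derivative e2 (s2.position (\<sigma> - c)) * 1) (at \<sigma>)"
        by (rule DERIV_chain2[OF s2.position_deriv]) (auto intro!: derivative_eq_intros)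
      then show "((\<lambda>\<sigma>. s2.position (\<sigma> - c)) has_real_derivative e2 (s2.position (\<sigma> - c))) (at \<sigma>)" by simp
    qed (use ab \<tau>_pos in \<open>auto intro!: derivative_eq_intros\<close>)
    from s2.primitive_on_rising[OF this ab] show ?thesis
    proof (rule primitive_on_cong)
      fix y assume y: "a \<le> y" "y \<le> b"
      have "\<phi>2 a \<le> \<phi>2 y" using y by simp
      then have s: "\<phi>2 1 \<le> c + \<phi>2 y" using c by linarith
      moreover have "y < 1 \<or> \<phi>2 1 < c + \<phi>2 y"
        using \<open>0 < c\<close> y b by (cases "y = 1") auto
      ultimately show "e2 y * k2 (c + \<phi>2 y) y = e2 (s2.position (c + \<phi>2 y - c)) *
          \<alpha>2 ((c + \<phi>2 y - \<phi>2 1) / \<tau>) (s2.position (c + \<phi>2 y - c))"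
        "c1 y * k1 (c + \<phi>2 y) y = e2 (s2.position (c + \<phi>2 y - c)) * (c1 (s2.position (c + \<phi>2 y - c)) *
          \<alpha>1 ((c + \<phi>2 y - \<phi>2 1) / \<tau>) (s2.position (c + \<phi>2 y - c))) / e2 y"
        using s2.e_pos[of y] a b y by (simp_all add: k1_after k2_after)
    qed
  qed
  consider "c + \<phi>2 b \<le> \<phi>2 1" | "\<phi>2 1 \<le> c + \<phi>2 a" | "c + \<phi>2 a \<le> \<phi>2 1" "\<phi>2 1 \<le> c + \<phi>2 b" by linarith
  then show ?thesis
  proof cases
    case 3
    \<comment> \<open>Again the crossing with \<open>s = \<phi>2 1\<close>, but \<open>s\<close> now
      increases with \<open>y\<close>, so the triangle branch comes first.\<close>
    define y where "y = s2.position (\<phi>2 1 - c)"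
    have y: "\<phi>2 y = \<phi>2 1 - c" "a \<le> y" "y \<le> b"
      using 3 by (auto simp: y_def s2.position_le_iff s2.le_position_iff)
    show ?thesis
      using before[of a y] after[of y b] assms y by (intro primitive_on_combine[of a y _ _ b]) auto
  qed (use before[of a b] after[of a b] assms in auto)
qed

end

section \<open>Flux balances\<close>

lemma set_integrable_bounded_mult:
  fixes f g :: "real \<Rightarrow> real"
  assumes f: "set_integrable lborel A f" and [measurable]: "g \<in> borel_measurable borel"
    and g: "\<And>x. \<bar>g x\<bar> \<le> B"
  shows "set_integrable lborel A (\<lambda>x. g x * f x)"
  unfolding set_integrable_def
proof (rule Bochner_Integration.integrable_bound)
  have f': "integrable lborel (\<lambda>x. indicator A x *\<^sub>R f x)" using f by (simp add: set_integrable_def)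
  then show "integrable lborel (\<lambda>x. B * (indicator A x *\<^sub>R f x))" by simp
  have [measurable]: "(\<lambda>x. indicator A x *\<^sub>R f x) \<in> borel_measurable borel"
    using borel_measurable_integrable[OF f'] by simp
  have "(\<lambda>x. g x * (indicator A x *\<^sub>R f x)) \<in> borel_measurable lborel" by measurable
  then show "(\<lambda>x. indicator A x *\<^sub>R (g x * f x)) \<in> borel_measurable lborel" by (simp add: mult_ac)
  have "\<bar>g x\<bar> * \<bar>f x\<bar> \<le> \<bar>B\<bar> * \<bar>f x\<bar>" for x
    using g[of x] by (intro mult_right_mono) auto
  then show "AE x in lborel. norm (indicator A x *\<^sub>R (g x * f x)) \<le> norm (B * (indicator A x *\<^sub>R f x))"
    by (auto simp: abs_mult indicator_def)
qed

lemma set_integrable_flip: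
  fixes f :: "real \<Rightarrow> real"
  assumes "set_integrable lborel {a..b} f"
  shows "set_integrable lborel {k - b..k - a} (\<lambda>c. f (k - c))"
proof -
  have "integrable lborel (\<lambda>c. indicator {a..b} (k + - 1 * c) *\<^sub>R f (k + - 1 * c))"
    using assms unfolding set_integrable_def by (rule lborel_integrable_real_affine) simp
  moreover have "indicator {a..b} (k + - 1 * c) = indicat_real {k - b..k - a} c" for c
    by (auto simp: indicator_def)
  ultimately show ?thesis by (simp add: set_integrable_def)
qed

context feedback_kernels
begin

lemma k1_horizon: "k1 horizon y = \<alpha>1 1 y" and k2_horizon: "k2 horizon y = \<alpha>2 1 y"
  using \<tau>_pos by (simp_all add: k1_def k2_def horizon_def)

lemma horizon_bounds: "\<phi>2 1 < horizon" "0 < \<phi>1 1" "0 < \<phi>2 1"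
  using \<tau>_pos s1.travel_less[of 0 1] s2.travel_less[of 0 1] by (auto simp: horizon_def)

text \<open>
  The density of \<open>e2 k2 u2\<close> along the lines \<open>s - \<phi>2 y = const\<close> and, with \<open>y\<close> as parameter, of
  \<open>e1 k1 u1\<close> along the lines \<open>s + \<phi>1 y = const\<close> at time \<open>t0 - s\<close>. As it is the same function, its
  double integral drops out when the two flux balances are compared.
\<close>

definition exchange :: "real \<Rightarrow> real \<Rightarrow> real \<Rightarrow> real" where
  "exchange t0 s y = c1 y * k1 s y * u2 y (t0 - s) - c2 y * k2 s y * u1 y (t0 - s)"

text \<open>The triangle and the square glued along \<open>x = 1\<close>, in the coordinates
  \<open>s\<close> and \<open>y\<close>: on the triangle \<open>\<phi>2 y \<le> s\<close> means
  \<open>y \<le> x\<close>, on the square it holds automatically.\<close>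

definition region :: "(real \<times> real) set" where
  "region = {p. 0 \<le> snd p \<and> snd p \<le> 1 \<and> \<phi>2 (snd p) \<le> fst p \<and> fst p \<le> horizon}"

lemma region_borel [measurable]: "region \<in> sets (borel \<Otimes>\<^sub>M borel)"
proof -
  have "region = {p \<in> space (borel \<Otimes>\<^sub>M borel). 0 \<le> snd p \<and> snd p \<le> 1 \<and> \<phi>2 (snd p) \<le> fst p \<and> fst p \<le> horizon}"
    by (simp add: region_def space_pair_measure)
  also have "\<dots> \<in> sets (borel \<Otimes>\<^sub>M borel)" by measurable
  finally show ?thesis .
qed

lemma exchange_integrable:
  assumes t0: "horizon \<le> t0"
  shows "integrable (lborel \<Otimes>\<^sub>M lborel) (\<lambda>(s, y). indicator region (s, y) * exchange t0 s y)"
proof -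
  obtain C where C: "\<And>y. \<bar>c1 y\<bar> \<le> C" "\<And>y. \<bar>c2 y\<bar> \<le> C" using c_bound by auto
  obtain B where B: "0 \<le> B" "\<And>s y. \<bar>k1 s y\<bar> \<le> B" "\<And>s y. \<bar>k2 s y\<bar> \<le> B" using k_bound by auto
  have C0: "0 \<le> C" using C(1)[of 0] by linarith
  let ?D = "{0..horizon} \<times> {0..1::real}"
  have u1: "integrable (lborel \<Otimes>\<^sub>M lborel) (\<lambda>p. indicator ?D p *\<^sub>R (case p of (s, y) \<Rightarrow> u1 y (t0 - s)))"
    using set_integrable_reflect_fst[OF u1_strip t0] by (simp add: set_integrable_def)
  have u2: "integrable (lborel \<Otimes>\<^sub>M lborel) (\<lambda>p. indicator ?D p *\<^sub>R (case p of (s, y) \<Rightarrow> u2 y (t0 - s)))"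
    using set_integrable_reflect_fst[OF u2_strip t0] by (simp add: set_integrable_def)
  show ?thesis
  proof (rule Bochner_Integration.integrable_bound)
    show "integrable (lborel \<Otimes>\<^sub>M lborel) (\<lambda>p. C * B * \<bar>indicator ?D p *\<^sub>R (case p of (s, y) \<Rightarrow> u2 y (t0 - s))\<bar> +
        C * B * \<bar>indicator ?D p *\<^sub>R (case p of (s, y) \<Rightarrow> u1 y (t0 - s))\<bar>)"
      by (intro Bochner_Integration.integrable_add integrable_mult_right integrable_abs u1 u2)
    show "(\<lambda>(s, y). indicator region (s, y) * exchange t0 s y) \<in> borel_measurable (lborel \<Otimes>\<^sub>M lborel)"
      unfolding exchange_def by measurable
    have bd: "\<bar>exchange t0 s y\<bar> \<le> C * B * \<bar>u2 y (t0 - s)\<bar> + C * B * \<bar>u1 y (t0 - s)\<bar>" for s y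
    proof -
      have "\<bar>c1 y * k1 s y * u2 y (t0 - s)\<bar> \<le> C * B * \<bar>u2 y (t0 - s)\<bar>"
        "\<bar>c2 y * k2 s y * u1 y (t0 - s)\<bar> \<le> C * B * \<bar>u1 y (t0 - s)\<bar>"
        unfolding abs_mult by (intro mult_mono B C C0 mult_nonneg_nonneg abs_ge_zero order_refl)+
      then show ?thesis unfolding exchange_def by linarith
    qed
    have "p \<in> ?D" if "p \<in> region" for p
    proof -
      have "0 \<le> \<phi>2 (snd p)" using that by (simp add: region_def)
      then have "0 \<le> fst p" using that unfolding region_def mem_Collect_eq by linarith
      then show ?thesis using that by (cases p) (auto simp: region_def)
    qed
    then show "AE p in lborel \<Otimes>\<^sub>M lborel. norm (case p of (s, y) \<Rightarrow> indicator region (s, y) * exchange t0 s y) \<le>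
        norm (C * B * \<bar>indicator ?D p *\<^sub>R (case p of (s, y) \<Rightarrow> u2 y (t0 - s))\<bar> +
        C * B * \<bar>indicator ?D p *\<^sub>R (case p of (s, y) \<Rightarrow> u1 y (t0 - s))\<bar>)"
      using bd C0 B(1) by (intro AE_I2) (fastforce simp: indicator_def split: prod.splits)
  qed
qed

lemma outflow1_integrable:
  assumes t0: "horizon \<le> t0"
  shows "set_integrable lborel {0..horizon} (\<lambda>c. e1 0 * k1 c 0 * u1 0 (t0 - c))"
proof -
  obtain B where B: "0 \<le> B" "\<And>s y. \<bar>k1 s y\<bar> \<le> B" using k_bound by auto
  have "set_integrable lborel {t0 - t0..t0 - 0} (\<lambda>c. u1 0 (t0 - c))"
    by (rule set_integrable_flip[OF u1_inflow_integrable])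
  then have "set_integrable lborel {0..horizon} (\<lambda>c. u1 0 (t0 - c))"
    by (rule set_integrable_subset) (use t0 in auto)
  then show ?thesis
    by (rule set_integrable_bounded_mult[where B = "e1 0 * B"])
      (use B(2)[of _ 0] s1.e_pos[of 0] in \<open>auto simp: abs_mult\<close>)
qed

lemma slice_integrable:
  assumes "horizon \<le> t0"
  shows "set_integrable lborel {0..1} (\<lambda>y. k1 horizon y * u1 y (t0 - horizon))"
    and "set_integrable lborel {0..1} (\<lambda>y. k2 horizon y * u2 y (t0 - horizon))"
proof -
  obtain B where B: "\<And>s y. \<bar>k1 s y\<bar> \<le> B" "\<And>s y. \<bar>k2 s y\<bar> \<le> B" using k_bound by auto
  have "0 \<le> t0 - horizon" using assms by simp
  then show "set_integrable lborel {0..1} (\<lambda>y. k1 horizon y * u1 y (t0 - horizon))"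
    "set_integrable lborel {0..1} (\<lambda>y. k2 horizon y * u2 y (t0 - horizon))"
    using B by (auto intro!: set_integrable_bounded_mult[where B = B] u1_slice u2_slice)
qed

text \<open>On a line \<open>s + \<phi>1 y = c\<close> the product \<open>e1 * k1 * u1\<close> has
  density \<open>exchange\<close>, so the line integral is a difference of end values. Upper ends
  lie on the diagonal or on \<open>y = 1\<close>, where \<alpha>1 vanishes; lower ends lie on
  \<open>y = 0\<close> or on \<open>s = horizon\<close>. These pieces are the three boundary
  integrals.\<close>

lemma flux1:
  assumes t0: "horizon \<le> t0"
  shows "(LBINT y:{0..1}. - c2 y / e2 y * u1 y (t0 - \<phi>2 y)) =
    (LBINT c:{0..horizon}. e1 0 * k1 c 0 * u1 0 (t0 - c)) +
    (LBINT y:{0..1}. k1 horizon y * u1 y (t0 - horizon)) +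
    (LBINT s. LBINT y. indicator region (s, y) * exchange t0 s y)"
proof -
  \<comment> \<open>Its \<open>position\<close> finds the diagonal point that lies on the line with
    a given label.\<close>
  interpret s3: travel_time "\<lambda>y. 1 / (1 / e1 y + 1 / e2 y)" "\<lambda>y. \<phi>1 y + \<phi>2 y"
    by (rule travel_time_add[OF s1.travel_time_axioms s2.travel_time_axioms])
  note hb = horizon_bounds
  define \<Gamma> where "\<Gamma> c y = e1 y * k1 (c - \<phi>1 y) y * u1 y (t0 - (c - \<phi>1 y))" for c y
  \<comment> \<open>\<open>max\<close> and \<open>min\<close> select the boundary piece that is hit:
    the lower end leaves \<open>y = 0\<close> once \<open>c\<close> exceeds \<open>horizon\<close>,
    the upper end leaves the diagonal once \<open>c\<close> exceeds
    \<open>\<phi>1 1 + \<phi>2 1\<close>.\<close>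
  define lo where "lo c = s1.position (max 0 (c - horizon))" for c
  define hi where "hi c = s3.position (min c (\<phi>1 1 + \<phi>2 1))" for c
  let ?J = "{0..horizon + \<phi>1 1}"
  have ind: "(c - \<phi>1 y, y) \<in> region \<longleftrightarrow> y \<in> {lo c..hi c}" for c y
    using s3.travel_le_iff[of y 1]
    by (auto simp: region_def lo_def hi_def s1.position_le_iff s3.le_position_iff algebra_simps)
  have \<phi>lo: "\<phi>1 (lo c) = max 0 (c - horizon)" for c by (simp add: lo_def)
  have \<phi>hi: "\<phi>1 (hi c) + \<phi>2 (hi c) = min c (\<phi>1 1 + \<phi>2 1)" for c
    using s3.travel_position by (simp add: hi_def)
  have line: "(LBINT y. indicator region (c + - \<phi>1 y, y) * exchange t0 (c + - \<phi>1 y) y) =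
      indicator ?J c * (\<Gamma> c (hi c) - \<Gamma> c (lo c))" if c: "c \<noteq> \<phi>1 1 + \<phi>2 1" for c
  proof -
    have "(LBINT y. indicator region (c + - \<phi>1 y, y) * exchange t0 (c + - \<phi>1 y) y) =
        (LBINT y:{lo c..hi c}. exchange t0 (c - \<phi>1 y) y)"
      unfolding set_lebesgue_integral_def
      by (rule Bochner_Integration.integral_cong) (auto simp: indicator_def ind)
    also have "\<dots> = indicator ?J c * (\<Gamma> c (hi c) - \<Gamma> c (lo c))"
    proof (cases "c \<in> ?J")
      case True
      have lo: "0 \<le> lo c" "lo c \<le> 1"
        using True hb by (auto simp: lo_def s1.position_le_iff s1.le_position_iff)
      then have "\<phi>2 (lo c) \<le> \<phi>2 1" by simp
      \<comment> \<open>The lower end does lie below the upper one; for labels beyond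
        \<open>horizon\<close> this rests on \<open>\<phi>2 1 < horizon\<close>.\<close>
      then have "\<phi>1 (lo c) + \<phi>2 (lo c) \<le> min c (\<phi>1 1 + \<phi>2 1)"
        using True hb \<phi>lo[of c] unfolding atLeastAtMost_iff
        by (cases "c \<le> horizon") (simp_all add: lo_def max_def del: s2.travel_le_iff)
      then have lohi: "lo c \<le> hi c" by (simp add: hi_def s3.le_position_iff)
      have hi: "hi c \<le> 1"
        unfolding hi_def s3.position_le_iff by simp
      have seg: "\<phi>2 (hi c) \<le> c - \<phi>1 (hi c)" "c - \<phi>1 (lo c) \<le> horizon"
        using \<phi>lo[of c] \<phi>hi[of c] by auto
      have "primitive_on (lo c) 1 (\<lambda>y. u1 y ((t0 - c) + \<phi>1 y)) (\<lambda>y. c1 y / e1 y * u2 y ((t0 - c) + \<phi>1 y))"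
        by (rule u1_line) (use lo seg t0 in auto)
      then have "primitive_on (lo c) (hi c) (\<lambda>y. u1 y ((t0 - c) + \<phi>1 y)) (\<lambda>y. c1 y / e1 y * u2 y ((t0 - c) + \<phi>1 y))"
        by (rule primitive_on_subinterval) (use lohi hi in auto)
      from primitive_on_mult[OF k1_line[OF lo(1) lohi hi seg c] this]
      have "primitive_on (lo c) (hi c) (\<Gamma> c) (\<lambda>y. exchange t0 (c - \<phi>1 y) y)"
        by (rule primitive_on_cong)
          (use less_imp_neq[OF s1.e_pos, symmetric] in \<open>auto simp: \<Gamma>_def exchange_def algebra_simps\<close>)
      from primitive_on_eq[OF this lohi] show ?thesis using True by simp
    next
      case False
      have "y \<notin> {lo c..hi c}" for y
      proof
        assume "y \<in> {lo c..hi c}"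
        then have "(c - \<phi>1 y, y) \<in> region" by (simp add: ind)
        then have "0 \<le> \<phi>1 y" "\<phi>1 y \<le> \<phi>1 1" "0 \<le> \<phi>2 y" "\<phi>2 y \<le> c - \<phi>1 y" "c - \<phi>1 y \<le> horizon"
          by (auto simp: region_def)
        then show False using False unfolding atLeastAtMost_iff by linarith
      qed
      then have "{lo c..hi c} = {}" by blast
      then show ?thesis using False by (simp add: set_lebesgue_integral_def del: atLeastatMost_empty_iff)
    qed
    finally show ?thesis .
  qed
  note int = exchange_integrable[OF t0]
  have [measurable]: "(\<lambda>c. \<Gamma> c (hi c)) \<in> borel_measurable borel" "(\<lambda>c. \<Gamma> c (lo c)) \<in> borel_measurable borel"
    unfolding \<Gamma>_def hi_def lo_def by measurable
  have "(LBINT s. LBINT y. indicator region (s, y) * exchange t0 s y) =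
      (LBINT c. LBINT y. indicator region (c + - \<phi>1 y, y) * exchange t0 (c + - \<phi>1 y) y)"
    by (rule shear_integral(2)[OF int, symmetric]) measurable
  also have "\<dots> = (LBINT c:?J. \<Gamma> c (hi c) - \<Gamma> c (lo c))"
    unfolding set_lebesgue_integral_def
  proof (rule integral_cong_AE)
    show "(\<lambda>c. LBINT y. indicator region (c + - \<phi>1 y, y) * exchange t0 (c + - \<phi>1 y) y) \<in> borel_measurable lborel"
      by (rule borel_measurable_integrable[OF lborel_pair.integrable_fst[OF shear_integral(1)[OF int]]]) measurable
    show "AE c in lborel. (LBINT y. indicator region (c + - \<phi>1 y, y) * exchange t0 (c + - \<phi>1 y) y) =
        indicator ?J c *\<^sub>R (\<Gamma> c (hi c) - \<Gamma> c (lo c))"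
      using AE_lborel_singleton[of "\<phi>1 1 + \<phi>2 1"] by eventually_elim (use line in simp)
  qed measurable
  finally have Q: "(LBINT s. LBINT y. indicator region (s, y) * exchange t0 s y) =
      (LBINT c:?J. \<Gamma> c (hi c) - \<Gamma> c (lo c))" .
  let ?h = "\<lambda>y. - c2 y / e2 y * u1 y (t0 - \<phi>2 y)"
  have h: "set_integrable lborel {0..1} ?h"
    using primitive_on_integrable[OF u2_line[of 1 t0]] t0 hb by simp
  let ?H = "\<lambda>c. ?h (s3.position c) * (1 / (1 / e1 (s3.position c) + 1 / e2 (s3.position c)))"
  have H: "set_integrable lborel {0..\<phi>1 1 + \<phi>2 1} ?H"
    "(LBINT c:{0..\<phi>1 1 + \<phi>2 1}. ?H c) = (LBINT y:{0..1}. ?h y)"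
    using s3.integral_position_rising[OF h zero_le_one, of 0] by simp_all
  \<comment> \<open>The Jacobian \<open>1 / e1 + 1 / e2\<close> of the label along the diagonal
    cancels the denominator \<open>e1 + e2\<close> in \<open>K1_diag\<close> and leaves
    \<open>- c2 / e2\<close>, the density of \<open>u2\<close> along its characteristic. Labels
    beyond the diagonal end on \<open>y = 1\<close> and contribute zero.\<close>
  have hi_eq: "indicator ?J c *\<^sub>R \<Gamma> c (hi c) = indicator {0..\<phi>1 1 + \<phi>2 1} c *\<^sub>R ?H c" for c
  proof (cases "c \<in> {0..\<phi>1 1 + \<phi>2 1}")
    case True
    then have hi: "hi c = s3.position c" by (simp add: hi_def)
    have "c - \<phi>1 (hi c) = \<phi>2 (hi c)" using True \<phi>hi[of c] by auto
    moreover have "0 \<le> hi c" "hi c \<le> 1"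
      using True by (auto simp: hi s3.position_le_iff s3.le_position_iff)
    ultimately have y: "0 \<le> hi c" "hi c \<le> 1" "c - \<phi>1 (hi c) = \<phi>2 (hi c)" by auto
    have pos: "0 < e1 (hi c)" "0 < e2 (hi c)" "0 < e1 (hi c) + e2 (hi c)"
      using s1.e_pos s2.e_pos by (auto intro: add_pos_pos)
    have "\<Gamma> c (hi c) = e1 (hi c) * (- c2 (hi c) / (e1 (hi c) + e2 (hi c))) * u1 (hi c) (t0 - \<phi>2 (hi c))"
      using y K1_diag[of "hi c"] by (simp add: \<Gamma>_def k1_def)
    also have "e1 (hi c) * (- c2 (hi c) / (e1 (hi c) + e2 (hi c))) =
        - c2 (hi c) / e2 (hi c) * (1 / (1 / e1 (hi c) + 1 / e2 (hi c)))"
      using pos by (simp add: divide_simps)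
    finally have "\<Gamma> c (hi c) = ?H c" by (simp add: hi mult_ac)
    then show ?thesis using True hb by simp
  next
    case False
    have "\<Gamma> c (hi c) = 0" if "c \<in> ?J"
    proof -
      have c: "\<phi>1 1 + \<phi>2 1 < c" "c \<le> horizon + \<phi>1 1" using that False by auto
      have "hi c = 1" using c s3.position_travel[of 1] by (simp add: hi_def)
      moreover have "(c - \<phi>1 1 - \<phi>2 1) / \<tau> \<in> {0<..1}" using c \<tau>_pos by (simp add: horizon_def)
      ultimately show ?thesis using c \<alpha>1_top by (simp add: \<Gamma>_def k1_def)
    qed
    then show ?thesis using False by (auto simp: indicator_def)
  qed
  have hi_int: "set_integrable lborel ?J (\<lambda>c. \<Gamma> c (hi c))"
    "(LBINT c:?J. \<Gamma> c (hi c)) = (LBINT y:{0..1}. ?h y)"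
    using H unfolding set_integrable_def set_lebesgue_integral_def hi_eq by simp_all
  have lo1: "\<Gamma> c (lo c) = e1 0 * k1 c 0 * u1 0 (t0 - c)" if "c \<in> {0..horizon}" for c
  proof -
    have "max 0 (c - horizon) = 0" using that by auto
    then show ?thesis by (simp add: lo_def \<Gamma>_def)
  qed
  let ?L = "\<lambda>c. k1 horizon (s1.position (c - horizon)) * u1 (s1.position (c - horizon)) (t0 - horizon) *
      e1 (s1.position (c - horizon))"
  have L: "set_integrable lborel {horizon..horizon + \<phi>1 1} ?L"
    "(LBINT c:{horizon..horizon + \<phi>1 1}. ?L c) = (LBINT y:{0..1}. k1 horizon y * u1 y (t0 - horizon))"
    using s1.integral_position_rising[OF slice_integrable(1)[OF t0] zero_le_one, of horizon] by simp_all
  have lo2: "\<Gamma> c (lo c) = ?L c" if "c \<in> {horizon..horizon + \<phi>1 1}" for c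
  proof -
    have "max 0 (c - horizon) = c - horizon" using that by auto
    then show ?thesis by (simp add: lo_def \<Gamma>_def mult_ac)
  qed
  have lo1_int: "set_integrable lborel {0..horizon} (\<lambda>c. \<Gamma> c (lo c))"
    using outflow1_integrable[OF t0] by (subst set_integrable_cong[OF refl refl lo1]) auto
  have lo2_int: "set_integrable lborel {horizon..horizon + \<phi>1 1} (\<lambda>c. \<Gamma> c (lo c))"
    using L(1) by (subst set_integrable_cong[OF refl refl lo2]) auto
  have "(LBINT c:?J. \<Gamma> c (lo c)) = (LBINT c:{0..horizon}. \<Gamma> c (lo c)) + (LBINT c:{horizon..horizon + \<phi>1 1}. \<Gamma> c (lo c))"
    by (rule set_integral_Icc_combine(2)[OF _ _ lo1_int lo2_int]) (use hb in auto)
  also have "(LBINT c:{0..horizon}. \<Gamma> c (lo c)) = (LBINT c:{0..horizon}. e1 0 * k1 c 0 * u1 0 (t0 - c))"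
    by (rule set_lebesgue_integral_cong) (use lo1 in auto)
  also have "(LBINT c:{horizon..horizon + \<phi>1 1}. \<Gamma> c (lo c)) = (LBINT c:{horizon..horizon + \<phi>1 1}. ?L c)"
    by (rule set_lebesgue_integral_cong) (use lo2 in auto)
  finally have lo_val: "(LBINT c:?J. \<Gamma> c (lo c)) = (LBINT c:{0..horizon}. e1 0 * k1 c 0 * u1 0 (t0 - c)) +
      (LBINT y:{0..1}. k1 horizon y * u1 y (t0 - horizon))" by (simp add: L(2))
  have lo_int: "set_integrable lborel ?J (\<lambda>c. \<Gamma> c (lo c))"
    by (rule set_integral_Icc_combine(1)[OF _ _ lo1_int lo2_int]) (use hb in auto)
  show ?thesis
    unfolding Q set_integral_diff(2)[OF hi_int(1) lo_int] hi_int(2) lo_val by simp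
qed

text \<open>In this family the diagonal is the single line \<open>c = 0\<close> and carries no flux;
  lines with negative label miss the region. All lower ends lie on \<open>y = 0\<close>. Upper ends
  lie on \<open>y = 1\<close> for \<open>c \<le> \<tau>\<close>, which yields the inlet history, and
  on \<open>s = horizon\<close> for larger \<open>c\<close>.\<close>

lemma flux2:
  assumes t0: "horizon < t0"
  shows "(LBINT c:{0..\<tau>}. e2 1 * \<alpha>2 (c / \<tau>) 1 * u2 1 (t0 - \<phi>2 1 - c)) +
    (LBINT y:{0..1}. k2 horizon y * u2 y (t0 - horizon)) =
    (LBINT c:{0..horizon}. e1 0 * k1 c 0 * u1 0 (t0 - c)) +
    (LBINT s. LBINT y. indicator region (s, y) * exchange t0 s y)"
proof -
  note hb = horizon_bounds
  define \<Gamma> where "\<Gamma> c y = e2 y * k2 (c + \<phi>2 y) y * u2 y (t0 - (c + \<phi>2 y))" for c y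
  define hi where "hi c = s2.position (min (\<phi>2 1) (horizon - c))" for c
  let ?J = "{0..horizon}"
  have ind: "(c + \<phi>2 y, y) \<in> region \<longleftrightarrow> 0 \<le> c \<and> y \<in> {0..hi c}" for c y
    by (auto simp: region_def hi_def s2.le_position_iff)
  have \<phi>hi: "\<phi>2 (hi c) = min (\<phi>2 1) (horizon - c)" for c by (simp add: hi_def)
  have line: "(LBINT y. indicator region (c + \<phi>2 y, y) * exchange t0 (c + \<phi>2 y) y) =
      indicator ?J c * (\<Gamma> c (hi c) - \<Gamma> c 0)" if c: "c \<noteq> 0" for c
  proof (cases "c \<in> ?J")
    case True
    have "(LBINT y. indicator region (c + \<phi>2 y, y) * exchange t0 (c + \<phi>2 y) y) =
        (LBINT y:{0..hi c}. exchange t0 (c + \<phi>2 y) y)"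
      unfolding set_lebesgue_integral_def
      by (rule Bochner_Integration.integral_cong) (use True in \<open>auto simp: indicator_def ind\<close>)
    moreover have hi: "0 \<le> hi c" "hi c \<le> 1" "c + \<phi>2 (hi c) \<le> horizon"
      using True hb \<phi>hi[of c] by (auto simp: hi_def s2.position_le_iff s2.le_position_iff)
    have "primitive_on 0 (hi c) (\<lambda>y. u2 y ((t0 - c) - \<phi>2 y)) (\<lambda>y. - c2 y / e2 y * u1 y ((t0 - c) - \<phi>2 y))"
      by (rule u2_line) (use hi t0 in auto)
    from primitive_on_mult[OF k2_line[OF order_refl hi(1) hi(2) _ hi(3)] this]
    have "primitive_on 0 (hi c) (\<Gamma> c) (\<lambda>y. exchange t0 (c + \<phi>2 y) y)"
      by (rule primitive_on_cong)
        (use True c less_imp_neq[OF s2.e_pos, symmetric] in \<open>auto simp: \<Gamma>_def exchange_def algebra_simps\<close>)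
    from primitive_on_eq[OF this hi(1)]
    have "\<Gamma> c (hi c) - \<Gamma> c 0 = (LBINT y:{0..hi c}. exchange t0 (c + \<phi>2 y) y)" .
    ultimately show ?thesis using True by simp
  next
    case False
    have "(c + \<phi>2 y, y) \<notin> region" for y
    proof
      assume "(c + \<phi>2 y, y) \<in> region"
      then have "0 \<le> \<phi>2 y" "\<phi>2 y \<le> c + \<phi>2 y" "c + \<phi>2 y \<le> horizon"
        by (auto simp: region_def)
      then show False using False unfolding atLeastAtMost_iff by linarith
    qed
    then show ?thesis using False by simp
  qed
  have t0': "horizon \<le> t0" using t0 by simp
  note int = exchange_integrable[OF t0']
  have [measurable]: "(\<lambda>c. \<Gamma> c (hi c)) \<in> borel_measurable borel" "(\<lambda>c. \<Gamma> c 0) \<in> borel_measurable borel"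
    unfolding \<Gamma>_def hi_def by measurable
  have "(LBINT s. LBINT y. indicator region (s, y) * exchange t0 s y) =
      (LBINT c. LBINT y. indicator region (c + \<phi>2 y, y) * exchange t0 (c + \<phi>2 y) y)"
    by (rule shear_integral(2)[OF int, symmetric]) measurable
  also have "\<dots> = (LBINT c:?J. \<Gamma> c (hi c) - \<Gamma> c 0)"
    unfolding set_lebesgue_integral_def
  proof (rule integral_cong_AE)
    show "(\<lambda>c. LBINT y. indicator region (c + \<phi>2 y, y) * exchange t0 (c + \<phi>2 y) y) \<in> borel_measurable lborel"
      by (rule borel_measurable_integrable[OF lborel_pair.integrable_fst[OF shear_integral(1)[OF int]]]) measurable
    show "AE c in lborel. (LBINT y. indicator region (c + \<phi>2 y, y) * exchange t0 (c + \<phi>2 y) y) =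
        indicator ?J c *\<^sub>R (\<Gamma> c (hi c) - \<Gamma> c 0)"
      using AE_lborel_singleton[of 0] by eventually_elim (simp add: line)
  qed measurable
  finally have Q: "(LBINT s. LBINT y. indicator region (s, y) * exchange t0 s y) =
      (LBINT c:?J. \<Gamma> c (hi c) - \<Gamma> c 0)" .
  obtain B where B: "\<And>s y. \<bar>k2 s y\<bar> \<le> B" using k_bound by auto
  have hi1: "\<Gamma> c (hi c) = e2 1 * k2 (c + \<phi>2 1) 1 * u2 1 (t0 - \<phi>2 1 - c)" if "c \<in> {0..\<tau>}" for c
  proof -
    have "min (\<phi>2 1) (horizon - c) = \<phi>2 1" using that by (simp add: horizon_def)
    then show ?thesis by (simp add: hi_def \<Gamma>_def algebra_simps)
  qed
  have "set_integrable lborel {t0 - \<phi>2 1 - t0..t0 - \<phi>2 1 - 0} (\<lambda>c. u2 1 (t0 - \<phi>2 1 - c))"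
    by (rule set_integrable_flip[OF u2_inflow_integrable])
  then have "set_integrable lborel {0..\<tau>} (\<lambda>c. u2 1 (t0 - \<phi>2 1 - c))"
    by (rule set_integrable_subset) (use t0 hb in \<open>auto simp: horizon_def\<close>)
  then have hi1_int': "set_integrable lborel {0..\<tau>} (\<lambda>c. e2 1 * k2 (c + \<phi>2 1) 1 * u2 1 (t0 - \<phi>2 1 - c))"
    by (rule set_integrable_bounded_mult[where B = "e2 1 * B"])
      (use B[of _ 1] s2.e_pos[of 1] in \<open>auto simp: abs_mult\<close>)
  have hi1_int: "set_integrable lborel {0..\<tau>} (\<lambda>c. \<Gamma> c (hi c))"
    using hi1_int' by (subst set_integrable_cong[OF refl refl hi1]) auto
  let ?L = "\<lambda>c. k2 horizon (s2.position (horizon - c)) * u2 (s2.position (horizon - c)) (t0 - horizon) *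
      e2 (s2.position (horizon - c))"
  have L: "set_integrable lborel {\<tau>..horizon} ?L"
    "(LBINT c:{\<tau>..horizon}. ?L c) = (LBINT y:{0..1}. k2 horizon y * u2 y (t0 - horizon))"
    using s2.integral_position_falling[OF slice_integrable(2)[OF t0'] zero_le_one, of horizon]
    by (simp_all add: horizon_def)
  have hi2: "\<Gamma> c (hi c) = ?L c" if "c \<in> {\<tau>..horizon}" for c
  proof -
    have "min (\<phi>2 1) (horizon - c) = horizon - c" using that by (simp add: horizon_def)
    then show ?thesis by (simp add: hi_def \<Gamma>_def mult_ac)
  qed
  have hi2_int: "set_integrable lborel {\<tau>..horizon} (\<lambda>c. \<Gamma> c (hi c))"
    using L(1) by (subst set_integrable_cong[OF refl refl hi2]) auto
  have \<tau>h: "0 \<le> \<tau>" "\<tau> \<le> horizon" using \<tau>_pos hb by (auto simp: horizon_def)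
  have hi_int: "set_integrable lborel ?J (\<lambda>c. \<Gamma> c (hi c))"
    by (rule set_integral_Icc_combine(1)[OF \<tau>h hi1_int hi2_int])
  have "(LBINT c:?J. \<Gamma> c (hi c)) = (LBINT c:{0..\<tau>}. \<Gamma> c (hi c)) + (LBINT c:{\<tau>..horizon}. \<Gamma> c (hi c))"
    by (rule set_integral_Icc_combine(2)[OF \<tau>h hi1_int hi2_int])
  also have "(LBINT c:{0..\<tau>}. \<Gamma> c (hi c)) = (LBINT c:{0..\<tau>}. e2 1 * \<alpha>2 (c / \<tau>) 1 * u2 1 (t0 - \<phi>2 1 - c))"
    by (rule set_lebesgue_integral_cong) (use hi1 in \<open>auto simp: k2_after\<close>)
  also have "(LBINT c:{\<tau>..horizon}. \<Gamma> c (hi c)) = (LBINT c:{\<tau>..horizon}. ?L c)"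
    by (rule set_lebesgue_integral_cong) (use hi2 in auto)
  finally have hi_val: "(LBINT c:?J. \<Gamma> c (hi c)) = (LBINT c:{0..\<tau>}. e2 1 * \<alpha>2 (c / \<tau>) 1 * u2 1 (t0 - \<phi>2 1 - c)) +
      (LBINT y:{0..1}. k2 horizon y * u2 y (t0 - horizon))" by (simp add: L(2))
  \<comment> \<open>The reflection of the state together with \<open>k_base\<close> converts the
    second-family flux at \<open>y = 0\<close> into the first-family one. Strictness in
    \<open>horizon < t0\<close> keeps \<open>t0 - c\<close> positive on the whole range of
    \<open>c\<close>.\<close>
  have "AE c in lborel. 0 < t0 - c \<longrightarrow> u1 0 (t0 - c) = q * u2 0 (t0 - c)"
    using AE_lborel_affine[OF reflection, of "- 1" t0] by simp
  then have lo: "AE c in lborel. indicator ?J c *\<^sub>R (e1 0 * k1 c 0 * u1 0 (t0 - c)) = indicator ?J c *\<^sub>R \<Gamma> c 0"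
  proof eventually_elim
    case (elim c)
    show ?case
    proof (cases "c \<in> ?J")
      case True
      then have "e1 0 * k1 c 0 * u1 0 (t0 - c) = (q * e1 0 * k1 c 0) * u2 0 (t0 - c)"
        using elim t0 by simp
      also have "\<dots> = \<Gamma> c 0" using k_base[of c] True by (simp add: \<Gamma>_def)
      finally show ?thesis by simp
    qed simp
  qed
  have meas: "(\<lambda>c. indicator ?J c *\<^sub>R (e1 0 * k1 c 0 * u1 0 (t0 - c))) \<in> borel_measurable lborel"
    "(\<lambda>c. indicator ?J c *\<^sub>R \<Gamma> c 0) \<in> borel_measurable lborel"
    by measurable
  have lo_int: "set_integrable lborel ?J (\<lambda>c. \<Gamma> c 0)"
    using outflow1_integrable[OF t0'] integrable_cong_AE[OF meas lo] by (simp only: set_integrable_def)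
  have lo_val: "(LBINT c:?J. \<Gamma> c 0) = (LBINT c:?J. e1 0 * k1 c 0 * u1 0 (t0 - c))"
    using integral_cong_AE[OF meas lo] by (simp only: set_lebesgue_integral_def)
  show ?thesis
    unfolding Q set_integral_diff(2)[OF hi_int lo_int] hi_val lo_val by simp
qed

text \<open>The hypothesis is the control law with the contents of the delay line rewritten as inlet
  history. Eliminating the outflow and exchange integrals between the two balances shows that its
  right-hand side equals the change of \<open>u2\<close> along the characteristic, that is, the
  inlet value minus \<open>u2 0 t0\<close>.\<close>

lemma outflow_vanishes:
  assumes "horizon < t0"
    and "u2 1 (t0 - \<phi>2 1) = (LBINT c:{0..\<tau>}. e2 1 * \<alpha>2 (c / \<tau>) 1 * u2 1 (t0 - \<phi>2 1 - c)) +
      (LBINT y:{0..1}. \<alpha>1 1 y * u1 y (t0 - horizon)) + (LBINT y:{0..1}. \<alpha>2 1 y * u2 y (t0 - horizon))"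
  shows "u2 0 t0 = 0"
proof -
  have "primitive_on 0 1 (\<lambda>y. u2 y (t0 - \<phi>2 y)) (\<lambda>y. - c2 y / e2 y * u1 y (t0 - \<phi>2 y))"
    by (rule u2_line) (use assms horizon_bounds in auto)
  from primitive_on_eq[OF this]
  have "u2 1 (t0 - \<phi>2 1) - u2 0 t0 = (LBINT y:{0..1}. - c2 y / e2 y * u1 y (t0 - \<phi>2 y))" by simp
  then show ?thesis
    using flux1[of t0] flux2[of t0] assms by (simp add: k1_horizon k2_horizon)
qed

end

section \<open>Finite-time stability\<close>

definition on_state :: "(real \<Rightarrow> real \<Rightarrow> real) \<Rightarrow> real \<Rightarrow> real \<Rightarrow> real" where
  "on_state u y t = indicator state_domain (y, t) * u y t"

lemma on_state_eq [simp]: "0 \<le> y \<Longrightarrow> y \<le> 1 \<Longrightarrow> 0 \<le> t \<Longrightarrow> on_state u y t = u y t"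
  by (simp add: on_state_def state_domain_def)

lemma borel_on_set:
  fixes f :: "real \<Rightarrow> real \<Rightarrow> real"
  assumes "set_borel_measurable borel D (\<lambda>(x, y). f x y)"
  shows "case_prod (\<lambda>x y. indicator D (x, y) * f x y) \<in> borel_measurable (borel \<Otimes>\<^sub>M borel)"
  using assms by (simp add: set_borel_measurable_def borel_prod case_prod_unfold)

lemma on_state_borel:
  assumes "locally_bounded_in_L2 u"
  shows "case_prod (on_state u) \<in> borel_measurable (borel \<Otimes>\<^sub>M borel)"
  unfolding on_state_def[abs_def]
  by (rule borel_on_set) (use assms in \<open>simp add: locally_bounded_in_L2_def\<close>)

text \<open>Passes from square integrability to integrability on sets of finite measure.\<close>

lemma abs_le_one_plus_square: "\<bar>x\<bar> \<le> 1 + x\<^sup>2" for x :: real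
  using zero_le_power2[of "\<bar>x\<bar> - 1/2"] by (simp add: power2_eq_square algebra_simps)

lemma on_state_slice:
  assumes u: "locally_bounded_in_L2 u" and t: "0 \<le> t"
  shows "set_integrable lborel {0..1} (\<lambda>y. on_state u y t)"
proof -
  note [measurable] = on_state_borel[OF u]
  have "set_integrable lborel {0..1} (\<lambda>y. (u y t)\<^sup>2)"
    using u t unfolding locally_bounded_in_L2_def by (meson atLeastAtMost_iff order_refl)
  then have sq: "integrable lborel (\<lambda>y. indicator {0..1} y *\<^sub>R 1 + indicator {0..1} y *\<^sub>R (u y t)\<^sup>2)"
    unfolding set_integrable_def by (intro Bochner_Integration.integrable_add) auto
  show ?thesis
    unfolding set_integrable_def
  proof (rule Bochner_Integration.integrable_bound[OF sq])
    show "AE y in lborel. norm (indicator {0..1} y *\<^sub>R on_state u y t) \<le>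
        norm (indicator {0..1} y *\<^sub>R 1 + indicator {0..1} y *\<^sub>R (u y t)\<^sup>2)"
      using t abs_le_one_plus_square by (auto simp: indicator_def)
  qed measurable
qed

lemma on_state_strip:
  assumes u: "locally_bounded_in_L2 u"
  shows "set_integrable (lborel \<Otimes>\<^sub>M lborel) ({0..T} \<times> {0..1}) (\<lambda>(t, y). on_state u y t)"
  unfolding set_integrable_def integrable_iff_bounded
proof
  note [measurable] = on_state_borel[OF u]
  let ?f = "\<lambda>p. indicator ({0..T} \<times> {0..1}) p *\<^sub>R (case p of (t, y) \<Rightarrow> on_state u y t)"
  show meas: "?f \<in> borel_measurable (lborel \<Otimes>\<^sub>M lborel)" by measurable
  obtain M where M: "\<And>t. t \<in> {0..T} \<Longrightarrow>
      set_integrable lborel {0..1} (\<lambda>x. (u x t)\<^sup>2) \<and> (LBINT x:{0..1}. (u x t)\<^sup>2) \<le> M"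
    using u unfolding locally_bounded_in_L2_def by meson
  have slice: "(\<integral>\<^sup>+ y. ennreal (norm (?f (t, y))) \<partial>lborel) \<le> indicator {0..T} t * ennreal (1 + M)" for t
  proof (cases "t \<in> {0..T}")
    case True
    let ?g = "\<lambda>y. indicator {0..1} y *\<^sub>R 1 + indicator {0..1} y *\<^sub>R (u y t)\<^sup>2"
    have g: "integrable lborel ?g"
      using M[OF True] unfolding set_integrable_def by (intro Bochner_Integration.integrable_add) auto
    have "(\<integral>\<^sup>+ y. ennreal (norm (?f (t, y))) \<partial>lborel) \<le> (\<integral>\<^sup>+ y. ennreal (?g y) \<partial>lborel)"
      using True abs_le_one_plus_square
      by (intro nn_integral_mono ennreal_leI) (auto simp: indicator_def)
    also have "\<dots> = ennreal (LBINT y. ?g y)"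
      by (rule nn_integral_eq_integral[OF g]) auto
    also have "(LBINT y. ?g y) = 1 + (LBINT x:{0..1}. (u x t)\<^sup>2)"
      using M[OF True] unfolding set_integrable_def set_lebesgue_integral_def
      by (subst Bochner_Integration.integral_add) auto
    also have "ennreal \<dots> \<le> ennreal (1 + M)" using M[OF True] by (intro ennreal_leI) auto
    finally show ?thesis using True by simp
  next
    case False
    then have "(\<integral>\<^sup>+ y. ennreal (norm (?f (t, y))) \<partial>lborel) = (\<integral>\<^sup>+ y. 0 \<partial>(lborel :: real measure))"
      by (intro nn_integral_cong) (auto simp: indicator_def)
    then show ?thesis by simp
  qed
  have "(\<integral>\<^sup>+ p. ennreal (norm (?f p)) \<partial>(lborel \<Otimes>\<^sub>M lborel)) =
      (\<integral>\<^sup>+ t. (\<integral>\<^sup>+ y. ennreal (norm (?f (t, y))) \<partial>lborel) \<partial>lborel)"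
    using meas by (intro lborel.nn_integral_fst[symmetric]) measurable
  also have "\<dots> \<le> (\<integral>\<^sup>+ t. indicator {0..T} t * ennreal (1 + M) \<partial>lborel)"
    by (rule nn_integral_mono[OF slice])
  also have "\<dots> < \<infinity>" by (simp add: nn_integral_multc ennreal_mult_less_top emeasure_lborel_Icc_eq)
  finally show "(\<integral>\<^sup>+ p. ennreal (norm (?f p)) \<partial>(lborel \<Otimes>\<^sub>M lborel)) < \<infinity>" .
qed

lemma bounded_coefficient:
  fixes c :: "real \<Rightarrow> real"
  assumes "continuous_on {0..1} c"
  shows "\<exists>C. \<forall>y. \<bar>c (clamp_unit y)\<bar> \<le> C"
proof -
  have "bounded (c ` {0..1})" using assms by (intro compact_imp_bounded compact_continuous_image) auto
  then obtain C where "\<forall>y\<in>{0..1}. \<bar>c y\<bar> \<le> C" unfolding bounded_iff by auto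
  then show ?thesis by (intro exI[of _ C]) simp
qed

lemma compact_kernel_triangle: "compact kernel_triangle"
proof (rule compact_Int_closed[of "{0..1} \<times> {0..1}" "{p. snd p \<le> fst p}", THEN back_subst[of compact]])
  show "closed {p :: real \<times> real. snd p \<le> fst p}"
    by (intro closed_Collect_le continuous_intros)
qed (auto intro!: compact_Times simp: kernel_triangle_def)

lemma triangle_kernel:
  fixes K :: "real \<Rightarrow> real \<Rightarrow> real"
  assumes "continuous_on kernel_triangle (\<lambda>(x, y). K x y)"
  shows "case_prod (\<lambda>x y. indicator kernel_triangle (x, y) * K x y) \<in> borel_measurable (borel \<Otimes>\<^sub>M borel)"
    and "\<exists>B\<ge>0. \<forall>x y. \<bar>indicator kernel_triangle (x, y) * K x y\<bar> \<le> B"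
proof -
  have "closed kernel_triangle" using compact_kernel_triangle by (rule compact_imp_closed)
  then have "set_borel_measurable borel kernel_triangle (\<lambda>(x, y). K x y)"
    unfolding set_borel_measurable_def
    by (intro borel_measurable_continuous_on_indicator assms) auto
  then show "case_prod (\<lambda>x y. indicator kernel_triangle (x, y) * K x y) \<in> borel_measurable (borel \<Otimes>\<^sub>M borel)"
    by (rule borel_on_set)
  have "bounded ((\<lambda>(x, y). K x y) ` kernel_triangle)"
    by (intro compact_imp_bounded compact_continuous_image assms compact_kernel_triangle)
  then obtain B where "\<forall>p\<in>kernel_triangle. \<bar>case p of (x, y) \<Rightarrow> K x y\<bar> \<le> B"
    unfolding bounded_iff by auto
  then have B: "\<And>p. p \<in> kernel_triangle \<Longrightarrow> \<bar>case p of (x, y) \<Rightarrow> K x y\<bar> \<le> B" by blast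
  have "0 \<in> kernel_triangle" by (simp add: kernel_triangle_def zero_prod_def)
  from B[OF this] have "0 \<le> B" by linarith
  then show "\<exists>B\<ge>0. \<forall>x y. \<bar>indicator kernel_triangle (x, y) * K x y\<bar> \<le> B"
    using B by (intro exI[of _ B]) (fastforce simp: indicator_def)
qed

theorem theorem2:
  fixes \<tau> q :: real
    and \<epsilon>1 \<epsilon>2 c1 c2 u10 u20 v0 :: "real \<Rightarrow> real"
    and K21 K22 \<alpha>1 \<alpha>2 u1 u2 v :: "real \<Rightarrow> real \<Rightarrow> real"
  assumes "\<tau> > 0" and "q > 0"
    and "continuous_on {0..1} \<epsilon>1" and "continuous_on {0..1} \<epsilon>2"
    and "continuous_on {0..1} c1" and "continuous_on {0..1} c2"
    and "\<forall>x\<in>{0..1}. \<epsilon>1 x > 0" and "\<forall>x\<in>{0..1}. \<epsilon>2 x > 0"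
    and "is_backstepping_kernel q \<epsilon>1 \<epsilon>2 c1 c2 K21 K22"
    and "is_delay_kernel \<tau> q \<epsilon>1 \<epsilon>2 c1 c2 K21 K22 \<alpha>1 \<alpha>2"
    and "L2_unit_interval u10" and "L2_unit_interval u20" and "L2_unit_interval v0"
    and "is_mild_solution \<tau> q \<epsilon>1 \<epsilon>2 c1 c2 (delay_gain \<tau> \<epsilon>2 \<alpha>2) \<alpha>1 \<alpha>2 u10 u20 v0 u1 u2 v"
  shows "\<forall>t \<ge> \<tau> + integral {0..1} (\<lambda>y. 1 / \<epsilon>1 y + 1 / \<epsilon>2 y).
    AE x in lebesgue. x \<in> {0..1} \<longrightarrow> u1 x t = 0 \<and> u2 x t = 0 \<and> v x t = 0"
proof (intro allI impI)
  fix t assume t: "\<tau> + integral {0..1} (\<lambda>y. 1 / \<epsilon>1 y + 1 / \<epsilon>2 y) \<le> t"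
  note kernel = assms(9)[unfolded is_backstepping_kernel_def]
  note delay = assms(10)[unfolded is_delay_kernel_def]
  note sol = assms(14)[unfolded is_mild_solution_def]
  \<comment> \<open>The locales want total functions: coefficients are clamped, kernels and states
    are cut off by zero, and all of them agree with the given data where the equations live.\<close>
  define e1 where "e1 y = \<epsilon>1 (clamp_unit y)" for y
  define e2 where "e2 y = \<epsilon>2 (clamp_unit y)" for y
  define d1 where "d1 y = c1 (clamp_unit y)" for y
  define d2 where "d2 y = c2 (clamp_unit y)" for y
  have coeff: "e1 y = \<epsilon>1 y" "e2 y = \<epsilon>2 y" "d1 y = c1 y" "d2 y = c2 y" if "0 \<le> y" "y \<le> 1" for y
    using that by (simp_all add: e1_def e2_def d1_def d2_def)
  obtain \<phi>1 where \<phi>1: "travel_time e1 \<phi>1" "\<phi>1 1 = integral {0..1} (\<lambda>y. 1 / \<epsilon>1 y)"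
    unfolding e1_def[abs_def] using travel_time_exists[OF assms(3)] assms(7) by blast
  obtain \<phi>2 where \<phi>2: "travel_time e2 \<phi>2" "\<phi>2 1 = integral {0..1} (\<lambda>y. 1 / \<epsilon>2 y)"
    unfolding e2_def[abs_def] using travel_time_exists[OF assms(4)] assms(8) by blast
  interpret s1: travel_time e1 \<phi>1 by (rule \<phi>1)
  interpret s2: travel_time e2 \<phi>2 by (rule \<phi>2)
  define K1 where "K1 x y = indicator kernel_triangle (x, y) * K21 x y" for x y
  define K2 where "K2 x y = indicator kernel_triangle (x, y) * K22 x y" for x y
  define A1 where "A1 x y = indicator kernel_square (x, y) * \<alpha>1 x y" for x y
  define A2 where "A2 x y = indicator kernel_square (x, y) * \<alpha>2 x y" for x y
  have K_eq: "K1 x y = K21 x y" "K2 x y = K22 x y" if "(x, y) \<in> kernel_triangle" for x y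
    using that by (simp_all add: K1_def K2_def)
  have A_eq: "A1 x y = \<alpha>1 x y" "A2 x y = \<alpha>2 x y" if "0 \<le> x" "x \<le> 1" "0 \<le> y" "y \<le> 1" for x y
    using that by (simp_all add: A1_def A2_def kernel_square_def)
  have L2: "locally_bounded_in_L2 u1" "locally_bounded_in_L2 u2" "locally_bounded_in_L2 v"
    using sol by auto
  obtain C1 where C1: "\<And>y. \<bar>d1 y\<bar> \<le> C1" using bounded_coefficient[OF assms(5)] by (auto simp: d1_def)
  obtain C2 where C2: "\<And>y. \<bar>d2 y\<bar> \<le> C2" using bounded_coefficient[OF assms(6)] by (auto simp: d2_def)
  obtain B1 where B1: "0 \<le> B1" "\<And>x y. \<bar>K1 x y\<bar> \<le> B1"
    using triangle_kernel(2)[of K21] kernel by (auto simp: K1_def)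
  obtain B2 where B2: "0 \<le> B2" "\<And>x y. \<bar>K2 x y\<bar> \<le> B2"
    using triangle_kernel(2)[of K22] kernel by (auto simp: K2_def)
  obtain M where M: "\<And>x y. (x, y) \<in> kernel_square \<Longrightarrow> \<bar>\<alpha>1 x y\<bar> \<le> M \<and> \<bar>\<alpha>2 x y\<bar> \<le> M"
    using delay by blast
  interpret feedback_kernels e1 \<phi>1 e2 \<phi>2 d1 d2 "on_state u1" "on_state u2" q \<tau> K1 K2 A1 A2
  proof
    show "d1 \<in> borel_measurable borel" "d2 \<in> borel_measurable borel"
      unfolding d1_def[abs_def] d2_def[abs_def]
      by (intro borel_measurable_continuous_onI continuous_on_clamp_unit assms(5,6))+
    show "\<exists>C. \<forall>y. \<bar>d1 y\<bar> \<le> C \<and> \<bar>d2 y\<bar> \<le> C"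
      using C1 C2 by (intro exI[of _ "max C1 C2"]) (auto simp: le_max_iff_disj)
    show "case_prod (on_state u1) \<in> borel_measurable (borel \<Otimes>\<^sub>M borel)"
      "case_prod (on_state u2) \<in> borel_measurable (borel \<Otimes>\<^sub>M borel)"
      using L2 on_state_borel by blast+
    show "set_integrable lborel {0..1} (\<lambda>y. on_state u1 y t)" "set_integrable lborel {0..1} (\<lambda>y. on_state u2 y t)"
      if "0 \<le> t" for t using that L2 on_state_slice by blast+
    show "set_integrable (lborel \<Otimes>\<^sub>M lborel) ({0..T} \<times> {0..1}) (\<lambda>(t, y). on_state u1 y t)"
      "set_integrable (lborel \<Otimes>\<^sub>M lborel) ({0..T} \<times> {0..1}) (\<lambda>(t, y). on_state u2 y t)" for T
      using L2 on_state_strip by blast+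
    have "transport_along_characteristics \<epsilon>1 (\<lambda>t. 1) state_domain u1 (\<lambda>x t. c1 x * u2 x t)"
      using sol by blast
    then show "transport_along_characteristics e1 (\<lambda>t. 1) state_domain (on_state u1) (\<lambda>x t. d1 x * on_state u2 x t)"
      by (rule transport_along_characteristics_cong) (auto simp: state_domain_def coeff)
    have "transport_along_characteristics (\<lambda>x. - \<epsilon>2 x) (\<lambda>t. 1) state_domain u2 (\<lambda>x t. c2 x * u1 x t)"
      using sol by blast
    then show "transport_along_characteristics (\<lambda>x. - e2 x) (\<lambda>t. 1) state_domain (on_state u2) (\<lambda>x t. d2 x * on_state u1 x t)"
      by (rule transport_along_characteristics_cong) (auto simp: state_domain_def coeff)
    show "0 < \<tau>" by fact
    show "case_prod K1 \<in> borel_measurable (borel \<Otimes>\<^sub>M borel)" "case_prod K2 \<in> borel_measurable (borel \<Otimes>\<^sub>M borel)"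
      unfolding K1_def[abs_def] K2_def[abs_def] using kernel triangle_kernel(1) by blast+
    show "case_prod A1 \<in> borel_measurable (borel \<Otimes>\<^sub>M borel)" "case_prod A2 \<in> borel_measurable (borel \<Otimes>\<^sub>M borel)"
      unfolding A1_def[abs_def] A2_def[abs_def] using delay borel_on_set by blast+
    have "\<bar>A1 x y\<bar> \<le> \<bar>M\<bar>" "\<bar>A2 x y\<bar> \<le> \<bar>M\<bar>" for x y
      using M[of x y] by (auto simp: A1_def A2_def indicator_def)
    then have "\<bar>K1 x y\<bar> \<le> B1 + B2 + \<bar>M\<bar> \<and> \<bar>K2 x y\<bar> \<le> B1 + B2 + \<bar>M\<bar> \<and>
        \<bar>A1 x y\<bar> \<le> B1 + B2 + \<bar>M\<bar> \<and> \<bar>A2 x y\<bar> \<le> B1 + B2 + \<bar>M\<bar>" for x y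
      using B1(2)[of x y] B2(2)[of x y] B1(1) B2(1) by (smt (verit))
    then show "\<exists>B. \<forall>x y. \<bar>K1 x y\<bar> \<le> B \<and> \<bar>K2 x y\<bar> \<le> B \<and> \<bar>A1 x y\<bar> \<le> B \<and> \<bar>A2 x y\<bar> \<le> B"
      by blast
    have tri: "0 \<le> x \<and> x \<le> 1 \<and> 0 \<le> y \<and> y \<le> 1" if "(x, y) \<in> kernel_triangle" for x y
      using that by (auto simp: kernel_triangle_def)
    have "transport_along_characteristics \<epsilon>2 (\<lambda>y. - \<epsilon>1 y) kernel_triangle
      (\<lambda>x y. \<epsilon>1 y * K21 x y) (\<lambda>x y. \<epsilon>1 y * (c2 y * K22 x y))" using kernel by blast
    then show "transport_along_characteristics e2 (\<lambda>y. - e1 y) kernel_triangle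
      (\<lambda>x y. e1 y * K1 x y) (\<lambda>x y. e1 y * (d2 y * K2 x y))"
      by (rule transport_along_characteristics_cong) (use tri in \<open>auto simp: K_eq coeff\<close>)
    have "transport_along_characteristics \<epsilon>2 \<epsilon>2 kernel_triangle
      (\<lambda>x y. \<epsilon>2 y * K22 x y) (\<lambda>x y. \<epsilon>2 y * (c1 y * K21 x y))" using kernel by blast
    then show "transport_along_characteristics e2 e2 kernel_triangle
      (\<lambda>x y. e2 y * K2 x y) (\<lambda>x y. e2 y * (d1 y * K1 x y))"
      by (rule transport_along_characteristics_cong) (use tri in \<open>auto simp: K_eq coeff\<close>)
    have "transport_along_characteristics (\<lambda>x. 1 / \<tau>) (\<lambda>y. - \<epsilon>1 y) kernel_square
      (\<lambda>x y. \<epsilon>1 y * \<alpha>1 x y) (\<lambda>x y. \<epsilon>1 y * (c2 y * \<alpha>2 x y))" using delay by blast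
    then show "transport_along_characteristics (\<lambda>x. 1 / \<tau>) (\<lambda>y. - e1 y) kernel_square
      (\<lambda>x y. e1 y * A1 x y) (\<lambda>x y. e1 y * (d2 y * A2 x y))"
      by (rule transport_along_characteristics_cong) (auto simp: kernel_square_def A_eq coeff)
    have "transport_along_characteristics (\<lambda>x. 1 / \<tau>) \<epsilon>2 kernel_square
      (\<lambda>x y. \<epsilon>2 y * \<alpha>2 x y) (\<lambda>x y. \<epsilon>2 y * (c1 y * \<alpha>1 x y))" using delay by blast
    then show "transport_along_characteristics (\<lambda>x. 1 / \<tau>) e2 kernel_square
      (\<lambda>x y. e2 y * A2 x y) (\<lambda>x y. e2 y * (d1 y * A1 x y))"
      by (rule transport_along_characteristics_cong) (auto simp: kernel_square_def A_eq coeff)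
    show "K1 x x = - d2 x / (e1 x + e2 x)" "e2 0 * K2 x 0 = q * e1 0 * K1 x 0"
      "e2 0 * A2 x 0 = q * e1 0 * A1 x 0" if "x \<in> {0..1}" for x
      using that kernel delay by (simp_all add: K_eq A_eq coeff kernel_triangle_def)
    show "A1 x 1 = 0" if "x \<in> {0<..1}" for x
      using that delay by (simp add: A_eq)
    show "A1 0 y = K1 1 y" if "y \<in> {0..<1}" for y
      using that delay by (simp add: A_eq K_eq kernel_triangle_def)
    show "A2 0 y = K2 1 y" if "y \<in> {0..1}" for y
      using that delay by (simp add: A_eq K_eq kernel_triangle_def)
    have "AE t in lborel. 0 < t \<longrightarrow> u1 0 t = q * u2 0 t" using sol by blast
    then show "AE t in lborel. 0 < t \<longrightarrow> on_state u1 0 t = q * on_state u2 0 t"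
      by eventually_elim simp
  qed
  \<comment> \<open>The delay line moves its contents unchanged, and what sits at position
    \<open>y\<close> leaves it after the time \<open>\<tau> * y\<close>.\<close>
  have v_line: "v 0 (s + \<tau> * y) = v y s" if "0 \<le> y" "y \<le> 1" "0 \<le> s" for y s
  proof -
    have "transport_along_characteristics (\<lambda>x. - 1) (\<lambda>t. \<tau>) state_domain v (\<lambda>x t. 0)" using sol by blast
    then have "primitive_on 0 y (\<lambda>\<sigma>. v (y - \<sigma>) (s + \<tau> * \<sigma>)) (\<lambda>\<sigma>. 0)"
      by (rule transport_primitive_on)
        (use that \<tau>_pos in \<open>auto intro!: derivative_eq_intros simp: state_domain_def\<close>)
    from primitive_on_eq[OF this \<open>0 \<le> y\<close>] show ?thesis by simp
  qed
  have inlet: "AE s in lborel. 0 < s \<longrightarrow> u2 1 s = v 0 s" using sol by blast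
  have law: "AE s in lborel. 0 < s \<longrightarrow> v 1 s = control_law (delay_gain \<tau> \<epsilon>2 \<alpha>2) \<alpha>1 \<alpha>2 u1 u2 v s"
    using sol by blast
  note [measurable] = on_state_borel[OF L2(3)]
  \<comment> \<open>What the delay line contains at time \<open>s\<close> is the inlet value of
    \<open>u2\<close> at time \<open>s + \<tau> * y\<close>, for almost every \<open>y\<close>.
    Substituting \<open>c = \<tau> * (1 - y)\<close> uses up the factor \<tau> of
    \<open>delay_gain\<close> as Jacobian.\<close>
  have delay_term: "(LBINT y:{0..1}. delay_gain \<tau> \<epsilon>2 \<alpha>2 (1 - y) * v y s) =
      (LBINT c:{0..\<tau>}. e2 1 * A2 (c / \<tau>) 1 * on_state u2 1 (s + \<tau> - c))" if s: "0 < s" for s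
  proof -
    let ?f = "\<lambda>c. indicator {0..\<tau>} c *\<^sub>R (e2 1 * A2 (c / \<tau>) 1 * on_state u2 1 (s + \<tau> - c))"
    have "(LBINT y:{0..1}. delay_gain \<tau> \<epsilon>2 \<alpha>2 (1 - y) * v y s) =
        (LBINT y:{0..1}. \<tau> * e2 1 * A2 (1 - y) 1 * on_state v y s)"
      by (rule set_lebesgue_integral_cong) (use s in \<open>auto simp: delay_gain_def A_eq coeff\<close>)
    also have "\<dots> = (LBINT y:{0..1}. \<tau> * e2 1 * A2 (1 - y) 1 * on_state u2 1 (s + \<tau> * y))"
    proof (rule set_lebesgue_integral_cong_AE)
      have "AE y in lborel. 0 < s + \<tau> * y \<longrightarrow> u2 1 (s + \<tau> * y) = v 0 (s + \<tau> * y)"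
        using AE_lborel_affine[OF inlet, of \<tau> s] \<tau>_pos by simp
      then show "AE y\<in>{0..1} in lborel. \<tau> * e2 1 * A2 (1 - y) 1 * on_state v y s =
          \<tau> * e2 1 * A2 (1 - y) 1 * on_state u2 1 (s + \<tau> * y)"
      proof eventually_elim
        case (elim y)
        have "0 < s + \<tau> * y" if "y \<in> {0..1}" using that s \<tau>_pos by (simp add: add_pos_nonneg)
        then show ?case using elim v_line[of y s] s by auto
      qed
    qed measurable
    also have "\<dots> = \<bar>- \<tau>\<bar> *\<^sub>R (LBINT y. ?f (\<tau> + - \<tau> * y))"
    proof -
      have eq: "indicator {0..1} y *\<^sub>R (\<tau> * e2 1 * A2 (1 - y) 1 * on_state u2 1 (s + \<tau> * y)) =
          \<bar>- \<tau>\<bar> * ?f (\<tau> + - \<tau> * y)" for y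
      proof -
        have "\<tau> + - \<tau> * y \<in> {0..\<tau>} \<longleftrightarrow> y \<in> {0..1}"
          using \<tau>_pos by (auto simp: mult_le_cancel_left1 zero_le_mult_iff)
        then have "indicat_real {0..\<tau>} (\<tau> + - \<tau> * y) = indicator {0..1} y"
          by (simp only: indicator_def)
        moreover have "(\<tau> + - \<tau> * y) / \<tau> = 1 - y" using \<tau>_pos by (simp add: field_simps)
        moreover have "s + \<tau> - (\<tau> + - \<tau> * y) = s + \<tau> * y" by simp
        ultimately show ?thesis using \<tau>_pos by (simp only: real_scaleR_def mult_ac) simp
      qed
      show ?thesis
        unfolding set_lebesgue_integral_def eq
        by (rule trans[OF integral_mult_right_zero]) simp
    qed
    also have "\<dots> = (LBINT c. ?f c)"
      using \<tau>_pos by (intro lborel_integral_real_affine[symmetric]) simp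
    finally show ?thesis by (simp add: set_lebesgue_integral_def)
  qed
  \<comment> \<open>One control value is followed: computed at time \<open>s - horizon\<close>, it
    enters the plant at \<open>s - \<phi>2 1\<close>, and the characteristic starting there reaches
    \<open>y = 0\<close> at \<open>s\<close>. Shifting the two boundary relations by these amounts
    preserves null sets.\<close>
  have "AE s in lborel. horizon < s \<longrightarrow> on_state u2 0 s = 0"
  proof -
    have "AE s in lborel. 0 < s - \<phi>2 1 \<longrightarrow> u2 1 (s - \<phi>2 1) = v 0 (s - \<phi>2 1)"
      using AE_lborel_affine[OF inlet, of 1 "- \<phi>2 1"] by simp
    moreover have "AE s in lborel. 0 < s - horizon \<longrightarrow>
        v 1 (s - horizon) = control_law (delay_gain \<tau> \<epsilon>2 \<alpha>2) \<alpha>1 \<alpha>2 u1 u2 v (s - horizon)"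
      using AE_lborel_affine[OF law, of 1 "- horizon"] by simp
    ultimately show ?thesis
    proof eventually_elim
      case (elim s)
      show ?case
      proof
        assume s: "horizon < s"
        then have pos: "0 < s - \<phi>2 1" "0 < s - horizon" using horizon_bounds by auto
        have shift: "s - horizon + \<tau> = s - \<phi>2 1" by (simp add: horizon_def)
        have "on_state u2 1 (s - \<phi>2 1) = v 0 (s - \<phi>2 1)" using elim pos by simp
        also have "\<dots> = v 1 (s - horizon)" using v_line[of 1 "s - horizon"] pos shift by simp
        also have "\<dots> = control_law (delay_gain \<tau> \<epsilon>2 \<alpha>2) \<alpha>1 \<alpha>2 u1 u2 v (s - horizon)"
          using elim pos by simp
        also have "\<dots> = (LBINT c:{0..\<tau>}. e2 1 * A2 (c / \<tau>) 1 * on_state u2 1 (s - \<phi>2 1 - c)) +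
            (LBINT y:{0..1}. A1 1 y * on_state u1 y (s - horizon)) +
            (LBINT y:{0..1}. A2 1 y * on_state u2 y (s - horizon))"
          unfolding control_law_def delay_term[OF pos(2)] shift
          using pos by (intro arg_cong2[where f = "(+)"] refl set_lebesgue_integral_cong) (auto simp: A_eq)
        finally show "on_state u2 0 s = 0" by (rule outflow_vanishes[OF s])
      qed
    qed
  qed
  then have "AE s in lborel. horizon < s \<longrightarrow> on_state u1 0 s = 0 \<and> on_state u2 0 s = 0"
    using reflection by eventually_elim (use horizon_bounds in auto)
  then have "AE c in lborel. \<forall>x\<in>{0..1}. horizon \<le> c \<longrightarrow> on_state u1 x (c + \<phi>1 x) = 0"
    and u2_zero: "AE c in lborel. \<forall>x\<in>{0..1}. horizon + \<phi>1 x + \<phi>2 x \<le> c \<longrightarrow> on_state u2 x (c - \<phi>2 x) = 0"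
    using sideways_uniqueness[of horizon] horizon_bounds by auto
  \<comment> \<open>From here \<open>t\<close> is fixed. The first-family line through
    \<open>x\<close> at time \<open>t\<close> has label \<open>t - \<phi>1 x\<close>, so a property
    of almost all lines becomes one of almost all \<open>x\<close>; \<open>x'\<close> will be taken
    equal to \<open>x\<close>. For \<open>u2\<close> the label is
    \<open>t + \<phi>2 x\<close>.\<close>
  then have u1_ae: "AE x in lborel. \<forall>x'\<in>{0..1}. horizon \<le> t - \<phi>1 x \<longrightarrow> on_state u1 x' (t - \<phi>1 x + \<phi>1 x') = 0"
    by (intro s1.AE_falling)
  have u2_ae: "AE x in lborel. \<forall>x'\<in>{0..1}. horizon + \<phi>1 x' + \<phi>2 x' \<le> t + \<phi>2 x \<longrightarrow>
      on_state u2 x' (t + \<phi>2 x - \<phi>2 x') = 0"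
    using u2_zero by (rule s2.AE_rising)
  have inlet_ae: "AE x in lborel. 0 < t + \<tau> * x \<longrightarrow> u2 1 (t + \<tau> * x) = v 0 (t + \<tau> * x)"
    using AE_lborel_affine[OF inlet, of \<tau> t] \<tau>_pos by simp
  \<comment> \<open>Prepares \<open>v\<close>: its value at position \<open>x\<close> and time
    \<open>t\<close> is that of \<open>u2\<close> at \<open>y = 1\<close> and time
    \<open>t + \<tau> * x\<close>, whose line has label
    \<open>t + \<phi>2 1 + \<tau> * x\<close>.\<close>
  have u2_inlet_ae: "AE x in lborel. \<forall>x'\<in>{0..1}. horizon + \<phi>1 x' + \<phi>2 x' \<le> t + \<phi>2 1 + \<tau> * x \<longrightarrow>
      on_state u2 x' (t + \<phi>2 1 + \<tau> * x - \<phi>2 x') = 0"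
    using AE_lborel_affine[OF u2_zero, of \<tau> "t + \<phi>2 1"] \<tau>_pos by simp
  have "integral {0..1} (\<lambda>y. 1 / \<epsilon>1 y + 1 / \<epsilon>2 y) = \<phi>1 1 + \<phi>2 1"
    unfolding \<phi>1(2) \<phi>2(2)
    by (intro Henstock_Kurzweil_Integration.integral_add integrable_continuous_real continuous_intros assms(3,4))
      (use assms(7,8) in force)+
  \<comment> \<open>Zero data reach position \<open>x\<close> after the further time
    \<open>\<phi>1 x\<close>, and \<phi>1 1 is the largest of these times.\<close>
  then have t': "horizon + \<phi>1 1 \<le> t" using t by (simp add: horizon_def)
  have "AE x in lborel. x \<in> {0..1} \<longrightarrow> u1 x t = 0 \<and> u2 x t = 0 \<and> v x t = 0"
    using u1_ae u2_ae inlet_ae u2_inlet_ae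
  proof eventually_elim
    case (elim x)
    show ?case
    proof
      assume x: "x \<in> {0..1}"
      have \<phi>: "\<phi>1 x \<le> \<phi>1 1" and t0: "0 \<le> t" "0 < t" using x t' horizon_bounds by auto
      have "u1 x t = 0" using elim(1)[rule_format, OF x] \<phi> t' t0 x by (simp del: s1.travel_le_iff)
      moreover have "u2 x t = 0" using elim(2)[rule_format, OF x] \<phi> t' t0 x by (simp del: s1.travel_le_iff)
      moreover have "v x t = 0"
      proof -
        have nn: "0 \<le> \<tau> * x" using x \<tau>_pos by simp
        have "v x t = u2 1 (t + \<tau> * x)" using elim(3) v_line[of x t] x t0 nn by simp
        also have "\<dots> = 0" using elim(4)[rule_format, of 1] t' t0 nn by simp
        finally show ?thesis .
      qed
      ultimately show "u1 x t = 0 \<and> u2 x t = 0 \<and> v x t = 0" by blast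
    qed
  qed
  then show "AE x in lebesgue. x \<in> {0..1} \<longrightarrow> u1 x t = 0 \<and> u2 x t = 0 \<and> v x t = 0"
    by (simp add: AE_completion_iff)
qed

end
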